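(* Assume that $S>0$, $0\le P<\lambda_1$, that $g\in C^0(\mathbb{R}_+,L^2(\Omega))$ satisfies $g_\infty:=\limsup_{t\to\infty}\|g(t)\|_{L^2}<+\infty$, and that $g$ is even with respect to $y$. There exists $\delta_0=\delta_0(g_\infty,S,P,\lambda_1)>0$ such that if $\delta>\delta_0$, then there exists $\eta>0$ such that $$\lim_{t\to\infty}e^{\eta t}\Big(\|u^T_t(t)\|_{L^2}^2+\|u^T(t)\|_{H^2_*}^2\Big)=0$$ for any solution $u$ of the plate problem.
   Context: Domain and spaces: $\Omega=(0,\pi)\times(-\ell,\ell)\subset\mathbb{R}^2$ with $0<\ell\ll\pi$ fixed, $\xi=(x,y)\in\Omega$, and the Poisson ratio is $\sigma=0.2$. $H^2_*(\Omega)=\{U\in H^2(\Omega):U=0\text{ on }\{0,\pi\}\times[-\ell,\ell]\}$, a Hilbert space with inner product $(U,V)_{H^2_*}=\int_\Omega\big(\Delta U\Delta V-(1-\sigma)(U_{xx}V_{yy}+U_{yy}V_{xx}-2U_{xy}V_{xy})\big)$ and norm $\|\cdot\|_{H^2_*}$; $(H^2_*(\Omega))'$ is its dual, $\langle\cdot,\cdot\rangle$ the duality pairing, $(\cdot,\cdot)_{L^2}$ the inner product of $L^2(\Omega)$. $\lambda_1=\min_{0\ne v\in H^2_*(\Omega)}\|v\|_{H^2_*}^2/\|v\|_{L^2}^2$. Plate problem: $u_{tt}+\delta u_t+\Delta^2u+\big[P-S\int_\Omega u_x^2\big]u_{xx}=g(\xi,t)$ in $\Omega$, with boundary conditions $u=u_{xx}=0$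 on $\{0,\pi\}\times[-\ell,\ell]$ and $u_{yy}+\sigma u_{xx}=u_{yyy}+(2-\sigma)u_{xxy}=0$ on $[0,\pi]\times\{-\ell,\ell\}$. Solution means (global) weak solution: $u\in C^0(\mathbb{R}_+,H^2_*(\Omega))\cap C^1(\mathbb{R}_+,L^2(\Omega))\cap C^2(\mathbb{R}_+,(H^2_*(\Omega))')$ with $\langle u_{tt},v\rangle+\delta(u_t,v)_{L^2}+(u,v)_{H^2_*}+\big[S\|u_x\|_{L^2}^2-P\big](u_x,v_x)_{L^2}=(g,v)_{L^2}$ for all $t\ge0$ and all $v\in H^2_*(\Omega)$ (no initial data prescribed). For a function $u$ of $(x,y,t)$, $u^T(x,y,t)=\frac{u(x,y,t)-u(x,-y,t)}2$ denotes its torsional part. *)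

theory Defs
  imports "HOL-Analysis.Analysis"
begin

text \<open>Elements of Lebesgue and Sobolev spaces are represented by functions on the whole space, of
  which only the values on \<open>\<Omega>\<close> (up to null sets) matter; the norms below are therefore
  seminorms on functions.\<close>

definition L2_space :: "'a::euclidean_space set \<Rightarrow> ('a \<Rightarrow> real) set" where
  "L2_space \<Omega> = {f \<in> borel_measurable (lebesgue_on \<Omega>). integrable (lebesgue_on \<Omega>) (\<lambda>z. (f z)\<^sup>2)}"

definition L2_inner :: "'a::euclidean_space set \<Rightarrow> ('a \<Rightarrow> real) \<Rightarrow> ('a \<Rightarrow> real) \<Rightarrow> real" where
  "L2_inner \<Omega> f h = (\<integral>z. f z * h z \<partial>(lebesgue_on \<Omega>))"

definition L2_norm :: "'a::euclidean_space set \<Rightarrow> ('a \<Rightarrow> real) \<Rightarrow> real" where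
  "L2_norm \<Omega> f = sqrt (L2_inner \<Omega> f f)"

text \<open>\<open>dir_derivs [e\<^sub>1, \<dots>, e\<^sub>k] f\<close> is the iterated directional derivative
  \<open>\<partial>\<^bsub>e\<^sub>1\<^esub> \<dots> \<partial>\<^bsub>e\<^sub>k\<^esub> f\<close>.\<close>

definition dir_derivs :: "'a::euclidean_space list \<Rightarrow> ('a \<Rightarrow> real) \<Rightarrow> 'a \<Rightarrow> real" where
  "dir_derivs es f = foldr (\<lambda>e h z. frechet_derivative h (at z) e) es f"

definition test_function :: "'a::euclidean_space set \<Rightarrow> ('a \<Rightarrow> real) \<Rightarrow> bool" where
  "test_function \<Omega> \<phi> \<longleftrightarrow>
     (\<forall>es z. dir_derivs es \<phi> differentiable (at z)) \<and>
     compact (closure {z. \<phi> z \<noteq> 0}) \<and> closure {z. \<phi> z \<noteq> 0} \<subseteq> \<Omega>"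

definition is_weak_deriv ::
  "'a::euclidean_space set \<Rightarrow> 'a list \<Rightarrow> ('a \<Rightarrow> real) \<Rightarrow> ('a \<Rightarrow> real) \<Rightarrow> bool" where
  "is_weak_deriv \<Omega> es f h \<longleftrightarrow> h \<in> L2_space \<Omega> \<and>
     (\<forall>\<phi>. test_function \<Omega> \<phi> \<longrightarrow>
        L2_inner \<Omega> f (dir_derivs es \<phi>) = (- 1) ^ length es * L2_inner \<Omega> h \<phi>)"

definition H2_space :: "'a::euclidean_space set \<Rightarrow> ('a \<Rightarrow> real) set" where
  "H2_space \<Omega> = {f \<in> L2_space \<Omega>.
     \<forall>es. set es \<subseteq> Basis \<and> length es \<le> 2 \<longrightarrow> (\<exists>h. is_weak_deriv \<Omega> es f h)}"

text \<open>The choice below is unique up to a null set.\<close>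

definition weak_deriv :: "'a::euclidean_space set \<Rightarrow> 'a list \<Rightarrow> ('a \<Rightarrow> real) \<Rightarrow> 'a \<Rightarrow> real" where
  "weak_deriv \<Omega> es f = (SOME h. is_weak_deriv \<Omega> es f h)"

definition plate :: "real \<Rightarrow> (real \<times> real) set" where
  "plate l = {0<..<pi} \<times> {-l<..<l}"

definition weak_x :: "real \<Rightarrow> (real \<times> real \<Rightarrow> real) \<Rightarrow> real \<times> real \<Rightarrow> real" where
  "weak_x l = weak_deriv (plate l) [(1, 0)]"

definition weak_xx :: "real \<Rightarrow> (real \<times> real \<Rightarrow> real) \<Rightarrow> real \<times> real \<Rightarrow> real" where
  "weak_xx l = weak_deriv (plate l) [(1, 0), (1, 0)]"

definition weak_xy :: "real \<Rightarrow> (real \<times> real \<Rightarrow> real) \<Rightarrow> real \<times> real \<Rightarrow> real" where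
  "weak_xy l = weak_deriv (plate l) [(1, 0), (0, 1)]"

definition weak_yy :: "real \<Rightarrow> (real \<times> real \<Rightarrow> real) \<Rightarrow> real \<times> real \<Rightarrow> real" where
  "weak_yy l = weak_deriv (plate l) [(0, 1), (0, 1)]"

text \<open>In dimension two, \<open>H\<^sup>2\<close> functions have a representative that is continuous up to the
  boundary; the condition \<open>U = 0\<close> on the two short edges refers to that representative.\<close>

definition H2_star :: "real \<Rightarrow> (real \<times> real \<Rightarrow> real) set" where
  "H2_star l = {U \<in> H2_space (plate l).
     \<exists>W. continuous_on ({0..pi} \<times> {-l..l}) W \<and>
         (AE z in lebesgue_on (plate l). U z = W z) \<and>
         (\<forall>z \<in> {0, pi} \<times> {-l..l}. W z = 0)}"

definition poisson_ratio :: real where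
  "poisson_ratio = 0.2"

definition H2_star_inner ::
  "real \<Rightarrow> (real \<times> real \<Rightarrow> real) \<Rightarrow> (real \<times> real \<Rightarrow> real) \<Rightarrow> real" where
  "H2_star_inner l U V =
     (\<integral>z. (weak_xx l U z + weak_yy l U z) * (weak_xx l V z + weak_yy l V z)
          - (1 - poisson_ratio) *
              (weak_xx l U z * weak_yy l V z + weak_yy l U z * weak_xx l V z
               - 2 * weak_xy l U z * weak_xy l V z)
        \<partial>(lebesgue_on (plate l)))"

definition H2_star_norm :: "real \<Rightarrow> (real \<times> real \<Rightarrow> real) \<Rightarrow> real" where
  "H2_star_norm l U = sqrt (H2_star_inner l U U)"

text \<open>The minimum of the Rayleigh quotient (it is attained). A function is a nonzero element of
  the space when its \<open>L\<^sup>2\<close> norm does not vanish.\<close>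

definition lambda1 :: "real \<Rightarrow> real" where
  "lambda1 l = Inf {(H2_star_norm l v)\<^sup>2 / (L2_norm (plate l) v)\<^sup>2 | v.
                      v \<in> H2_star l \<and> L2_norm (plate l) v \<noteq> 0}"

text \<open>Bounded linear functionals on \<open>H2_star\<close>; their values outside \<open>H2_star\<close> are irrelevant.\<close>

definition H2_star_dual :: "real \<Rightarrow> ((real \<times> real \<Rightarrow> real) \<Rightarrow> real) set" where
  "H2_star_dual l = {\<psi>.
     (\<forall>v \<in> H2_star l. \<forall>w \<in> H2_star l. \<forall>a b.
        \<psi> (\<lambda>z. a * v z + b * w z) = a * \<psi> v + b * \<psi> w) \<and>
     (\<exists>C. \<forall>v \<in> H2_star l. \<bar>\<psi> v\<bar> \<le> C * H2_star_norm l v)}"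

definition dual_norm :: "real \<Rightarrow> ((real \<times> real \<Rightarrow> real) \<Rightarrow> real) \<Rightarrow> real" where
  "dual_norm l \<psi> = (SUP v \<in> {v \<in> H2_star l. H2_star_norm l v \<le> 1}. \<bar>\<psi> v\<bar>)"

text \<open>Continuity and differentiability of curves \<open>[0, \<infinity>) \<rightarrow> X\<close> with respect to a seminorm \<open>N\<close>,
  where \<open>X\<close> consists of real-valued functions; at time 0 the limits are one-sided.\<close>

definition C0_curve :: "('x \<Rightarrow> real) set \<Rightarrow> (('x \<Rightarrow> real) \<Rightarrow> real) \<Rightarrow> (real \<Rightarrow> 'x \<Rightarrow> real) \<Rightarrow> bool" where
  "C0_curve X N w \<longleftrightarrow> (\<forall>t\<ge>0. w t \<in> X \<and>
     ((\<lambda>s. N (\<lambda>z. w s z - w t z)) \<longlongrightarrow> 0) (at t within {0..}))"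

definition has_time_deriv ::
  "(('x \<Rightarrow> real) \<Rightarrow> real) \<Rightarrow> (real \<Rightarrow> 'x \<Rightarrow> real) \<Rightarrow> (real \<Rightarrow> 'x \<Rightarrow> real) \<Rightarrow> bool" where
  "has_time_deriv N w w' \<longleftrightarrow> (\<forall>t\<ge>0.
     ((\<lambda>s. N (\<lambda>z. (w s z - w t z) / (s - t) - w' t z)) \<longlongrightarrow> 0) (at t within {0..}))"

text \<open>\<open>ut\<close> is the \<open>L\<^sup>2\<close> time derivative of \<open>u\<close>. The second time derivative \<open>utt\<close> lives in the
  dual space, into which \<open>L\<^sup>2\<close> is embedded by \<open>w \<mapsto> (w, \<cdot>)\<close>.\<close>

definition weak_solution ::
  "real \<Rightarrow> real \<Rightarrow> real \<Rightarrow> real \<Rightarrow> (real \<Rightarrow> real \<times> real \<Rightarrow> real) \<Rightarrow>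
   (real \<Rightarrow> real \<times> real \<Rightarrow> real) \<Rightarrow> (real \<Rightarrow> real \<times> real \<Rightarrow> real) \<Rightarrow> bool" where
  "weak_solution l \<delta> S P g u ut \<longleftrightarrow>
     C0_curve (H2_star l) (H2_star_norm l) u \<and>
     has_time_deriv (L2_norm (plate l)) u ut \<and>
     C0_curve (L2_space (plate l)) (L2_norm (plate l)) ut \<and>
     (\<exists>utt. has_time_deriv (dual_norm l) (\<lambda>t. L2_inner (plate l) (ut t)) utt \<and>
        C0_curve (H2_star_dual l) (dual_norm l) utt \<and>
        (\<forall>t\<ge>0. \<forall>v \<in> H2_star l.
           utt t v + \<delta> * L2_inner (plate l) (ut t) v + H2_star_inner l (u t) v
           + (S * (L2_norm (plate l) (weak_x l (u t)))\<^sup>2 - P)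
               * L2_inner (plate l) (weak_x l (u t)) (weak_x l v)
           = L2_inner (plate l) (g t) v))"

definition even_in_y :: "real \<Rightarrow> (real \<times> real \<Rightarrow> real) \<Rightarrow> bool" where
  "even_in_y l f \<longleftrightarrow> (AE (x, y) in lebesgue_on (plate l). f (x, - y) = f (x, y))"

definition torsional :: "(real \<times> real \<Rightarrow> real) \<Rightarrow> real \<times> real \<Rightarrow> real" where
  "torsional f = (\<lambda>(x, y). (f (x, y) - f (x, - y)) / 2)"

end

theory Submission
  imports Defs "HOL-Real_Asymp.Real_Asymp"
begin

text \<open>The torsional part \<open>w\<close> of a solution \<open>u\<close> satisfies a linear homogeneous equation: the projection
  \<open>torsional\<close> commutes with the plate operator, it annihilates the even forcing, and the nonlinearity
  enters only through the scalar coefficient \<open>\<alpha> = S * \<parallel>u\<^sub>x\<parallel>\<^sup>2 - P\<close> of \<open>w\<^sub>x\<^sub>x\<close>. Two facts then give exponential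
  decay for large damping.

  First, \<open>\<alpha>\<close> is eventually bounded in terms of the data alone, uniformly in \<open>\<delta> \<ge> 2\<close>
  (\<open>eventually_stretch_bounded\<close>). The Lyapunov function is the energy of \<open>u\<close> plus \<open>1 / \<delta>\<close> times the
  multiplier functional \<open>(u\<^sub>t, u) + \<delta> / 2 * \<parallel>u\<parallel>\<^sup>2\<close>; the quartic term of the energy controls \<open>\<parallel>u\<^sub>x\<parallel>\<close>.

  Second, the torsional part is subject to \<open>\<alpha> \<ge> - P\<close> and to the coercivity of \<open>\<parallel>w\<parallel>\<^sup>2 - P * \<parallel>w\<^sub>x\<parallel>\<^sup>2\<close>, in the
  energy norm, for \<open>P\<close> below the first eigenvalue (\<open>torsional_coercivity\<close>). In the Lyapunov function
  \<open>(\<parallel>w\<^sub>t\<parallel>\<^sup>2 + \<parallel>w\<parallel>\<^sup>2) / 2 + \<delta> / 4 * ((w\<^sub>t, w) + \<delta> / 2 * \<parallel>w\<parallel>\<^sup>2)\<close>, with the energy norm in the first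
  and the \<open>L\<^sup>2\<close> norm in the last term, the coefficient contributes only \<open>\<alpha>\<^sup>2 / \<delta>\<close> times the energy, because
  \<open>\<alpha> (w\<^sub>x\<^sub>x, w\<^sub>t)\<close> is absorbed by the damping. The multiplier \<open>w\<close> dissipates a multiple of \<open>\<delta>\<close> times the energy,
  which wins for large \<open>\<delta>\<close> (\<open>torsional_decay\<close>).

  The analytic input is the following. Integration by parts in \<open>x\<close>, \<open>(v\<^sub>x, w\<^sub>x) = - (v\<^sub>x\<^sub>x, w)\<close>, uses the
  boundary values on the short edges and rests on the absolute continuity of Sobolev functions on
  almost every line (\<open>weak_derivative_slices\<close>, \<open>integration_by_parts\<close>). Coercivity follows from
  the Poincare inequality for odd functions and from the bound \<open>lambda1 l \<le> 1\<close>. Finally, the velocity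
  of a weak solution is not an admissible test function; that the energy is nevertheless
  differentiable, with the expected derivative, is a statement about kernels in two time variables
  (\<open>energy_identity\<close>).\<close>

section \<open>Smooth functions and bumps\<close>

text \<open>Counting derivatives by a number, rather than by lists of directions as \<open>test_function\<close> does,
  turns closure under sums, products and affine substitutions into inductions on \<open>n\<close>.\<close>

primrec Cdiff :: "nat \<Rightarrow> ('a::real_normed_vector \<Rightarrow> real) \<Rightarrow> bool" where
  "Cdiff 0 f = True"
| "Cdiff (Suc n) f = ((\<forall>z. f differentiable (at z)) \<and> (\<forall>e. Cdiff n (\<lambda>z. frechet_derivative f (at z) e)))"

definition smooth :: "('a::real_normed_vector \<Rightarrow> real) \<Rightarrow> bool" where
  "smooth f \<longleftrightarrow> (\<forall>n. Cdiff n f)"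

lemma Cdiff_SucI:
  assumes "\<And>z. (f has_derivative f' z) (at z)" "\<And>e. Cdiff n (\<lambda>z. f' z e)"
  shows "Cdiff (Suc n) f"
proof -
  have "frechet_derivative f (at z) = f' z" for z
    using frechet_derivative_at[OF assms(1)] by simp
  then show ?thesis using assms by (auto simp: differentiable_def)
qed

lemma Cdiff_SucD:
  assumes "Cdiff (Suc n) f"
  shows "(f has_derivative frechet_derivative f (at z)) (at z)"
    "Cdiff n (\<lambda>z. frechet_derivative f (at z) e)"
  using assms by (auto simp: frechet_derivative_works[symmetric])

lemma Cdiff_Suc_imp: "Cdiff (Suc n) f \<Longrightarrow> Cdiff n f"
proof (induction n arbitrary: f)
  case (Suc n)
  show ?case
    by (rule Cdiff_SucI[OF Cdiff_SucD(1)[OF Suc.prems]])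
      (rule Suc.IH[OF Cdiff_SucD(2)[OF Suc.prems]])
qed simp

lemma Cdiff_const: "Cdiff n (\<lambda>_. c)"
  by (induction n arbitrary: c) (auto intro!: Cdiff_SucI[where f' = "\<lambda>_ _. 0"] simp del: Cdiff.simps(2))

lemma Cdiff_add: "Cdiff n f \<Longrightarrow> Cdiff n g \<Longrightarrow> Cdiff n (\<lambda>z. f z + g z)"
proof (induction n arbitrary: f g)
  case (Suc n)
  show ?case
    by (rule Cdiff_SucI[OF has_derivative_add[OF Cdiff_SucD(1) Cdiff_SucD(1)]])
       (use Suc in \<open>auto intro: Suc.IH\<close>)
qed simp

lemma Cdiff_mult: "Cdiff n f \<Longrightarrow> Cdiff n g \<Longrightarrow> Cdiff n (\<lambda>z. f z * g z)"
proof (induction n arbitrary: f g)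
  case (Suc n)
  show ?case
    by (rule Cdiff_SucI[OF has_derivative_mult[OF Cdiff_SucD(1) Cdiff_SucD(1)]])
       (use Suc in \<open>auto intro!: Suc.IH Cdiff_add intro: Cdiff_Suc_imp\<close>)
qed simp

lemma Cdiff_affine:
  assumes "bounded_linear L"
  shows "Cdiff n f \<Longrightarrow> Cdiff n (\<lambda>z. f (L z + b))"
proof (induction n arbitrary: f)
  case (Suc n)
  have L: "((\<lambda>z. L z + b) has_derivative L) (at z)" for z
    using assms by (auto intro!: derivative_eq_intros bounded_linear_imp_has_derivative)
  show ?case
    by (rule Cdiff_SucI[OF has_derivative_compose[OF L Cdiff_SucD(1)]])
       (use Suc in \<open>auto intro: Suc.IH[OF Cdiff_SucD(2)]\<close>)
qed simp

lemma smooth_const: "smooth (\<lambda>_. c)"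
  and smooth_add: "smooth f \<Longrightarrow> smooth g \<Longrightarrow> smooth (\<lambda>z. f z + g z)"
  and smooth_mult: "smooth f \<Longrightarrow> smooth g \<Longrightarrow> smooth (\<lambda>z. f z * g z)"
  by (auto simp: smooth_def Cdiff_const Cdiff_add Cdiff_mult)

lemma smooth_affine:
  "bounded_linear L \<Longrightarrow> smooth f \<Longrightarrow> smooth (\<lambda>z. f (L z + b))"
  by (auto simp: smooth_def Cdiff_affine)

lemma smooth_compose_linear: "bounded_linear L \<Longrightarrow> smooth f \<Longrightarrow> smooth (\<lambda>z. f (L z))"
  using smooth_affine[of L f 0] by simp

lemma smooth_has_derivative:
  "smooth f \<Longrightarrow> (f has_derivative frechet_derivative f (at z)) (at z)"
  unfolding smooth_def by (metis Cdiff_SucD(1))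

lemma smooth_differentiable: "smooth f \<Longrightarrow> f differentiable (at z)"
  using smooth_has_derivative differentiable_def by blast

lemma smooth_frechet: "smooth f \<Longrightarrow> smooth (\<lambda>z. frechet_derivative f (at z) e)"
  unfolding smooth_def by (metis Cdiff_SucD(2))

lemma smooth_continuous_on: "smooth f \<Longrightarrow> continuous_on A f"
  by (meson continuous_at_imp_continuous_on differentiable_imp_continuous_within smooth_differentiable)

lemma smooth_dir_derivs: "smooth f \<Longrightarrow> smooth (dir_derivs es f)"
  by (induction es) (auto simp: dir_derivs_def smooth_frechet)

lemma dir_derivs_Nil [simp]: "dir_derivs [] f = f"
  and dir_derivs_Cons: "dir_derivs (e # es) f = (\<lambda>z. frechet_derivative (dir_derivs es f) (at z) e)"
  by (simp_all add: dir_derivs_def)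

lemma smooth_iff_dir_derivs: "smooth f \<longleftrightarrow> (\<forall>es z. dir_derivs es f differentiable (at z))"
proof
  assume d: "\<forall>es z. dir_derivs es f differentiable (at z)"
  have "Cdiff n (dir_derivs es f)" for n es
  proof (induction n arbitrary: es)
    case (Suc n)
    show ?case
      using d Suc[of "_ # es"] by (auto simp: dir_derivs_Cons)
  qed simp
  from this[of _ "[]"] show "smooth f" by (simp add: smooth_def)
qed (auto intro: smooth_differentiable smooth_dir_derivs)

lemma test_function_iff:
  "test_function \<Omega> \<phi> \<longleftrightarrow>
     smooth \<phi> \<and> compact (closure {z. \<phi> z \<noteq> 0}) \<and> closure {z. \<phi> z \<noteq> 0} \<subseteq> \<Omega>"
  by (simp add: test_function_def smooth_iff_dir_derivs)

lemma frechet_real: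
  "(f has_real_derivative d) (at x) \<Longrightarrow> frechet_derivative f (at x) = (\<lambda>e. d * e)"
  using frechet_derivative_at[of f "\<lambda>e. d * e"] by (simp add: has_field_derivative_def)

lemma smooth_real_deriv:
  fixes f :: "real \<Rightarrow> real"
  assumes "smooth f"
  shows "(f has_real_derivative deriv f x) (at x)" "smooth (deriv f)"
proof -
  show d: "(f has_real_derivative deriv f x) (at x)" for x
    using smooth_differentiable[OF assms]
    by (metis DERIV_deriv_iff_real_differentiable)
  have "deriv f = (\<lambda>x. frechet_derivative f (at x) 1)"
    using frechet_real[OF d] by auto
  then show "smooth (deriv f)" using smooth_frechet[OF assms] by simp
qed

lemma smooth_real_antideriv:
  fixes f :: "real \<Rightarrow> real"
  assumes "\<And>x. (F has_real_derivative f x) (at x)" "smooth f"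
  shows "smooth F"
  unfolding smooth_def
proof
  fix n
  show "Cdiff n F"
  proof (cases n)
    case (Suc m)
    have "Cdiff (Suc m) F"
      by (rule Cdiff_SucI[where f' = "\<lambda>z e. f z * e"])
        (use assms in \<open>auto simp: has_field_derivative_def smooth_def intro: Cdiff_mult Cdiff_const\<close>)
    then show ?thesis by (simp only: Suc)
  qed simp
qed

text \<open>The functions \<open>t\<^sup>-\<^sup>k exp (- 1 / t)\<close>, extended by zero. Only \<open>flat 0\<close> is needed for bumps, but
  its smoothness at the origin is best seen inside a family that differentiation maps into its own
  span.\<close>

definition flat :: "nat \<Rightarrow> real \<Rightarrow> real" where
  "flat k t = (if t > 0 then inverse t ^ k * exp (- inverse t) else 0)"

lemma flat_lim: "((\<lambda>t. flat k t) \<longlongrightarrow> 0) (at 0)"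
proof -
  have "((\<lambda>t. inverse t ^ k / exp (inverse t)) \<longlongrightarrow> (0::real)) (at_right 0)"
    by (rule filterlim_compose[OF tendsto_power_div_exp_0 filterlim_inverse_at_top_right])
  then have "((\<lambda>t. flat k t) \<longlongrightarrow> 0) (at_right 0)"
    by (rule Lim_transform_eventually)
      (auto simp: flat_def eventually_at_filter exp_minus divide_inverse)
  moreover have "((\<lambda>t. flat k t) \<longlongrightarrow> 0) (at_left 0)"
    by (rule Lim_transform_eventually[OF tendsto_const])
      (auto simp: flat_def eventually_at_filter)
  ultimately show ?thesis by (simp add: filterlim_split_at)
qed

text \<open>At the origin the difference quotient of \<open>flat k\<close> is \<open>flat (k + 1)\<close>, which tends to zero.\<close>

lemma flat_deriv:
  "(flat k has_real_derivative flat (k + 2) t - real k * flat (k + 1) t) (at t)"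
proof (cases t "0::real" rule: linorder_cases)
  case less
  have "((\<lambda>_. 0) has_real_derivative 0) (at t)" by simp
  then have "(flat k has_real_derivative 0) (at t)"
    by (rule has_field_derivative_transform_within_open[of _ _ _ "{..<0}"])
      (use less in \<open>auto simp: flat_def\<close>)
  then show ?thesis using less by (simp add: flat_def)
next
  case equal
  have "((\<lambda>t. flat k t / t) \<longlongrightarrow> 0) (at 0)"
    by (rule Lim_transform_eventually[OF flat_lim[of "Suc k"]])
      (auto simp: flat_def eventually_at_filter divide_inverse)
  then show ?thesis using equal
    by (simp add: has_field_derivative_iff flat_def)
next
  case greater
  have "((\<lambda>t. inverse t ^ k * exp (- inverse t)) has_real_derivative
      flat (k + 2) t - real k * flat (k + 1) t) (at t)"
  proof -
    have k: "real k * inverse t ^ (k - 1) * inverse t = real k * inverse t ^ k"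
      by (cases k) auto
    have "((\<lambda>t. inverse t ^ k * exp (- inverse t)) has_real_derivative
        (real k * inverse t ^ (k - 1) * (- (inverse t * inverse t))) * exp (- inverse t)
        + exp (- inverse t) * (inverse t * inverse t) * inverse t ^ k) (at t)"
      using greater by (auto intro!: derivative_eq_intros)
    also have "(real k * inverse t ^ (k - 1) * (- (inverse t * inverse t))) * exp (- inverse t)
        = - (real k * inverse t ^ (k - 1) * inverse t) * inverse t * exp (- inverse t)"
      by (simp add: algebra_simps)
    finally show ?thesis
      using greater unfolding k by (simp add: flat_def algebra_simps)
  qed
  then show ?thesis
    by (rule has_field_derivative_transform_within_open[of _ _ _ "{0<..}"])
      (use greater in \<open>auto simp: flat_def\<close>)
qed

lemma smooth_flat: "smooth (flat k)"
  unfolding smooth_def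
proof
  fix n show "Cdiff n (flat k)"
  proof (induction n arbitrary: k)
    case (Suc n)
    have *: "Cdiff n (\<lambda>z. (flat (k + 2) z + (- real k) * flat (k + 1) z) * e)" for e
      using Suc by (intro Cdiff_mult Cdiff_add Cdiff_const)
    show ?case
      by (rule Cdiff_SucI[where f' = "\<lambda>z e. (flat (k + 2) z + (- real k) * flat (k + 1) z) * e"])
        (use flat_deriv[of k] * in \<open>simp_all add: has_field_derivative_def\<close>)
  qed simp
qed

text \<open>The weak formulation is exploited through products of two such functions, which are the test
  functions on a rectangle that Fubini's theorem can separate. An empty interval \<open>{c..d}\<close> admits the
  zero function on every \<open>{a<..<b}\<close>.\<close>

definition test_fun_on :: "real \<Rightarrow> real \<Rightarrow> (real \<Rightarrow> real) \<Rightarrow> bool" where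
  "test_fun_on a b \<alpha> \<longleftrightarrow> smooth \<alpha> \<and> (\<exists>c d. a < c \<and> d < b \<and> (\<forall>x. x \<notin> {c..d} \<longrightarrow> \<alpha> x = 0))"

text \<open>The shift by 1 keeps the support inside \<open>{a + 1 / n..b - 1 / n}\<close>, hence compact in \<open>{a<..<b}\<close>,
  while the bumps still converge to the indicator of \<open>{a<..<b}\<close>.\<close>

definition bump :: "real \<Rightarrow> real \<Rightarrow> nat \<Rightarrow> real \<Rightarrow> real" where
  "bump a b n x = flat 0 (real n * (x - a) - 1) * flat 0 (real n * (b - x) - 1)"

lemma flat_0_bounds: "0 \<le> flat 0 t" "flat 0 t \<le> 1" "t > 0 \<Longrightarrow> flat 0 t > 0"
  by (auto simp: flat_def)

lemma bump_bounds: "0 \<le> bump a b n x" "bump a b n x \<le> 1"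
  using flat_0_bounds by (auto simp: bump_def intro!: mult_le_one)

lemma smooth_bump: "smooth (bump a b n)"
proof -
  have "smooth (\<lambda>x. flat 0 (real n * x + (- real n * a - 1)) * flat 0 ((- real n) * x + (real n * b - 1)))"
    by (intro smooth_mult smooth_affine smooth_flat bounded_linear_mult_right)
  then show ?thesis
    unfolding bump_def[abs_def] by (simp add: algebra_simps)
qed

lemma bump_supp:
  assumes "bump a b n x \<noteq> 0"
  shows "n > 0" "a + 1 / n < x" "x < b - 1 / n"
proof -
  have "real n * (x - a) > 1" "real n * (b - x) > 1"
    using assms by (auto simp: bump_def flat_def split: if_splits)
  then show "n > 0" "a + 1 / n < x" "x < b - 1 / n"
    by (cases "n = 0"; simp add: field_simps)+
qed

lemma test_fun_bump: "n > 0 \<Longrightarrow> test_fun_on a b (bump a b n)"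
proof -
  assume n: "n > 0"
  have "\<forall>x. x \<notin> {a + 1 / n..b - 1 / n} \<longrightarrow> bump a b n x = 0"
    using bump_supp(2,3)[of a b n] by (meson atLeastAtMost_iff less_imp_le)
  moreover have "a < a + 1 / n" "b - 1 / n < b" using n by auto
  ultimately show "test_fun_on a b (bump a b n)"
    unfolding test_fun_on_def using smooth_bump[of a b n] by blast
qed

lemma test_fun_mono: "test_fun_on a b \<alpha> \<Longrightarrow> a' \<le> a \<Longrightarrow> b \<le> b' \<Longrightarrow> test_fun_on a' b' \<alpha>"
  unfolding test_fun_on_def by (meson order_le_less_trans order_less_le_trans)

lemma test_fun_add: assumes "test_fun_on a b \<alpha>" "test_fun_on a b \<beta>" shows "test_fun_on a b (\<lambda>x. \<alpha> x + c * \<beta> x)"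
proof -
  from assms obtain c1 d1 c2 d2 where *: "a < c1" "d1 < b" "\<forall>x. x \<notin> {c1..d1} \<longrightarrow> \<alpha> x = 0"
     "a < c2" "d2 < b" "\<forall>x. x \<notin> {c2..d2} \<longrightarrow> \<beta> x = 0" unfolding test_fun_on_def by auto
  have "smooth (\<lambda>x. \<alpha> x + c * \<beta> x)"
    using assms by (intro smooth_add smooth_mult smooth_const) (auto simp: test_fun_on_def)
  moreover have "\<alpha> x + c * \<beta> x = 0" if "x \<notin> {min c1 c2..max d1 d2}" for x
  proof -
    have "\<alpha> x = 0" "\<beta> x = 0" using that * by (auto simp: min_def max_def split: if_splits)
    then show ?thesis by simp
  qed
  moreover have "a < min c1 c2" "max d1 d2 < b" using * by auto
  ultimately show ?thesis unfolding test_fun_on_def by blast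
qed

lemma test_fun_zero: "test_fun_on a b \<alpha> \<Longrightarrow> x \<notin> {a<..<b} \<Longrightarrow> \<alpha> x = 0"
  unfolding test_fun_on_def by fastforce

lemma flat_0_tendsto: "c > 0 \<Longrightarrow> (\<lambda>n. flat 0 (real n * c - 1)) \<longlonglongrightarrow> 1"
proof -
  assume c: "c > 0"
  have l: "filterlim (\<lambda>n. real n * c - 1) at_top sequentially"
    using c by real_asymp
  have "((\<lambda>t. flat 0 t) \<longlongrightarrow> 1) at_top"
  proof (rule Lim_transform_eventually)
    have "((\<lambda>t::real. exp (- inverse t)) \<longlongrightarrow> exp (- 0)) at_top"
      by (intro tendsto_intros tendsto_inverse_0_at_top filterlim_ident)
    then show "((\<lambda>t::real. exp (- inverse t)) \<longlongrightarrow> 1) at_top" by simp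
    show "\<forall>\<^sub>F t in at_top. exp (- inverse t) = flat 0 t"
      using eventually_gt_at_top[of 0] by eventually_elim (simp add: flat_def)
  qed
  from filterlim_compose[OF this l] show ?thesis .
qed

lemma bump_tendsto: "(\<lambda>n. bump a b n x) \<longlonglongrightarrow> indicator {a<..<b} x"
proof (cases "a < x \<and> x < b")
  case True
  then show ?thesis unfolding bump_def
    using tendsto_mult[OF flat_0_tendsto[of "x - a"] flat_0_tendsto[of "b - x"]] by simp
next
  case False
  then have "bump a b n x = 0" for n
    using bump_supp[of a b n x] by (smt (verit) divide_nonneg_nonneg of_nat_0_le_iff)
  then show ?thesis using False by auto
qed

lemma test_function_prod:
  assumes "test_fun_on a b \<alpha>" "test_fun_on c d \<beta>"
  shows "test_function ({a<..<b} \<times> {c<..<d}) (\<lambda>z. \<alpha> (fst z) * \<beta> (snd z))"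
proof -
  from assms obtain a1 b1 c1 d1 where *: "a < a1" "b1 < b" "\<forall>x. x \<notin> {a1..b1} \<longrightarrow> \<alpha> x = 0"
     "c < c1" "d1 < d" "\<forall>x. x \<notin> {c1..d1} \<longrightarrow> \<beta> x = 0" unfolding test_fun_on_def by auto
  have "closure {z. \<alpha> (fst z) * \<beta> (snd z) \<noteq> 0} \<subseteq> {a1..b1} \<times> {c1..d1}"
    by (rule closure_minimal) (use * in \<open>auto intro!: closed_Times\<close>)
  moreover have "compact ({a1..b1} \<times> {c1..d1})" by (intro compact_Times) auto
  ultimately have "compact (closure {z. \<alpha> (fst z) * \<beta> (snd z) \<noteq> 0})"
    using closed_closure unfolding compact_eq_bounded_closed by (auto intro: bounded_subset)
  moreover have "{a1..b1} \<times> {c1..d1} \<subseteq> {a<..<b} \<times> {c<..<d}" using * by auto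
  moreover have "smooth (\<lambda>z. \<alpha> (fst z) * \<beta> (snd z))"
    using assms unfolding test_fun_on_def
    by (intro smooth_mult smooth_compose_linear[OF bounded_linear_fst]
        smooth_compose_linear[OF bounded_linear_snd]) auto
  ultimately show ?thesis
    unfolding test_function_iff using \<open>closure _ \<subseteq> {a1..b1} \<times> {c1..d1}\<close> by blast
qed

lemma smooth_prod_deriv:
  fixes \<alpha> \<beta> :: "real \<Rightarrow> real"
  assumes "smooth \<alpha>" "smooth \<beta>"
  shows "frechet_derivative (\<lambda>z. \<alpha> (fst z) * \<beta> (snd z)) (at z) e =
     fst e * (deriv \<alpha> (fst z) * \<beta> (snd z)) + snd e * (\<alpha> (fst z) * deriv \<beta> (snd z))"
proof -
  have "((\<lambda>z. \<alpha> (fst z)) has_derivative (\<lambda>e. deriv \<alpha> (fst z) * fst e)) (at z)"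
    by (rule has_derivative_compose[OF bounded_linear_imp_has_derivative[OF bounded_linear_fst]])
     (use smooth_real_deriv(1)[OF assms(1)] in \<open>simp add: has_field_derivative_def\<close>)
  moreover have "((\<lambda>z. \<beta> (snd z)) has_derivative (\<lambda>e. deriv \<beta> (snd z) * snd e)) (at z)"
    by (rule has_derivative_compose[OF bounded_linear_imp_has_derivative[OF bounded_linear_snd]])
     (use smooth_real_deriv(1)[OF assms(2)] in \<open>simp add: has_field_derivative_def\<close>)
  ultimately have "((\<lambda>z. \<alpha> (fst z) * \<beta> (snd z)) has_derivative
     (\<lambda>e. \<alpha> (fst z) * (deriv \<beta> (snd z) * snd e) + deriv \<alpha> (fst z) * fst e * \<beta> (snd z))) (at z)"
    by (rule has_derivative_mult)
  from frechet_derivative_at[OF this, symmetric] show ?thesis by (simp add: algebra_simps)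
qed

section \<open>Weak derivatives on slices\<close>

lemma fst_borel [measurable]: "(fst :: real \<times> real \<Rightarrow> real) \<in> borel_measurable borel"
  and snd_borel [measurable]: "(snd :: real \<times> real \<Rightarrow> real) \<in> borel_measurable borel"
  by (auto intro!: borel_measurable_continuous_onI continuous_intros)

lemma integrable_prod:
  fixes u v :: "real \<Rightarrow> real"
  assumes [measurable]: "integrable lborel u" "integrable lborel v"
  shows "integrable lborel (\<lambda>z. u (fst z) * v (snd z))"
proof -
  have "integrable (lborel \<Otimes>\<^sub>M lborel) (\<lambda>z. u (fst z) * v (snd z))"
    using assms by (intro lborel_pair.Fubini_integrable) (auto simp: abs_mult)
  then show ?thesis by (simp add: lborel_prod)
qed

text \<open>Open boxes form a generator of the Borel sets that is stable under intersection, so the integral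
  of \<open>h\<close> vanishes over every Borel set.\<close>

lemma integral_box_eq_0_imp_AE_0:
  fixes h :: "real \<times> real \<Rightarrow> real"
  assumes h[measurable]: "integrable lborel h"
    and Q: "\<And>z. z \<notin> {a<..<b} \<times> {c<..<d} \<Longrightarrow> h z = 0"
    and box: "\<And>s t u v. (\<integral>z. indicator ({s<..<t} \<times> {u<..<v}) z * h z \<partial>lborel) = 0"
  shows "AE z in lborel. h z = 0"
proof (rule density_unique_real[of lborel h "\<lambda>_. 0", simplified, OF h])
  have si: "set_integrable lborel A h" if "A \<in> sets borel" for A
    using integrable_mult_indicator[of A lborel h] that h by (simp add: set_integrable_def)
  have hQ: "(\<integral>z. h z \<partial>lborel) = 0"
  proof -
    have "(\<integral>z. h z \<partial>lborel) = (\<integral>z. indicator ({a<..<b} \<times> {c<..<d}) z * h z \<partial>lborel)"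
      using Q by (intro Bochner_Integration.integral_cong) (auto simp: indicator_def)
    then show ?thesis by (simp add: box)
  qed
  fix A :: "(real \<times> real) set" assume A: "A \<in> sets borel"
  have "Int_stable (range (\<lambda>(a, b). box a b :: (real \<times> real) set))"
    by (auto simp: Int_stable_def box_Int_box)
  moreover have "(range (\<lambda>(a, b). box a b :: (real \<times> real) set)) \<subseteq> Pow UNIV" by auto
  moreover have "A \<in> sigma_sets UNIV (range (\<lambda>(a, b). box a b))"
    using A unfolding borel_eq_box by simp
  ultimately show "(LINT z:A|lborel. h z) = 0"
  proof (induction rule: sigma_sets_induct_disjoint)
    case (basic A)
    then show ?case using box by (auto simp: set_lebesgue_integral_def box_prod box_real)
  next
    case empty
    show ?case by (simp add: set_lebesgue_integral_def)
  next
    case (compl A)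
    then have [measurable]: "A \<in> sets borel" by (simp add: borel_eq_box)
    have "(LINT z:UNIV - A|lborel. h z) = (\<integral>z. h z - indicator A z * h z \<partial>lborel)"
      unfolding set_lebesgue_integral_def
      by (intro Bochner_Integration.integral_cong) (auto simp: indicator_def)
    also have "\<dots> = 0 - (LINT z:A|lborel. h z)"
      using hQ si[of A] h
      by (subst Bochner_Integration.integral_diff)
         (auto simp: set_lebesgue_integral_def set_integrable_def)
    finally show ?case using compl by simp
  next
    case (union F)
    then have [measurable]: "\<And>i. F i \<in> sets borel"
      by (simp add: borel_eq_box subset_eq)
    have "(LINT z:(\<Union>i. F i)|lborel. h z) = (\<Sum>i. LINT z:F i|lborel. h z)"
      by (rule lebesgue_integral_countable_add)
        (use union in \<open>auto simp: disjoint_family_on_def intro!: si sets.countable_UN\<close>)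
    then show ?case using union by simp
  qed
qed

text \<open>The fundamental lemma of the calculus of variations. Products of test functions are enough since
  they converge boundedly to indicators of boxes.\<close>

lemma AE_0_if_orthogonal_to_products:
  fixes h :: "real \<times> real \<Rightarrow> real"
  assumes h[measurable]: "integrable lborel h"
    and Q: "\<And>z. z \<notin> {a<..<b} \<times> {c<..<d} \<Longrightarrow> h z = 0"
    and orth: "\<And>\<alpha> \<beta>. test_fun_on a b \<alpha> \<Longrightarrow> test_fun_on c d \<beta> \<Longrightarrow> (\<integral>z. h z * (\<alpha> (fst z) * \<beta> (snd z)) \<partial>lborel) = 0"
  shows "AE z in lborel. h z = 0"
proof (rule integral_box_eq_0_imp_AE_0[OF h Q], assumption)
  fix s t u v
  define \<phi> where "\<phi> n z = bump (max s a) (min t b) n (fst z) * bump (max u c) (min v d) n (snd z)" for n z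
  have [measurable]: "bump p q n \<in> borel_measurable borel" for p q n
    using smooth_continuous_on[OF smooth_bump] by (rule borel_measurable_continuous_onI)
  have hm[measurable]: "h \<in> borel_measurable borel"
    using borel_measurable_integrable[OF h] by simp
  have \<phi>m[measurable]: "\<phi> n \<in> borel_measurable borel" for n
    unfolding \<phi>_def by measurable
  have "(\<lambda>n. \<integral>z. h z * \<phi> n z \<partial>lborel) \<longlonglongrightarrow> (\<integral>z. indicator ({s<..<t} \<times> {u<..<v}) z * h z \<partial>lborel)"
  proof (rule integral_dominated_convergence)
    show "integrable lborel (\<lambda>z. norm (h z))" using h by simp
    show "AE z in lborel. (\<lambda>n. h z * \<phi> n z) \<longlonglongrightarrow> indicator ({s<..<t} \<times> {u<..<v}) z * h z"
    proof (rule AE_I2)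
      fix z
      have "(\<lambda>n. h z * \<phi> n z) \<longlonglongrightarrow> h z * (indicator {max s a<..<min t b} (fst z) *
         indicator {max u c<..<min v d} (snd z))"
        unfolding \<phi>_def by (intro tendsto_intros bump_tendsto)
      also have "h z * (indicator {max s a<..<min t b} (fst z) *
         indicator {max u c<..<min v d} (snd z)) = indicator ({s<..<t} \<times> {u<..<v}) z * h z"
        using Q[of z] by (cases z) (auto simp: indicator_def)
      finally show "(\<lambda>n. h z * \<phi> n z) \<longlonglongrightarrow> indicator ({s<..<t} \<times> {u<..<v}) z * h z" .
    qed
    show "AE z in lborel. norm (h z * \<phi> n z) \<le> norm (h z)" for n
    proof (rule AE_I2)
      fix z
      have "\<bar>\<phi> n z\<bar> \<le> 1"
        using bump_bounds by (auto simp: \<phi>_def abs_mult intro!: mult_le_one)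
      then show "norm (h z * \<phi> n z) \<le> norm (h z)" by (simp add: abs_mult mult_left_le)
    qed
  qed (simp_all add: open_Times)
  moreover have "(\<lambda>n. \<integral>z. h z * \<phi> n z \<partial>lborel) \<longlonglongrightarrow> 0"
  proof (rule Lim_transform_eventually[OF tendsto_const])
    show "\<forall>\<^sub>F n in sequentially. 0 = (\<integral>z. h z * \<phi> n z \<partial>lborel)"
      using eventually_gt_at_top[of 0]
    proof eventually_elim
      case (elim n)
      then show ?case unfolding \<phi>_def
        by (subst orth) (auto intro: test_fun_mono[OF test_fun_bump])
    qed
  qed
  ultimately show "(\<integral>z. indicator ({s<..<t} \<times> {u<..<v}) z * h z \<partial>lborel) = 0"
    by (rule LIMSEQ_unique)
qed

lemma test_fun_deriv:
  assumes "test_fun_on a b \<alpha>" shows "test_fun_on a b (deriv \<alpha>)"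
proof -
  from assms obtain c d where *: "a < c" "d < b" "\<forall>x. x \<notin> {c..d} \<longrightarrow> \<alpha> x = 0" and s: "smooth \<alpha>"
    unfolding test_fun_on_def by auto
  have "deriv \<alpha> x = 0" if "x \<notin> {c..d}" for x
  proof -
    have "((\<lambda>_. 0) has_real_derivative 0) (at x)" by simp
    then have "(\<alpha> has_real_derivative 0) (at x)"
      by (rule has_field_derivative_transform_within_open[of _ _ _ "- {c..d}"])
        (use that * in \<open>auto intro: open_Compl\<close>)
    then show ?thesis by (rule DERIV_imp_deriv)
  qed
  then show ?thesis unfolding test_fun_on_def using smooth_real_deriv(2)[OF s] * by blast
qed

lemma test_fun_measurable: "test_fun_on a b \<alpha> \<Longrightarrow> \<alpha> \<in> borel_measurable borel"
  by (auto simp: test_fun_on_def intro!: borel_measurable_continuous_onI smooth_continuous_on)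

lemma test_fun_bounded:
  assumes "test_fun_on a b \<alpha>" shows "\<exists>B. \<forall>x. \<bar>\<alpha> x\<bar> \<le> B"
proof -
  from assms obtain c d where *: "\<forall>x. x \<notin> {c..d} \<longrightarrow> \<alpha> x = 0" and s: "smooth \<alpha>"
    unfolding test_fun_on_def by auto
  have "bounded (\<alpha> ` {c..d})"
    by (intro compact_imp_bounded compact_continuous_image smooth_continuous_on s) auto
  then obtain B where "\<forall>x\<in>{c..d}. \<bar>\<alpha> x\<bar> \<le> B" by (auto simp: bounded_iff)
  then have "\<bar>\<alpha> x\<bar> \<le> max B 0" for x using * by (cases "x \<in> {c..d}") fastforce+
  then show ?thesis by blast
qed

lemma test_fun_integrable:
  assumes "test_fun_on a b \<alpha>" shows "integrable lborel \<alpha>"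
proof -
  from assms obtain c d where *: "\<forall>x. x \<notin> {c..d} \<longrightarrow> \<alpha> x = 0" and s: "smooth \<alpha>"
    unfolding test_fun_on_def by auto
  have "set_integrable lborel {c..d} \<alpha>"
    by (intro borel_integrable_atLeastAtMost' smooth_continuous_on s)
  moreover have "(\<lambda>x. indicator {c..d} x *\<^sub>R \<alpha> x) = \<alpha>" using * by (auto simp: indicator_def fun_eq_iff)
  ultimately show ?thesis by (simp add: set_integrable_def)
qed

lemma integral_tail_deriv:
  assumes "test_fun_on a b \<beta>"
  shows "(\<integral>y. (if t \<le> y then deriv \<beta> y else 0) \<partial>lborel) = - \<beta> t"
proof -
  define T where "T = max t b"
  have "(\<integral>y. (if t \<le> y then deriv \<beta> y else 0) \<partial>lborel) = (\<integral>y. indicator {t..T} y *\<^sub>R deriv \<beta> y \<partial>lborel)"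
  proof (intro Bochner_Integration.integral_cong refl)
    fix y show "(if t \<le> y then deriv \<beta> y else 0) = indicator {t..T} y *\<^sub>R deriv \<beta> y"
    proof (cases "y \<le> T")
      case False
      then have "y \<notin> {a<..<b}" by (auto simp: T_def)
      then show ?thesis using test_fun_zero[OF test_fun_deriv[OF assms], of y] by simp
    qed (auto simp: indicator_def)
  qed
  also have "\<dots> = \<beta> T - \<beta> t"
  proof (rule integral_FTC_atLeastAtMost)
    show "continuous_on {t..T} (deriv \<beta>)"
      using assms by (auto simp: test_fun_on_def intro!: smooth_continuous_on smooth_real_deriv)
    show "(\<beta> has_vector_derivative deriv \<beta> x) (at x within {t..T})" for x
      using assms smooth_real_deriv(1)[of \<beta> x]
      by (auto simp: test_fun_on_def has_real_derivative_iff_has_vector_derivative intro: has_vector_derivative_at_within)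
  qed (auto simp: T_def)
  also have "\<beta> T = 0" using test_fun_zero[OF assms, of T] by (simp add: T_def)
  finally show ?thesis by simp
qed

text \<open>The primitive that vanishes to the left of the support is constant to its right, and this constant
  is the integral of \<open>g\<close>.\<close>

lemma test_fun_antideriv:
  assumes g: "test_fun_on a b g" and 0: "(\<integral>x. g x \<partial>lborel) = 0"
  shows "\<exists>\<beta>. test_fun_on a b \<beta> \<and> deriv \<beta> = g"
proof -
  from g obtain c d where *: "a < c" "d < b" "\<forall>x. x \<notin> {c..d} \<longrightarrow> g x = 0" and s: "smooth g"
    unfolding test_fun_on_def by auto
  define d' where "d' = max c d"
  have "isCont g x" for x using smooth_continuous_on[OF s, of UNIV] by (simp add: continuous_on_eq_continuous_at)
  then obtain F where F: "\<And>x. (F has_real_derivative g x) (at x)"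
    using einterval_antiderivative[of "-\<infinity>" \<infinity> g]
    by (auto simp: has_real_derivative_iff_has_vector_derivative)
  define \<beta> where "\<beta> x = F x - F c" for x
  have d: "(\<beta> has_real_derivative g x) (at x)" for x
    unfolding \<beta>_def using F[of x] by (auto intro!: derivative_eq_intros)
  have ftc: "(\<integral>x. indicator {u..v} x *\<^sub>R g x \<partial>lborel) = F v - F u" if "u \<le> v" for u v
    by (rule integral_FTC_atLeastAtMost[OF that])
      (use F s in \<open>auto simp: has_real_derivative_iff_has_vector_derivative
          intro: has_vector_derivative_at_within smooth_continuous_on\<close>)
  have z: "\<beta> x = 0" if "x \<notin> {c..d'}" for x
  proof (cases "x < c")
    case True
    have "AE y in lborel. indicator {x..c} y *\<^sub>R g y = 0"
    proof (rule AE_mp[OF AE_lborel_singleton[of c]], intro AE_I2 impI)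
      fix y assume "y \<noteq> c"
      then show "indicator {x..c} y *\<^sub>R g y = 0" using * by (auto simp: indicator_def)
    qed
    then have "F c - F x = 0" using ftc[of x c] True by (simp add: integral_eq_zero_AE)
    then show ?thesis by (simp add: \<beta>_def)
  next
    case False
    then have "x > d'" "c \<le> x" using that by auto
    then have "{c..d} \<subseteq> {c..x}" by (auto simp: d'_def)
    then have "indicator {c..x} y *\<^sub>R g y = g y" for y
      using * by (cases "y \<in> {c..d}") (auto simp: indicator_def)
    then have "(\<lambda>y. indicator {c..x} y *\<^sub>R g y) = g" by auto
    then show ?thesis using ftc[of c x] 0 \<open>c \<le> x\<close> by (simp add: \<beta>_def)
  qed
  have "smooth \<beta>" by (rule smooth_real_antideriv[OF d s])
  moreover have "d' < b \<or> g = (\<lambda>_. 0)"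
  proof (cases "c \<le> d")
    case False
    then have "g = (\<lambda>_. 0)" using * by auto
    then show ?thesis by simp
  qed (use * in \<open>auto simp: d'_def\<close>)
  ultimately show ?thesis
  proof (elim disjE)
    assume "smooth \<beta>" "d' < b"
    then have "test_fun_on a b \<beta>" unfolding test_fun_on_def using z * by blast
    moreover have "deriv \<beta> = g" using DERIV_imp_deriv[OF d] by auto
    ultimately show ?thesis by blast
  next
    assume 0: "g = (\<lambda>_. 0)"
    have "deriv (\<lambda>_::real. 0::real) = (\<lambda>_. 0)" by auto
    then show ?thesis using g 0 by metis
  qed
qed

lemma test_fun_unit_mass:
  assumes "a < b" shows "\<exists>\<kappa>. test_fun_on a b \<kappa> \<and> (\<integral>x. \<kappa> x \<partial>lborel) = 1"
proof -
  have [measurable]: "bump a b n \<in> borel_measurable borel" for n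
    using smooth_continuous_on[OF smooth_bump] by (rule borel_measurable_continuous_onI)
  have "(\<lambda>n. \<integral>x. bump a b n x \<partial>lborel) \<longlonglongrightarrow> (\<integral>x. indicator {a<..<b} x \<partial>lborel)"
  proof (rule integral_dominated_convergence[where w = "indicator {a<..<b}"])
    have "bump a b n x \<le> indicator {a<..<b} x" for n x
    proof (cases "x \<in> {a<..<b}")
      case False
      then have "bump a b n x = 0"
        using bump_supp[of a b n x] by (smt (verit) divide_nonneg_nonneg of_nat_0_le_iff greaterThanLessThan_iff)
      then show ?thesis by simp
    qed (simp add: bump_bounds)
    then show "AE x in lborel. norm (bump a b n x) \<le> indicator {a<..<b} x" for n
      using bump_bounds by simp
    show "integrable lborel (indicator {a<..<b} :: real \<Rightarrow> real)"
      using assms by (intro integrable_real_indicator) auto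
  qed (auto intro: bump_tendsto)
  also have "(\<integral>x. indicator {a<..<b} x \<partial>lborel) = b - a" using assms by simp
  finally have "\<forall>\<^sub>F n in sequentially. 0 < (\<integral>x. bump a b n x \<partial>lborel)"
    using assms by (intro order_tendstoD(1)[of _ "b - a"]) auto
  then have "\<forall>\<^sub>F n in sequentially. 0 < (\<integral>x. bump a b n x \<partial>lborel) \<and> n > 0"
    using eventually_gt_at_top[of 0] by eventually_elim simp
  then obtain n where n: "0 < (\<integral>x. bump a b n x \<partial>lborel)" "n > 0"
    using eventually_happens'[OF sequentially_bot] by blast
  define I where "I = (\<integral>x. bump a b n x \<partial>lborel)"
  have "test_fun_on a b (\<lambda>x. 0 + inverse I * bump a b n x)"
  proof (rule test_fun_add[OF _ test_fun_bump[OF n(2)]])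
    show "test_fun_on a b (\<lambda>_. 0)"
      unfolding test_fun_on_def by (intro conjI smooth_const exI[of _ "a + 1"] exI[of _ "b - 1"]) auto
  qed
  moreover have "(\<integral>x. inverse I * bump a b n x \<partial>lborel) = 1"
    using n(1) by (simp add: I_def[symmetric])
  ultimately show ?thesis by (intro exI[of _ "\<lambda>x. inverse I * bump a b n x"]) simp
qed

text \<open>Both sides integrate \<open>q y * r t\<close> over the half plane \<open>t \<le> y\<close>.\<close>

lemma integral_primitive_swap:
  fixes q r :: "real \<Rightarrow> real"
  assumes q[measurable]: "integrable lborel q" and r[measurable]: "integrable lborel r"
  shows "(\<integral>y. q y * (\<integral>t. (if t \<le> y then r t else 0) \<partial>lborel) \<partial>lborel) =
    (\<integral>t. r t * (\<integral>y. (if t \<le> y then q y else 0) \<partial>lborel) \<partial>lborel)"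
proof -
  have i: "integrable (lborel \<Otimes>\<^sub>M lborel) (\<lambda>(y, t). if t \<le> y then q y * r t else 0)"
  proof (rule Bochner_Integration.integrable_bound)
    show "integrable (lborel \<Otimes>\<^sub>M lborel) (\<lambda>z. q (fst z) * r (snd z))"
      using integrable_prod[OF q r] by (simp add: lborel_prod)
  qed auto
  have "(\<integral>y. q y * (\<integral>t. (if t \<le> y then r t else 0) \<partial>lborel) \<partial>lborel)
    = (\<integral>y. (\<integral>t. q y * (if t \<le> y then r t else 0) \<partial>lborel) \<partial>lborel)"
    by simp
  also have "\<dots> = (\<integral>y. (\<integral>t. (if t \<le> y then q y * r t else 0) \<partial>lborel) \<partial>lborel)"
    by (intro Bochner_Integration.integral_cong refl) auto
  also have "\<dots> = (\<integral>t. (\<integral>y. (if t \<le> y then q y * r t else 0) \<partial>lborel) \<partial>lborel)"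
    using lborel_pair.Fubini_integral[OF i] by simp
  also have "\<dots> = (\<integral>t. (\<integral>y. r t * (if t \<le> y then q y else 0) \<partial>lborel) \<partial>lborel)"
    by (intro Bochner_Integration.integral_cong refl) auto
  also have "\<dots> = (\<integral>t. r t * (\<integral>y. (if t \<le> y then q y else 0) \<partial>lborel) \<partial>lborel)"
    by simp
  finally show ?thesis .
qed

text \<open>A function with a weak derivative is absolutely continuous on almost every line. By Fubini, the
  primitive \<open>R\<close> of \<open>r\<close> along the lines has the same weak derivative as \<open>p\<close>, so \<open>f = p - R\<close> annihilates
  \<open>\<alpha> (x) \<beta>' (y)\<close>. As every test function is a derivative plus a multiple of a fixed \<open>\<kappa>\<close> of mass one,
  \<open>f\<close> depends on \<open>x\<close> only, and its value on a line is the average of \<open>f\<close> against \<open>\<kappa>\<close>.\<close>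

lemma weak_derivative_slices:
  fixes p r :: "real \<times> real \<Rightarrow> real"
  assumes ab: "a < b" and cd: "c < d"
    and p[measurable]: "integrable lborel p" and r[measurable]: "integrable lborel r"
    and weak: "\<And>\<alpha> \<beta>. test_fun_on a b \<alpha> \<Longrightarrow> test_fun_on c d \<beta> \<Longrightarrow>
      (\<integral>z. p z * (\<alpha> (fst z) * deriv \<beta> (snd z)) \<partial>lborel) = - (\<integral>z. r z * (\<alpha> (fst z) * \<beta> (snd z)) \<partial>lborel)"
  shows "\<exists>C. AE z in lborel. z \<in> {a<..<b} \<times> {c<..<d} \<longrightarrow>
     p z = C (fst z) + (\<integral>t. (if t \<le> snd z then r (fst z, t) else 0) \<partial>lborel)"
proof -
  define Q where "Q = {a<..<b} \<times> {c<..<d}"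
  have [measurable]: "Q \<in> sets borel" by (simp add: Q_def open_Times)
  define R where "R z = (\<integral>t. (if t \<le> snd z then r (fst z, t) else 0) \<partial>lborel)" for z :: "real \<times> real"
  have R_eq: "R (x, y) = (\<integral>t. (if t \<le> y then r (x, t) else 0) \<partial>lborel)" for x y
    unfolding R_def fst_conv snd_conv ..
  have r': "integrable (lborel \<Otimes>\<^sub>M lborel) r" using r by (simp add: lborel_prod)
  have r_meas[measurable]: "r \<in> borel_measurable (borel \<Otimes>\<^sub>M borel)"
    using borel_measurable_integrable[OF r] by (simp add: borel_prod)
  have R_meas: "R \<in> borel_measurable (borel \<Otimes>\<^sub>M borel)"
    unfolding R_def by measurable
  then have [measurable]: "R \<in> borel_measurable borel" by (simp add: borel_prod)
  have slice: "AE x in lborel. integrable lborel (\<lambda>t. r (x, t))"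
    by (rule lborel_pair.AE_integrable_fst'[OF r'])
  have R_bound: "\<bar>R (x, y)\<bar> \<le> (\<integral>t. \<bar>r (x, t)\<bar> \<partial>lborel)" if "integrable lborel (\<lambda>t. r (x, t))" for x y
  proof -
    have "\<bar>R (x, y)\<bar> \<le> (\<integral>t. \<bar>if t \<le> y then r (x, t) else 0\<bar> \<partial>lborel)"
      unfolding R_eq by (rule integral_abs_bound)
    also have "\<dots> \<le> (\<integral>t. \<bar>r (x, t)\<bar> \<partial>lborel)"
      using that by (intro integral_mono_AE Bochner_Integration.integrable_bound[OF that]) auto
    finally show ?thesis .
  qed
  have RQ: "integrable lborel (\<lambda>z. indicator Q z * R z)"
  proof -
    have "integrable (lborel \<Otimes>\<^sub>M lborel) (\<lambda>z. indicator Q z * R z)"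
    proof (rule lborel_pair.Fubini_integrable)
      show "(\<lambda>z. indicator Q z * R z) \<in> borel_measurable (lborel \<Otimes>\<^sub>M lborel)"
        unfolding lborel_prod by measurable
      have i: "integrable lborel (\<lambda>y. indicator {c<..<d} y * R (x, y))"
        if "integrable lborel (\<lambda>t. r (x, t))" for x
      proof (rule Bochner_Integration.integrable_bound)
        show "integrable lborel (\<lambda>y. indicator {c<..<d} y * (\<integral>t. \<bar>r (x, t)\<bar> \<partial>lborel))"
          using cd by (intro integrable_mult_left integrable_real_indicator) auto
        show "(\<lambda>y. indicator {c<..<d} y * R (x, y)) \<in> borel_measurable lborel"
          using R_meas by measurable
      qed (use R_bound[OF that] in \<open>auto simp: indicator_def intro: order_trans\<close>)
      show "AE x in lborel. integrable lborel (\<lambda>y. indicator Q (x, y) * R (x, y))"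
        using slice
      proof eventually_elim
        case (elim x)
        then show ?case
          using integrable_mult_right[OF i[OF elim], of "indicator {a<..<b} x"]
          by (simp add: Q_def indicator_times mult.assoc)
      qed
      show "integrable lborel (\<lambda>x. \<integral>y. norm (indicator Q (x, y) * R (x, y)) \<partial>lborel)"
      proof (rule Bochner_Integration.integrable_bound)
        show "integrable lborel (\<lambda>x. (d - c) * (\<integral>t. \<bar>r (x, t)\<bar> \<partial>lborel))"
          using lborel_pair.integrable_fst'[OF integrable_abs[OF r']] by simp
        show "(\<lambda>x. \<integral>y. norm (indicator Q (x, y) * R (x, y)) \<partial>lborel) \<in> borel_measurable lborel"
          using R_meas by measurable
        show "AE x in lborel. norm (\<integral>y. norm (indicator Q (x, y) * R (x, y)) \<partial>lborel)
          \<le> norm ((d - c) * (\<integral>t. \<bar>r (x, t)\<bar> \<partial>lborel))"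
          using slice
        proof eventually_elim
          case (elim x)
          define \<rho> where "\<rho> = (\<integral>t. \<bar>r (x, t)\<bar> \<partial>lborel)"
          have \<rho>: "\<rho> \<ge> 0" by (simp add: \<rho>_def)
          have "(\<integral>y. norm (indicator Q (x, y) * R (x, y)) \<partial>lborel) \<le> (\<integral>y. indicator {c<..<d} y * \<rho> \<partial>lborel)"
          proof (rule integral_mono_AE')
            show "integrable lborel (\<lambda>y. indicator {c<..<d} y * \<rho>)"
              using cd by (intro integrable_mult_left integrable_real_indicator) auto
          qed (use R_bound[OF elim] \<rho> in \<open>auto simp: \<rho>_def Q_def indicator_def\<close>)
          also have "\<dots> = (d - c) * \<rho>" using cd by simp
          finally show ?case using cd \<rho> by (simp add: \<rho>_def)
        qed
      qed
    qed
    then show ?thesis by (simp add: lborel_prod)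
  qed
  define f where "f z = indicator Q z * (p z - R z)" for z
  have pQ: "integrable lborel (\<lambda>z. indicator Q z * p z)"
    using integrable_mult_indicator[OF _ p, of Q] by simp
  have f: "integrable lborel f"
    unfolding f_def right_diff_distrib using pQ RQ by simp
  have mult: "integrable lborel (\<lambda>z. h z * (\<alpha> (fst z) * \<beta> (snd z)))"
    if h: "integrable lborel h" and \<alpha>: "test_fun_on a b \<alpha>" and \<beta>: "test_fun_on c d \<beta>" for h :: "real \<times> real \<Rightarrow> real" and \<alpha> \<beta>
  proof -
    obtain A B where AB: "\<And>x. \<bar>\<alpha> x\<bar> \<le> A" "\<And>x. \<bar>\<beta> x\<bar> \<le> B"
      using test_fun_bounded[OF \<alpha>] test_fun_bounded[OF \<beta>] by blast
    have [measurable]: "\<alpha> \<in> borel_measurable borel" "\<beta> \<in> borel_measurable borel" "h \<in> borel_measurable borel"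
      using test_fun_measurable \<alpha> \<beta> borel_measurable_integrable[OF h] by auto
    show ?thesis
    proof (rule Bochner_Integration.integrable_bound)
      show "integrable lborel (\<lambda>z. (A * B) * h z)" using h by simp
      show "AE z in lborel. norm (h z * (\<alpha> (fst z) * \<beta> (snd z))) \<le> norm ((A * B) * h z)"
      proof (rule AE_I2)
        fix z
        have "\<bar>\<alpha> (fst z)\<bar> * \<bar>\<beta> (snd z)\<bar> \<le> A * B"
          using AB by (intro mult_mono) (auto intro: order_trans[OF abs_ge_zero])
        moreover have "0 \<le> A" "0 \<le> B" using AB[of 0] by linarith+
        ultimately show "norm (h z * (\<alpha> (fst z) * \<beta> (snd z))) \<le> norm ((A * B) * h z)"
          by (simp add: abs_mult mult.commute mult_left_mono)
      qed
    qed measurable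
  qed
  have iter: "(\<integral>z. h z * (\<alpha> (fst z) * \<beta> (snd z)) \<partial>lborel) = (\<integral>x. \<alpha> x * (\<integral>y. h (x, y) * \<beta> y \<partial>lborel) \<partial>lborel)"
    if h: "integrable lborel h" and \<alpha>: "test_fun_on a b \<alpha>" and \<beta>: "test_fun_on c d \<beta>" for h :: "real \<times> real \<Rightarrow> real" and \<alpha> \<beta>
    using lborel_pair.integral_fst'[of "\<lambda>z. h z * (\<alpha> (fst z) * \<beta> (snd z))"] mult[OF that]
    by (simp add: lborel_prod mult.left_commute)
  have f_deriv: "(\<integral>z. f z * (\<alpha> (fst z) * deriv \<beta> (snd z)) \<partial>lborel) = 0"
    if \<alpha>: "test_fun_on a b \<alpha>" and \<beta>: "test_fun_on c d \<beta>" for \<alpha> \<beta>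
  proof -
    have "(\<integral>z. (indicator Q z * R z) * (\<alpha> (fst z) * deriv \<beta> (snd z)) \<partial>lborel)
      = (\<integral>x. \<alpha> x * (\<integral>y. (indicator Q (x, y) * R (x, y)) * deriv \<beta> y \<partial>lborel) \<partial>lborel)"
      by (rule iter[OF RQ \<alpha> test_fun_deriv[OF \<beta>]])
    also have "\<dots> = (\<integral>x. \<alpha> x * (\<integral>y. - r (x, y) * \<beta> y \<partial>lborel) \<partial>lborel)"
    proof (rule integral_cong_AE)
      show "AE x in lborel. \<alpha> x * (\<integral>y. (indicator Q (x, y) * R (x, y)) * deriv \<beta> y \<partial>lborel)
        = \<alpha> x * (\<integral>y. - r (x, y) * \<beta> y \<partial>lborel)"
        using slice
      proof eventually_elim
        case (elim x)
        show ?case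
        proof (cases "x \<in> {a<..<b}")
          case True
          have "(\<integral>y. (indicator Q (x, y) * R (x, y)) * deriv \<beta> y \<partial>lborel)
             = (\<integral>y. deriv \<beta> y * (\<integral>t. (if t \<le> y then r (x, t) else 0) \<partial>lborel) \<partial>lborel)"
          proof (intro Bochner_Integration.integral_cong refl)
            fix y
            show "indicator Q (x, y) * R (x, y) * deriv \<beta> y = deriv \<beta> y * (\<integral>t. (if t \<le> y then r (x, t) else 0) \<partial>lborel)"
              using True test_fun_zero[OF test_fun_deriv[OF \<beta>], of y] 
              by (cases "y \<in> {c<..<d}") (auto simp: Q_def R_eq)
          qed
          also have "\<dots> = (\<integral>t. r (x, t) * - \<beta> t \<partial>lborel)"
            using integral_primitive_swap[OF test_fun_integrable[OF test_fun_deriv[OF \<beta>]] elim]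
            by (simp only: integral_tail_deriv[OF \<beta>])
          finally show ?thesis by simp
        qed (use test_fun_zero[OF \<alpha>, of x] in simp)
      qed
      have [measurable]: "\<alpha> \<in> borel_measurable borel" "\<beta> \<in> borel_measurable borel" "deriv \<beta> \<in> borel_measurable borel"
        using test_fun_measurable \<alpha> \<beta> test_fun_deriv by auto
      have Q': "Q \<in> sets (borel \<Otimes>\<^sub>M borel)"
        unfolding borel_prod by (simp add: Q_def open_Times)
      show "(\<lambda>x. \<alpha> x * (\<integral>y. indicator Q (x, y) * R (x, y) * deriv \<beta> y \<partial>lborel)) \<in> borel_measurable lborel"
        using R_meas Q' by measurable
    qed (use test_fun_measurable[OF \<alpha>] test_fun_measurable[OF \<beta>] in measurable)
    also have "\<dots> = - (\<integral>z. r z * (\<alpha> (fst z) * \<beta> (snd z)) \<partial>lborel)"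
      by (simp add: iter[OF r \<alpha> \<beta>])
    finally have 1: "(\<integral>z. (indicator Q z * R z) * (\<alpha> (fst z) * deriv \<beta> (snd z)) \<partial>lborel)
      = - (\<integral>z. r z * (\<alpha> (fst z) * \<beta> (snd z)) \<partial>lborel)" .
    have "(\<integral>z. (indicator Q z * p z) * (\<alpha> (fst z) * deriv \<beta> (snd z)) \<partial>lborel)
      = (\<integral>z. p z * (\<alpha> (fst z) * deriv \<beta> (snd z)) \<partial>lborel)"
    proof (intro Bochner_Integration.integral_cong refl)
      fix z
      show "(indicator Q z * p z) * (\<alpha> (fst z) * deriv \<beta> (snd z)) = p z * (\<alpha> (fst z) * deriv \<beta> (snd z))"
        using test_fun_zero[OF test_fun_deriv[OF \<beta>], of "snd z"] test_fun_zero[OF \<alpha>, of "fst z"]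
        by (cases "z \<in> Q"; cases "fst z \<in> {a<..<b}") (auto simp: Q_def mem_Times_iff)
    qed
    with weak[OF \<alpha> \<beta>] 1 show ?thesis
      using mult[OF pQ \<alpha> test_fun_deriv[OF \<beta>]] mult[OF RQ \<alpha> test_fun_deriv[OF \<beta>]]
      by (simp add: f_def left_diff_distrib right_diff_distrib)
  qed
  obtain \<kappa> where \<kappa>: "test_fun_on c d \<kappa>" "(\<integral>x. \<kappa> x \<partial>lborel) = 1"
    using test_fun_unit_mass[OF cd] by blast
  have [measurable]: "\<kappa> \<in> borel_measurable borel" by (rule test_fun_measurable[OF \<kappa>(1)])
  define C where "C x = (\<integral>y. f (x, y) * \<kappa> y \<partial>lborel)" for x
  have C: "integrable lborel C"
  proof -
    obtain B where B: "\<And>x. \<bar>\<kappa> x\<bar> \<le> B" using test_fun_bounded[OF \<kappa>(1)] by blast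
    have "integrable lborel (\<lambda>z. f z * \<kappa> (snd z))"
      by (rule Bochner_Integration.integrable_bound[OF integrable_mult_left[OF f, of B]])
         (use f in \<open>auto simp: abs_mult intro!: AE_I2 mult_left_mono order_trans[OF B abs_ge_self]\<close>)
    then have "integrable (lborel \<Otimes>\<^sub>M lborel) (\<lambda>z. f z * \<kappa> (snd z))" by (simp add: lborel_prod)
    from lborel_pair.integrable_fst'[OF this] show ?thesis unfolding C_def by simp
  qed
  have CQ: "integrable lborel (\<lambda>z. indicator Q z * C (fst z))"
  proof -
    have "integrable lborel (\<lambda>z. (indicator {a<..<b} (fst z) * C (fst z)) * indicator {c<..<d} (snd z))"
    proof (rule integrable_prod)
      show "integrable lborel (\<lambda>x. indicator {a<..<b} x * C x)"
        using integrable_mult_indicator[OF _ C, of "{a<..<b}"] by simp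
    qed (use cd in \<open>auto intro!: integrable_real_indicator\<close>)
    then show ?thesis by (simp add: Q_def indicator_times mult_ac)
  qed
  have "AE z in lborel. f z - indicator Q z * C (fst z) = 0"
  proof (rule AE_0_if_orthogonal_to_products)
    show "integrable lborel (\<lambda>z. f z - indicator Q z * C (fst z))" using f CQ by simp
    show "f z - indicator Q z * C (fst z) = 0" if "z \<notin> {a<..<b} \<times> {c<..<d}" for z
      using that by (simp add: f_def Q_def)
    fix \<alpha> q assume \<alpha>: "test_fun_on a b \<alpha>" and q: "test_fun_on c d q"
    define I where "I = (\<integral>x. q x \<partial>lborel)"
    \<comment> \<open>Subtracting its mass makes \<open>q\<close> the derivative of a test function.\<close>
    have "test_fun_on c d (\<lambda>x. q x + (- I) * \<kappa> x)" by (rule test_fun_add[OF q \<kappa>(1)])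
    moreover have "(\<integral>x. q x + (- I) * \<kappa> x \<partial>lborel) = 0"
      using test_fun_integrable[OF q] test_fun_integrable[OF \<kappa>(1)] \<kappa>(2) by (simp add: I_def)
    ultimately obtain \<beta> where \<beta>: "test_fun_on c d \<beta>" "deriv \<beta> = (\<lambda>x. q x + (- I) * \<kappa> x)"
      using test_fun_antideriv by blast
    have "0 = (\<integral>z. f z * (\<alpha> (fst z) * q (snd z)) - I * (f z * (\<alpha> (fst z) * \<kappa> (snd z))) \<partial>lborel)"
      using f_deriv[OF \<alpha> \<beta>(1)] by (simp add: \<beta>(2) algebra_simps)
    also have "\<dots> = (\<integral>z. f z * (\<alpha> (fst z) * q (snd z)) \<partial>lborel) - I * (\<integral>z. f z * (\<alpha> (fst z) * \<kappa> (snd z)) \<partial>lborel)"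
      using mult[OF f \<alpha> q] mult[OF f \<alpha> \<kappa>(1)] by simp
    also have "(\<integral>z. f z * (\<alpha> (fst z) * \<kappa> (snd z)) \<partial>lborel) = (\<integral>x. \<alpha> x * C x \<partial>lborel)"
      unfolding C_def by (rule iter[OF f \<alpha> \<kappa>(1)])
    finally have 2: "(\<integral>z. f z * (\<alpha> (fst z) * q (snd z)) \<partial>lborel) = I * (\<integral>x. \<alpha> x * C x \<partial>lborel)" by simp
    have "(\<integral>z. (indicator Q z * C (fst z)) * (\<alpha> (fst z) * q (snd z)) \<partial>lborel)
      = (\<integral>x. \<alpha> x * (\<integral>y. (indicator Q (x, y) * C x) * q y \<partial>lborel) \<partial>lborel)"
      by (simp add: iter[OF CQ \<alpha> q])
    also have "\<dots> = (\<integral>x. I * (\<alpha> x * C x) \<partial>lborel)"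
    proof (intro Bochner_Integration.integral_cong refl)
      fix x
      have "\<alpha> x * (indicator Q (x, y) * C x * q y) = \<alpha> x * C x * q y" for y
        using test_fun_zero[OF \<alpha>, of x] test_fun_zero[OF q, of y] by (auto simp: Q_def indicator_def)
      then have "(\<integral>y. \<alpha> x * (indicator Q (x, y) * C x * q y) \<partial>lborel) = (\<integral>y. \<alpha> x * C x * q y \<partial>lborel)"
        by presburger
      moreover have "(\<integral>y. \<alpha> x * (indicator Q (x, y) * C x * q y) \<partial>lborel)
          = \<alpha> x * (\<integral>y. indicator Q (x, y) * C x * q y \<partial>lborel)"
        by (rule integral_mult_right_zero)
      moreover have "(\<integral>y. \<alpha> x * C x * q y \<partial>lborel) = \<alpha> x * C x * I"
        unfolding I_def by (rule integral_mult_right_zero)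
      ultimately show "\<alpha> x * (\<integral>y. indicator Q (x, y) * C x * q y \<partial>lborel) = I * (\<alpha> x * C x)"
        by (metis mult.commute)
    qed
    finally show "(\<integral>z. (f z - indicator Q z * C (fst z)) * (\<alpha> (fst z) * q (snd z)) \<partial>lborel) = 0"
      using mult[OF f \<alpha> q] mult[OF CQ \<alpha> q] 2 by (simp add: left_diff_distrib)
  qed
  then have "AE z in lborel. z \<in> Q \<longrightarrow> p z = C (fst z) + R z"
    by eventually_elim (auto simp: f_def)
  then show ?thesis unfolding Q_def R_def by blast
qed

section \<open>Positive semidefinite forms\<close>

text \<open>The \<open>L\<^sup>2\<close> product, the energy product and the product of the \<open>x\<close> derivatives are only semidefinite,
  because functions that agree almost everywhere are not identified. The Cauchy-Schwarz inequality
  and the continuity arguments for curves are the same for all three.\<close>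

locale semi_inner =
  fixes X :: "('x \<Rightarrow> real) set" and B :: "('x \<Rightarrow> real) \<Rightarrow> ('x \<Rightarrow> real) \<Rightarrow> real"
  assumes lin: "f \<in> X \<Longrightarrow> g \<in> X \<Longrightarrow> (\<lambda>z. a * f z + b * g z) \<in> X"
    and lin_left: "f \<in> X \<Longrightarrow> g \<in> X \<Longrightarrow> h \<in> X \<Longrightarrow> B (\<lambda>z. a * f z + b * g z) h = a * B f h + b * B g h"
    and sym: "f \<in> X \<Longrightarrow> g \<in> X \<Longrightarrow> B f g = B g f"
    and nonneg: "f \<in> X \<Longrightarrow> 0 \<le> B f f"
begin

definition N :: "('x \<Rightarrow> real) \<Rightarrow> real" where "N f = sqrt (B f f)"

lemma N_nonneg: "f \<in> X \<Longrightarrow> 0 \<le> N f" and N_square: "f \<in> X \<Longrightarrow> (N f)\<^sup>2 = B f f"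
  using nonneg by (simp_all add: N_def)

lemma diff: "f \<in> X \<Longrightarrow> g \<in> X \<Longrightarrow> (\<lambda>z. f z - g z) \<in> X"
  using lin[of f g 1 "-1"] by simp

lemma diff_left: "f \<in> X \<Longrightarrow> g \<in> X \<Longrightarrow> h \<in> X \<Longrightarrow> B (\<lambda>z. f z - g z) h = B f h - B g h"
  using lin_left[of f g h 1 "-1"] by simp

lemma diff_right: "f \<in> X \<Longrightarrow> g \<in> X \<Longrightarrow> h \<in> X \<Longrightarrow> B h (\<lambda>z. f z - g z) = B h f - B h g"
  using diff_left[of f g h] sym diff by metis

lemma Cauchy_Schwarz: 
  assumes "f \<in> X" "g \<in> X" shows "\<bar>B f g\<bar> \<le> N f * N g"
proof -
  have q: "0 \<le> a\<^sup>2 * B f f + 2 * a * b * B f g + b\<^sup>2 * B g g" for a b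
  proof -
    let ?h = "\<lambda>z. a * f z + b * g z"
    have h: "?h \<in> X" using lin assms by blast
    have "0 \<le> B ?h ?h" using h by (rule nonneg)
    also have "\<dots> = a * B ?h f + b * B ?h g"
      using lin_left[OF assms h] sym[OF h] assms by simp
    also have "\<dots> = a\<^sup>2 * B f f + 2 * a * b * B f g + b\<^sup>2 * B g g"
      using assms by (simp add: lin_left sym[of g f] power2_eq_square algebra_simps)
    finally show ?thesis .
  qed
  have "(B f g)\<^sup>2 \<le> B f f * B g g"
  proof (cases "B g g = 0")
    case True
    have "B f g = 0"
    proof (rule ccontr)
      assume n: "B f g \<noteq> 0"
      show False using q[of 1 "- (B f f + 1) / (2 * B f g)"] True n by (simp add: field_simps)
    qed
    then show ?thesis using True by simp
  next
    case False
    then have g: "B g g > 0" using nonneg[OF assms(2)] by simp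
    have "0 \<le> (B g g)\<^sup>2 * B f f + 2 * B g g * (- B f g) * B f g + (- B f g)\<^sup>2 * B g g"
      using q[of "B g g" "- B f g"] by simp
    also have "\<dots> = B g g * (B f f * B g g - (B f g)\<^sup>2)" by (simp add: power2_eq_square algebra_simps)
    finally show ?thesis using g by (simp add: zero_le_mult_iff)
  qed
  then have "sqrt ((B f g)\<^sup>2) \<le> sqrt (B f f * B g g)" by (rule real_sqrt_le_mono)
  then show ?thesis by (simp add: N_def real_sqrt_mult)
qed

lemma tendsto_B:
  assumes w: "\<forall>\<^sub>F s in F. w s \<in> X" and v: "\<forall>\<^sub>F s in F. v s \<in> X" and w0: "w0 \<in> X" and v0: "v0 \<in> X"
    and lw: "((\<lambda>s. N (\<lambda>z. w s z - w0 z)) \<longlongrightarrow> 0) F" and lv: "((\<lambda>s. N (\<lambda>z. v s z - v0 z)) \<longlongrightarrow> 0) F"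
  shows "((\<lambda>s. B (w s) (v s)) \<longlongrightarrow> B w0 v0) F"
proof -
  let ?w = "\<lambda>s z. w s z - w0 z" and ?v = "\<lambda>s z. v s z - v0 z"
  have "((\<lambda>s. N (?w s) * N (?v s) + N (?w s) * N v0 + N w0 * N (?v s)) \<longlongrightarrow> 0 * 0 + 0 * N v0 + N w0 * 0) F"
    by (intro tendsto_intros lw lv)
  then have "((\<lambda>s. N (?w s) * N (?v s) + N (?w s) * N v0 + N w0 * N (?v s)) \<longlongrightarrow> 0) F" by simp
  moreover have "\<forall>\<^sub>F s in F. norm (B (w s) (v s) - B w0 v0) \<le> N (?w s) * N (?v s) + N (?w s) * N v0 + N w0 * N (?v s)"
    using w v
  proof eventually_elim
    case (elim s)
    have X: "?w s \<in> X" "?v s \<in> X" using elim w0 v0 by (auto intro: diff)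
    have "B (w s) (v s) - B w0 v0 = B (?w s) (?v s) + B (?w s) v0 + B w0 (?v s)"
      using elim w0 v0 X by (simp add: diff_left diff_right)
    moreover have "\<bar>B (?w s) (?v s)\<bar> \<le> N (?w s) * N (?v s)" "\<bar>B (?w s) v0\<bar> \<le> N (?w s) * N v0"
       "\<bar>B w0 (?v s)\<bar> \<le> N w0 * N (?v s)"
      using X w0 v0 by (auto intro: Cauchy_Schwarz)
    ultimately show ?case by simp
  qed
  ultimately have "((\<lambda>s. B (w s) (v s) - B w0 v0) \<longlongrightarrow> 0) F"
    by (rule Lim_null_comparison[rotated])
  then show ?thesis by (simp add: LIM_zero_iff)
qed

lemma continuous_on_B:
  assumes w: "C0_curve X N w" and v: "C0_curve X N v"
  shows "continuous_on ({0..} \<times> {0..}) (\<lambda>p. B (w (fst p)) (v (snd p)))"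
  unfolding continuous_on_def
proof
  fix p :: "real \<times> real" assume p: "p \<in> {0..} \<times> {0..}"
  let ?F = "at p within {0..} \<times> {0..}"
  have lim: "((\<lambda>q. N (\<lambda>z. c (g q) z - c (g p) z)) \<longlongrightarrow> 0) ?F"
    if c: "C0_curve X N c" and g: "(g \<longlongrightarrow> g p) ?F" "\<forall>\<^sub>F q in ?F. g q \<in> {0..}" "g p \<ge> 0" for c g
  proof -
    have "c (g p) \<in> X" using c g by (auto simp: C0_curve_def)
    then have 0: "N (\<lambda>z. c (g p) z - c (g p) z) = 0"
      using diff_left[of "c (g p)" "c (g p)" "\<lambda>z. c (g p) z - c (g p) z"] diff[of "c (g p)" "c (g p)"]
      by (simp add: N_def)
    have "continuous (at (g p) within {0..}) (\<lambda>s. N (\<lambda>z. c s z - c (g p) z))"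
      unfolding continuous_within 0 using c g(3) by (auto simp: C0_curve_def)
    from continuous_within_tendsto_compose[OF this g(2,1)] show ?thesis by (simp only: 0)
  qed
  have ev: "\<forall>\<^sub>F q in ?F. fst q \<in> {0..}" "\<forall>\<^sub>F q in ?F. snd q \<in> {0..}"
    by (auto simp: eventually_at_filter intro!: always_eventually)
  show "((\<lambda>p. B (w (fst p)) (v (snd p))) \<longlongrightarrow> B (w (fst p)) (v (snd p))) ?F"
  proof (rule tendsto_B)
    show "\<forall>\<^sub>F q in ?F. w (fst q) \<in> X" "\<forall>\<^sub>F q in ?F. v (snd q) \<in> X"
    proof -
      show "\<forall>\<^sub>F q in ?F. w (fst q) \<in> X"
        using ev(1) by (rule eventually_mono) (use w in \<open>auto simp: C0_curve_def\<close>)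
      show "\<forall>\<^sub>F q in ?F. v (snd q) \<in> X"
        using ev(2) by (rule eventually_mono) (use v in \<open>auto simp: C0_curve_def\<close>)
    qed
    show "w (fst p) \<in> X" "v (snd p) \<in> X" using p w v by (auto simp: C0_curve_def)
    show "((\<lambda>s. N (\<lambda>z. w (fst s) z - w (fst p) z)) \<longlongrightarrow> 0) ?F"
      by (rule lim[OF w]) (use p ev in \<open>auto intro!: tendsto_intros\<close>)
    show "((\<lambda>s. N (\<lambda>z. v (snd s) z - v (snd p) z)) \<longlongrightarrow> 0) ?F"
      by (rule lim[OF v]) (use p ev in \<open>auto intro!: tendsto_intros\<close>)
  qed
qed

lemma has_derivative_B:
  assumes u: "\<And>t. t \<ge> 0 \<Longrightarrow> u t \<in> X" and ut: "\<And>t. t \<ge> 0 \<Longrightarrow> ut t \<in> X" and w: "w \<in> X"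
    and d: "has_time_deriv N u ut" and t: "t > 0"
  shows "((\<lambda>s. B (u s) w) has_real_derivative B (ut t) w) (at t)"
proof -
  have at: "at t within {0..} = at t"
    using t by (intro at_within_interior) (auto simp: interior_Ici)
  let ?q = "\<lambda>s z. (u s z - u t z) / (s - t)"
  have q: "?q s \<in> X" "B (?q s) w = (B (u s) w - B (u t) w) / (s - t)" if "s \<ge> 0" for s
    using lin[OF u[OF that] u[of t], of "inverse (s - t)" "- inverse (s - t)"] t
      lin_left[OF u[OF that] u[of t] w, of "inverse (s - t)" "- inverse (s - t)"]
    by (simp_all add: divide_inverse algebra_simps)
  have "((\<lambda>s. N (\<lambda>z. ?q s z - ut t z) * N w) \<longlongrightarrow> 0 * N w) (at t)"
    using d t at by (intro tendsto_intros) (auto simp: has_time_deriv_def dest!: spec[of _ t])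
  then have "((\<lambda>s. N (\<lambda>z. ?q s z - ut t z) * N w) \<longlongrightarrow> 0) (at t)" by simp
  moreover have "\<forall>\<^sub>F s in at t. s \<ge> 0"
    using t by (intro eventually_at_topological[THEN iffD2] exI[of _ "{0<..}"]) auto
  then have "\<forall>\<^sub>F s in at t. norm ((B (u s) w - B (u t) w) / (s - t) - B (ut t) w) \<le> N (\<lambda>z. ?q s z - ut t z) * N w"
  proof eventually_elim
    case (elim s)
    have "(B (u s) w - B (u t) w) / (s - t) - B (ut t) w = B (\<lambda>z. ?q s z - ut t z) w"
      using q[OF elim] ut[of t] t w by (simp add: diff_left)
    then show ?case
      using Cauchy_Schwarz[OF diff[OF q(1)[OF elim] ut[of t]] w] t by simp
  qed
  ultimately have "((\<lambda>s. (B (u s) w - B (u t) w) / (s - t) - B (ut t) w) \<longlongrightarrow> 0) (at t)"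
    by (rule Lim_null_comparison[rotated])
  then show ?thesis by (simp add: has_field_derivative_iff LIM_zero_iff)
qed

end

section \<open>The spaces on the plate\<close>

locale plate_width =
  fixes l :: real
  assumes l_pos: "0 < l"
begin

abbreviation "\<Omega> \<equiv> plate l"
abbreviation "I \<equiv> L2_inner \<Omega>"
abbreviation "L2 \<equiv> L2_space \<Omega>"

lemma open_plate: "open \<Omega>" by (simp add: plate_def open_Times)
lemma plate_borel: "\<Omega> \<in> sets borel" using open_plate by simp
lemma plate_lebesgue: "\<Omega> \<in> sets lebesgue" using plate_borel by simp
lemma bounded_plate: "bounded \<Omega>" by (simp add: plate_def bounded_Times)
lemma plate_lmeasurable: "\<Omega> \<in> lmeasurable"
  using open_plate bounded_plate by (simp add: lmeasurable_open)

lemma finite_measure_plate: "finite_measure (lebesgue_on \<Omega>)"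
  using plate_lmeasurable by (rule finite_measure_lebesgue_on)

lemma L2_D: "f \<in> L2 \<Longrightarrow> f \<in> borel_measurable (lebesgue_on \<Omega>)"
    "f \<in> L2 \<Longrightarrow> integrable (lebesgue_on \<Omega>) (\<lambda>z. (f z)\<^sup>2)"
  by (auto simp: L2_space_def)

lemma L2_mult_integrable:
  assumes "f \<in> L2" "g \<in> L2" shows "integrable (lebesgue_on \<Omega>) (\<lambda>z. f z * g z)"
proof (rule Bochner_Integration.integrable_bound)
  show "integrable (lebesgue_on \<Omega>) (\<lambda>z. (f z)\<^sup>2 + (g z)\<^sup>2)" using assms by (auto dest: L2_D)
  show "(\<lambda>z. f z * g z) \<in> borel_measurable (lebesgue_on \<Omega>)"
    using assms by (intro borel_measurable_times) (auto dest: L2_D)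
  show "AE z in lebesgue_on \<Omega>. norm (f z * g z) \<le> norm ((f z)\<^sup>2 + (g z)\<^sup>2)"
  proof (rule AE_I2)
    fix z
    have "2 * \<bar>f z * g z\<bar> \<le> (f z)\<^sup>2 + (g z)\<^sup>2"
      using sum_squares_bound[of "\<bar>f z\<bar>" "\<bar>g z\<bar>"] by (simp add: abs_mult)
    then show "norm (f z * g z) \<le> norm ((f z)\<^sup>2 + (g z)\<^sup>2)" by simp
  qed
qed

lemma L2_lin: assumes "f \<in> L2" "g \<in> L2" shows "(\<lambda>z. a * f z + b * g z) \<in> L2"
proof -
  have "(\<lambda>z. (a * f z + b * g z)\<^sup>2) = (\<lambda>z. a\<^sup>2 * (f z)\<^sup>2 + b\<^sup>2 * (g z)\<^sup>2 + 2 * a * b * (f z * g z))"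
    by (auto simp: power2_eq_square algebra_simps)
  then show ?thesis unfolding L2_space_def
    using assms L2_mult_integrable[OF assms] L2_D
    by (auto intro!: borel_measurable_add borel_measurable_times)
qed

lemma I_lin_left:
  assumes "f \<in> L2" "g \<in> L2" "h \<in> L2"
  shows "I (\<lambda>z. a * f z + b * g z) h = a * I f h + b * I g h"
  using L2_mult_integrable[OF assms(1,3)] L2_mult_integrable[OF assms(2,3)]
  by (simp add: L2_inner_def algebra_simps)

lemma I_sym: "I f g = I g f" by (simp add: L2_inner_def mult.commute)

lemma I_nonneg: "0 \<le> I f f" by (simp add: L2_inner_def)

sublocale L2: semi_inner L2 I
  by unfold_locales (auto intro: L2_lin I_lin_left I_sym I_nonneg)

lemma L2_N: "L2.N = L2_norm \<Omega>"
  by (auto simp: L2.N_def L2_norm_def fun_eq_iff)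

lemma I_cong_AE:
  assumes "f \<in> L2" "f' \<in> L2" "g \<in> L2" "AE z in lebesgue_on \<Omega>. f z = f' z"
  shows "I f g = I f' g"
  unfolding L2_inner_def
proof (rule integral_cong_AE)
  show "AE z in lebesgue_on \<Omega>. f z * g z = f' z * g z" using assms(4) by eventually_elim simp
qed (use assms L2_D in auto)

lemma L2_integrable: assumes "f \<in> L2" shows "integrable (lebesgue_on \<Omega>) f"
proof -
  interpret finite_measure "lebesgue_on \<Omega>" by (rule finite_measure_plate)
  have "(\<lambda>_. 1) \<in> L2" by (auto simp: L2_space_def)
  from L2_mult_integrable[OF assms this] show ?thesis by simp
qed

lemma L2_continuous: 
  assumes "continuous_on (closure \<Omega>) f" shows "f \<in> L2"
proof -
  interpret finite_measure "lebesgue_on \<Omega>" by (rule finite_measure_plate)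
  have "compact (closure \<Omega>)" using bounded_plate by simp
  then have "bounded (f ` closure \<Omega>)" using assms compact_continuous_image compact_imp_bounded by blast
  then obtain b where b: "\<And>z. z \<in> closure \<Omega> \<Longrightarrow> \<bar>f z\<bar> \<le> b" by (auto simp: bounded_iff)
  have m: "f \<in> borel_measurable (lebesgue_on \<Omega>)"
    using assms closure_subset plate_lebesgue
    by (meson continuous_imp_measurable_on_sets_lebesgue continuous_on_subset)
  have "integrable (lebesgue_on \<Omega>) (\<lambda>z. (f z)\<^sup>2)"
  proof (rule integrable_const_bound[where B = "b\<^sup>2"])
    show "AE z in lebesgue_on \<Omega>. norm ((f z)\<^sup>2) \<le> b\<^sup>2"
    proof (rule AE_I2)
      fix z assume "z \<in> space (lebesgue_on \<Omega>)"
      then have "z \<in> closure \<Omega>" using closure_subset[of \<Omega>] by auto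
      then have "\<bar>f z\<bar> \<le> b" by (rule b)
      then have "\<bar>f z\<bar>\<^sup>2 \<le> b\<^sup>2" by (rule power_mono) simp
      then show "norm ((f z)\<^sup>2) \<le> b\<^sup>2" by simp
    qed
    show "(\<lambda>z. (f z)\<^sup>2) \<in> borel_measurable (lebesgue_on \<Omega>)" using m by measurable
  qed
  then show ?thesis using m by (simp add: L2_space_def)
qed

lemma L2_smooth: "smooth f \<Longrightarrow> f \<in> L2"
  by (intro L2_continuous smooth_continuous_on)

lemma test_smooth: "test_function \<Omega> \<phi> \<Longrightarrow> smooth \<phi>" by (simp add: test_function_iff)

text \<open>Fubini's theorem asks for Borel functions on the whole plane, whereas elements of \<open>L\<^sup>2\<close> are only
  Lebesgue measurable on the plate; \<open>F\<close> is a Borel version of \<open>f\<close>, extended by zero.\<close>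

definition is_rep :: "(real \<times> real \<Rightarrow> real) \<Rightarrow> (real \<times> real \<Rightarrow> real) \<Rightarrow> bool" where
  "is_rep F f \<longleftrightarrow> F \<in> borel_measurable borel \<and> (\<forall>z. z \<notin> \<Omega> \<longrightarrow> F z = 0) \<and>
     (AE z in lebesgue_on \<Omega>. f z = F z)"

lemma ex_rep:
  assumes "f \<in> borel_measurable (lebesgue_on \<Omega>)" shows "\<exists>F. is_rep F f"
proof -
  have "(\<lambda>z. if z \<in> \<Omega> then f z else 0) \<in> borel_measurable lebesgue"
    using assms by (subst borel_measurable_if[OF plate_lebesgue])
  from completion_ex_borel_measurable_real[OF this]
  obtain G where G: "G \<in> borel_measurable lborel" "AE z in lborel. (if z \<in> \<Omega> then f z else 0) = G z"
    by (elim bexE)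
  have "AE z in lebesgue. (if z \<in> \<Omega> then f z else 0) = G z"
    using G(2) by (rule AE_completion)
  then have "AE z in lebesgue_on \<Omega>. f z = indicator \<Omega> z * G z"
    using plate_lebesgue by (subst AE_restrict_space_iff) (auto elim!: eventually_mono)
  then show ?thesis unfolding is_rep_def using G(1) plate_borel
    by (intro exI[of _ "\<lambda>z. indicator \<Omega> z * G z"]) auto
qed

lemma rep_measurable: "F \<in> borel_measurable borel \<Longrightarrow> F \<in> borel_measurable (lebesgue_on \<Omega>)"
  by (intro measurable_restrict_space1 measurable_completion) simp

lemma rep_integral:
  assumes "is_rep F f" "f \<in> borel_measurable (lebesgue_on \<Omega>)"
  shows "(\<integral>z. f z \<partial>lebesgue_on \<Omega>) = (\<integral>z. F z \<partial>lborel)"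
    and "integrable (lebesgue_on \<Omega>) f \<longleftrightarrow> integrable lborel F"
proof -
  have F: "F \<in> borel_measurable borel" "\<And>z. z \<notin> \<Omega> \<Longrightarrow> F z = 0" "AE z in lebesgue_on \<Omega>. f z = F z"
    using assms by (auto simp: is_rep_def)
  have i: "(\<lambda>z. indicator \<Omega> z * F z) = F" using F(2) by (auto simp: indicator_def fun_eq_iff)
  have "(\<integral>z. f z \<partial>lebesgue_on \<Omega>) = (\<integral>z. F z \<partial>lebesgue_on \<Omega>)"
    by (rule integral_cong_AE[OF assms(2) rep_measurable[OF F(1)] F(3)])
  also have "\<dots> = (\<integral>z. F z \<partial>lebesgue)"
    using plate_lebesgue by (subst integral_restrict_space) (auto simp: i)
  also have "\<dots> = (\<integral>z. F z \<partial>lborel)"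
    using F(1) by (intro integral_completion) simp
  finally show "(\<integral>z. f z \<partial>lebesgue_on \<Omega>) = (\<integral>z. F z \<partial>lborel)" .
  have "integrable (lebesgue_on \<Omega>) f \<longleftrightarrow> integrable (lebesgue_on \<Omega>) F"
    by (rule integrable_cong_AE[OF assms(2) rep_measurable[OF F(1)] F(3)])
  also have "\<dots> \<longleftrightarrow> integrable lebesgue F"
    using plate_lebesgue by (subst integrable_restrict_space) (auto simp: i)
  also have "\<dots> \<longleftrightarrow> integrable lborel F"
    using F(1) by (intro integrable_completion) simp
  finally show "integrable (lebesgue_on \<Omega>) f \<longleftrightarrow> integrable lborel F" .
qed

lemma rep_mult:
  assumes "is_rep F f" "is_rep G g" shows "is_rep (\<lambda>z. F z * G z) (\<lambda>z. f z * g z)"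
proof -
  have "AE z in lebesgue_on \<Omega>. f z = F z" "AE z in lebesgue_on \<Omega>. g z = G z"
    using assms by (auto simp: is_rep_def)
  then have "AE z in lebesgue_on \<Omega>. f z * g z = F z * G z" by eventually_elim simp
  then show ?thesis using assms by (auto simp: is_rep_def)
qed

lemma rep_mult_borel:
  assumes "is_rep F f" "\<phi> \<in> borel_measurable borel" shows "is_rep (\<lambda>z. F z * \<phi> z) (\<lambda>z. f z * \<phi> z)"
proof -
  have "AE z in lebesgue_on \<Omega>. f z = F z"
    using assms by (auto simp: is_rep_def)
  then have "AE z in lebesgue_on \<Omega>. f z * \<phi> z = F z * \<phi> z" by eventually_elim simp
  then show ?thesis using assms by (auto simp: is_rep_def)
qed

lemma AE_plate: "(AE z in lebesgue_on \<Omega>. P z) \<longleftrightarrow> (AE z in lebesgue. z \<in> \<Omega> \<longrightarrow> P z)"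
  using plate_lebesgue by (subst AE_restrict_space_iff) auto

lemma rep_I:
  assumes "f \<in> L2" "g \<in> L2" "is_rep F f" "is_rep G g"
  shows "I f g = (\<integral>z. F z * G z \<partial>lborel)"
  unfolding L2_inner_def using rep_integral(1)[OF rep_mult[OF assms(3,4)]] assms L2_D by auto

lemma rep_L2_integrable:
  assumes "f \<in> L2" "is_rep F f"
  shows "integrable lborel F" "integrable lborel (\<lambda>z. (F z)\<^sup>2)"
proof -
  show "integrable lborel F" using rep_integral(2)[OF assms(2)] L2_integrable assms(1) L2_D by auto
  show "integrable lborel (\<lambda>z. (F z)\<^sup>2)"
    using rep_integral(2)[OF rep_mult[OF assms(2,2)]] L2_mult_integrable[OF assms(1,1)] assms(1) L2_D
    by (auto simp: power2_eq_square)
qed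

lemma I_test_products:
  assumes "f \<in> L2" "is_rep F f" and "smooth \<phi>"
  shows "I f \<phi> = (\<integral>z. F z * \<phi> z \<partial>lborel)"
  unfolding L2_inner_def
proof (rule rep_integral(1)[OF rep_mult_borel[OF assms(2)]])
  show "\<phi> \<in> borel_measurable borel"
    using assms(3) by (intro borel_measurable_continuous_onI smooth_continuous_on)
  show "(\<lambda>z. f z * \<phi> z) \<in> borel_measurable (lebesgue_on \<Omega>)"
    using L2_D(1)[OF assms(1)] L2_D(1)[OF L2_smooth[OF assms(3)]] by simp
qed

text \<open>As \<open>weak_deriv\<close> chooses a representative, even its linearity rests on this uniqueness.\<close>

lemma weak_deriv_unique:
  assumes "is_weak_deriv \<Omega> es f h" "is_weak_deriv \<Omega> es f h'"
  shows "AE z in lebesgue_on \<Omega>. h z = h' z"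
proof -
  have h: "h \<in> L2" "h' \<in> L2" using assms by (auto simp: is_weak_deriv_def)
  then have d: "(\<lambda>z. h z - h' z) \<in> L2" by (rule L2.diff)
  then obtain D where D: "is_rep D (\<lambda>z. h z - h' z)" using ex_rep L2_D by blast
  have "AE z in lborel. D z = 0"
  proof (rule AE_0_if_orthogonal_to_products)
    show "integrable lborel D" using rep_L2_integrable[OF d D] by simp
    show "D z = 0" if "z \<notin> {0<..<pi} \<times> {-l<..<l}" for z
      using D that unfolding is_rep_def plate_def by blast
    fix \<alpha> \<beta> assume "test_fun_on 0 pi \<alpha>" "test_fun_on (-l) l \<beta>"
    then have t: "test_function \<Omega> (\<lambda>z. \<alpha> (fst z) * \<beta> (snd z))" (is "test_function _ ?\<phi>")
      unfolding plate_def by (rule test_function_prod)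
    have s: "(- 1) ^ length es * (I h ?\<phi>) = (- 1) ^ length es * (I h' ?\<phi>)"
    proof -
      have "I f (dir_derivs es ?\<phi>) = (- 1) ^ length es * (I h ?\<phi>)"
        "I f (dir_derivs es ?\<phi>) = (- 1) ^ length es * (I h' ?\<phi>)"
        using assms t unfolding is_weak_deriv_def by blast+
      then show ?thesis by linarith
    qed
    then have "I h ?\<phi> = I h' ?\<phi>" by simp
    then have "I (\<lambda>z. h z - h' z) ?\<phi> = 0"
      using L2.diff_left h L2_smooth[OF test_smooth[OF t]] by simp
    then show "(\<integral>z. D z * ?\<phi> z \<partial>lborel) = 0"
      using I_test_products[OF d D test_smooth[OF t]] by simp
  qed
  then have "AE z in lebesgue. D z = 0" by (rule AE_completion)
  then have "AE z in lebesgue_on \<Omega>. D z = 0" by (simp add: AE_plate eventually_mono)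
  moreover have "AE z in lebesgue_on \<Omega>. h z - h' z = D z" using D by (simp add: is_rep_def)
  ultimately show ?thesis by eventually_elim simp
qed

lemma is_weak_deriv_lin:
  assumes f: "f \<in> L2" "g \<in> L2" "is_weak_deriv \<Omega> es f h" "is_weak_deriv \<Omega> es g k"
  shows "is_weak_deriv \<Omega> es (\<lambda>z. a * f z + b * g z) (\<lambda>z. a * h z + b * k z)"
proof -
  have h: "h \<in> L2" "k \<in> L2" using assms by (auto simp: is_weak_deriv_def)
  show ?thesis unfolding is_weak_deriv_def
  proof (intro conjI allI impI)
    show "(\<lambda>z. a * h z + b * k z) \<in> L2" using h by (rule L2_lin)
    fix \<phi> assume t: "test_function \<Omega> \<phi>"
    have "smooth (dir_derivs es \<phi>)" using t by (intro smooth_dir_derivs test_smooth)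
    then show "I (\<lambda>z. a * f z + b * g z) (dir_derivs es \<phi>) = (- 1) ^ length es * I (\<lambda>z. a * h z + b * k z) \<phi>"
      using t assms f h L2_smooth L2_smooth[OF test_smooth[OF t]]
      by (simp add: I_lin_left is_weak_deriv_def algebra_simps)
  qed
qed

definition multi_index :: "(real \<times> real) list \<Rightarrow> bool" where
  "multi_index es \<longleftrightarrow> set es \<subseteq> {(1, 0), (0, 1)} \<and> length es \<le> 2"

lemma Basis_plane: "(Basis :: (real \<times> real) set) = {(1, 0), (0, 1)}"
  by (auto simp: Basis_prod_def)

lemma H2_space_iff: "f \<in> H2_space \<Omega> \<longleftrightarrow> f \<in> L2 \<and> (\<forall>es. multi_index es \<longrightarrow> (\<exists>h. is_weak_deriv \<Omega> es f h))"
  by (auto simp: H2_space_def multi_index_def Basis_plane)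

abbreviation "D es \<equiv> weak_deriv \<Omega> es"

lemma weak_deriv_works: "f \<in> H2_space \<Omega> \<Longrightarrow> multi_index es \<Longrightarrow> is_weak_deriv \<Omega> es f (D es f)"
  unfolding weak_deriv_def H2_space_iff by (rule someI_ex[of "is_weak_deriv \<Omega> es f"]) auto

lemma weak_deriv_L2: "f \<in> H2_space \<Omega> \<Longrightarrow> multi_index es \<Longrightarrow> D es f \<in> L2"
  using weak_deriv_works is_weak_deriv_def by blast

lemma weak_deriv_eq: "f \<in> H2_space \<Omega> \<Longrightarrow> multi_index es \<Longrightarrow> is_weak_deriv \<Omega> es f h \<Longrightarrow> AE z in lebesgue_on \<Omega>. D es f z = h z"
  using weak_deriv_unique weak_deriv_works by blast

lemma H2_space_L2: "f \<in> H2_space \<Omega> \<Longrightarrow> f \<in> L2" by (simp add: H2_space_def)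

lemma H2_space_lin: "f \<in> H2_space \<Omega> \<Longrightarrow> g \<in> H2_space \<Omega> \<Longrightarrow> (\<lambda>z. a * f z + b * g z) \<in> H2_space \<Omega>"
  unfolding H2_space_iff by (intro conjI L2_lin allI impI) (blast intro: is_weak_deriv_lin)+

lemma I_D_lin_left:
  assumes "f \<in> H2_space \<Omega>" "g \<in> H2_space \<Omega>" "multi_index es" "k \<in> L2"
  shows "I (D es (\<lambda>z. a * f z + b * g z)) k = a * I (D es f) k + b * I (D es g) k"
proof -
  have "I (D es (\<lambda>z. a * f z + b * g z)) k = I (\<lambda>z. a * D es f z + b * D es g z) k"
  proof (rule I_cong_AE)
    show "D es (\<lambda>z. a * f z + b * g z) \<in> L2" "(\<lambda>z. a * D es f z + b * D es g z) \<in> L2"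
      using assms by (auto intro: weak_deriv_L2 H2_space_lin L2_lin)
    show "AE z in lebesgue_on \<Omega>. D es (\<lambda>z. a * f z + b * g z) z = a * D es f z + b * D es g z"
      using assms by (intro weak_deriv_eq H2_space_lin is_weak_deriv_lin H2_space_L2 weak_deriv_works)
  qed (rule assms)
  then show ?thesis using assms weak_deriv_L2 by (simp add: I_lin_left)
qed

abbreviation "V \<equiv> H2_star l"
abbreviation "eV \<equiv> H2_star_inner l"

lemma V_H2: "f \<in> V \<Longrightarrow> f \<in> H2_space \<Omega>" by (simp add: H2_star_def)
lemma V_L2: "f \<in> V \<Longrightarrow> f \<in> L2" using V_H2 H2_space_L2 by blast

lemma V_lin:
  assumes "f \<in> V" "g \<in> V" shows "(\<lambda>z. a * f z + b * g z) \<in> V"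
proof -
  obtain W W' where W: "continuous_on ({0..pi} \<times> {-l..l}) W" "AE z in lebesgue_on \<Omega>. f z = W z"
     "\<forall>z \<in> {0, pi} \<times> {-l..l}. W z = 0" "continuous_on ({0..pi} \<times> {-l..l}) W'" 
     "AE z in lebesgue_on \<Omega>. g z = W' z" "\<forall>z \<in> {0, pi} \<times> {-l..l}. W' z = 0"
    using assms by (auto simp: H2_star_def)
  have "AE z in lebesgue_on \<Omega>. a * f z + b * g z = a * W z + b * W' z"
    using W(2,5) by eventually_elim simp
  moreover have "continuous_on ({0..pi} \<times> {-l..l}) (\<lambda>z. a * W z + b * W' z)"
    using W by (intro continuous_intros)
  ultimately show ?thesis
    using W assms unfolding H2_star_def
    by (auto intro: H2_space_lin intro!: exI[of _ "\<lambda>z. a * W z + b * W' z"])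
qed

lemma multi_index_simps [simp]: "multi_index [(1, 0)]" "multi_index [(0, 1)]" "multi_index [(1, 0), (1, 0)]" "multi_index [(1, 0), (0, 1)]" "multi_index [(0, 1), (0, 1)]"
  by (auto simp: multi_index_def)

lemma H2_star_inner_eq:
  assumes "u \<in> H2_space \<Omega>" "v \<in> H2_space \<Omega>"
  shows "eV u v = I (weak_xx l u) (weak_xx l v) + I (weak_yy l u) (weak_yy l v)
     + 1/5 * (I (weak_xx l u) (weak_yy l v) + I (weak_yy l u) (weak_xx l v))
     + 8/5 * I (weak_xy l u) (weak_xy l v)"
proof -
  have L: "weak_xx l w \<in> L2" "weak_yy l w \<in> L2" "weak_xy l w \<in> L2" if "w \<in> H2_space \<Omega>" for w
    using that by (auto simp: weak_xx_def weak_yy_def weak_xy_def intro: weak_deriv_L2)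
  have i: "integrable (lebesgue_on \<Omega>) (\<lambda>z. weak_xx l u z * weak_xx l v z)"
     "integrable (lebesgue_on \<Omega>) (\<lambda>z. weak_yy l u z * weak_yy l v z)"
     "integrable (lebesgue_on \<Omega>) (\<lambda>z. weak_xx l u z * weak_yy l v z)"
     "integrable (lebesgue_on \<Omega>) (\<lambda>z. weak_yy l u z * weak_xx l v z)"
     "integrable (lebesgue_on \<Omega>) (\<lambda>z. weak_xy l u z * weak_xy l v z)"
    using L assms by (auto intro: L2_mult_integrable)
  have "eV u v = (\<integral>z. weak_xx l u z * weak_xx l v z + weak_yy l u z * weak_yy l v z
     + 1/5 * (weak_xx l u z * weak_yy l v z + weak_yy l u z * weak_xx l v z)
     + 8/5 * (weak_xy l u z * weak_xy l v z) \<partial>lebesgue_on \<Omega>)"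
    unfolding H2_star_inner_def poisson_ratio_def
    by (intro Bochner_Integration.integral_cong refl) (simp add: field_simps)
  then show ?thesis using i by (simp add: L2_inner_def)
qed

text \<open>With the Poisson ratio \<open>1 / 5\<close>, the difference of the two sides is the squared norm of
  \<open>u\<^sub>y\<^sub>y + u\<^sub>x\<^sub>x / 5\<close>.\<close>

lemma H2_star_inner_lower:
  assumes "u \<in> H2_space \<Omega>"
  shows "24/25 * I (weak_xx l u) (weak_xx l u) + 8/5 * I (weak_xy l u) (weak_xy l u) \<le> eV u u"
proof -
  let ?x = "weak_xx l u" and ?y = "weak_yy l u"
  have L: "?x \<in> L2" "?y \<in> L2"
    using assms by (auto simp: weak_xx_def weak_yy_def intro: weak_deriv_L2)
  let ?k = "\<lambda>z. 1/5 * ?x z + 1 * ?y z"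
  have k: "?k \<in> L2" using L by (rule L2_lin)
  have "0 \<le> I ?k ?k" by (rule I_nonneg)
  also have "\<dots> = 1/5 * I ?x ?k + 1 * I ?y ?k" by (rule I_lin_left[OF L k])
  also have "I ?x ?k = 1/5 * I ?x ?x + 1 * I ?y ?x" using I_lin_left[OF L L(1)] I_sym by metis
  also have "I ?y ?k = 1/5 * I ?x ?y + 1 * I ?y ?y" using I_lin_left[OF L L(2)] I_sym by metis
  finally show ?thesis using I_sym[of ?x ?y] 
    by (simp add: H2_star_inner_eq[OF assms assms] field_simps)
qed

sublocale V: semi_inner V eV
proof
  fix f g h :: "real \<times> real \<Rightarrow> real" and c d :: real
  assume V: "f \<in> V" "g \<in> V"
  then show "(\<lambda>z. c * f z + d * g z) \<in> V" by (rule V_lin)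
  have H: "f \<in> H2_space \<Omega>" "g \<in> H2_space \<Omega>" using V V_H2 by auto
  show "eV f g = eV g f" using H by (simp add: H2_star_inner_eq I_sym)
  show "eV (\<lambda>z. c * f z + d * g z) h = c * eV f h + d * eV g h" if "h \<in> V"
  proof -
    have h: "h \<in> H2_space \<Omega>" using that V_H2 by auto
    show ?thesis
      using H h by (simp add: H2_star_inner_eq H2_space_lin weak_xx_def weak_yy_def weak_xy_def I_D_lin_left weak_deriv_L2 algebra_simps)
  qed
next
  fix f assume "f \<in> V"
  then show "0 \<le> eV f f"
    using H2_star_inner_lower[OF V_H2, of f] I_nonneg[of "weak_xx l f"] I_nonneg[of "weak_xy l f"] by simp
qed

lemma V_N: "V.N = H2_star_norm l"
  by (auto simp: V.N_def H2_star_norm_def fun_eq_iff)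

abbreviation "bx u v \<equiv> I (weak_x l u) (weak_x l v)"

sublocale B: semi_inner V bx
proof
  fix f g h :: "real \<times> real \<Rightarrow> real" and c d :: real
  assume V: "f \<in> V" "g \<in> V"
  then show "(\<lambda>z. c * f z + d * g z) \<in> V" by (rule V_lin)
  show "bx (\<lambda>z. c * f z + d * g z) h = c * bx f h + d * bx g h" if "h \<in> V"
    using V that V_H2 by (simp add: weak_x_def I_D_lin_left weak_deriv_L2)
qed (auto intro: I_sym I_nonneg)

lemma weak_x_L2: "f \<in> V \<Longrightarrow> weak_x l f \<in> L2" and weak_xx_L2: "f \<in> V \<Longrightarrow> weak_xx l f \<in> L2"
  and weak_xy_L2: "f \<in> V \<Longrightarrow> weak_xy l f \<in> L2"
  by (auto simp: weak_x_def weak_xx_def weak_xy_def intro: weak_deriv_L2 V_H2)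

end

section \<open>Integration by parts in the long direction\<close>

lemma AE_ex_in_interval:
  assumes "AE x in lborel. P x" "s < (t::real)" shows "\<exists>x. s < x \<and> x < t \<and> P x"
proof (rule ccontr)
  assume n: "\<not> ?thesis"
  from assms(1) have "AE x in lborel. x \<notin> {s<..<t}"
    using n by (auto elim!: eventually_mono)
  then have "emeasure lborel {s<..<t} = 0"
    by (subst (asm) AE_iff_measurable[of "{s<..<t}"]) (auto simp: space_lborel)
  then show False using assms(2) by simp
qed

lemma tendsto_primitive:
  fixes r :: "real \<Rightarrow> real"
  assumes r: "integrable lborel r" and X: "X \<longlonglongrightarrow> x"
  shows "(\<lambda>n. \<integral>s. (if s \<le> X n then r s else 0) \<partial>lborel) \<longlonglongrightarrow> (\<integral>s. (if s \<le> x then r s else 0) \<partial>lborel)"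
proof (rule integral_dominated_convergence)
  show "integrable lborel (\<lambda>s. \<bar>r s\<bar>)" using r by simp
  show "AE s in lborel. (\<lambda>n. if s \<le> X n then r s else 0) \<longlonglongrightarrow> (if s \<le> x then r s else 0)"
  proof (rule AE_mp[OF AE_lborel_singleton[of x]], intro AE_I2 impI)
    fix s assume "s \<noteq> x"
    then consider "s < x" | "x < s" by linarith
    then show "(\<lambda>n. if s \<le> X n then r s else 0) \<longlonglongrightarrow> (if s \<le> x then r s else 0)"
    proof cases
      case 1
      have "\<forall>\<^sub>F n in sequentially. s < X n" using order_tendstoD(1)[OF X 1] .
      then have "\<forall>\<^sub>F n in sequentially. r s = (if s \<le> X n then r s else 0)" by eventually_elim simp
      from Lim_transform_eventually[OF tendsto_const this] show ?thesis using 1 by simp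
    next
      case 2
      have "\<forall>\<^sub>F n in sequentially. X n < s" using order_tendstoD(2)[OF X 2] .
      then have "\<forall>\<^sub>F n in sequentially. 0 = (if s \<le> X n then r s else 0)" by eventually_elim simp
      from Lim_transform_eventually[OF tendsto_const this] show ?thesis using 2 by simp
    qed
  qed
qed (use r in auto)

text \<open>An end point is a limit of interior points at which the identity holds, and both sides are
  continuous.\<close>

lemma primitive_at_point:
  fixes r w :: "real \<Rightarrow> real"
  assumes r: "integrable lborel r" and AB: "A < B" and w: "continuous_on {A..B} w" and x: "x \<in> {A, B}"
    and eq: "AE x in lborel. x \<in> {A<..<B} \<longrightarrow> w x = c + (\<integral>s. (if s \<le> x then r s else 0) \<partial>lborel)"
  shows "w x = c + (\<integral>s. (if s \<le> x then r s else 0) \<partial>lborel)"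
proof -
  have "\<exists>y. \<bar>y - x\<bar> < 1 / Suc n \<and> y \<in> {A<..<B} \<and> w y = c + (\<integral>s. (if s \<le> y then r s else 0) \<partial>lborel)" for n
  proof -
    define e where "e = min (1 / Suc n) (B - A)"
    have e: "e > 0" "e \<le> 1 / Suc n" "e \<le> B - A" using AB by (auto simp: e_def)
    show ?thesis
    proof (cases "x = A")
      case True
      from AE_ex_in_interval[OF eq, of A "A + e"] e obtain y where y: "A < y" "y < A + e"
        "y \<in> {A<..<B} \<longrightarrow> w y = c + (\<integral>s. (if s \<le> y then r s else 0) \<partial>lborel)" by auto
      moreover have "\<bar>y - x\<bar> < 1 / Suc n" using y(1,2) e True unfolding abs_less_iff by linarith
      moreover have "y \<in> {A<..<B}" using y(1,2) e by auto
      ultimately show ?thesis by blast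
    next
      case False
      then have x: "x = B" using x by auto
      from AE_ex_in_interval[OF eq, of "B - e" B] e obtain y where y: "B - e < y" "y < B"
        "y \<in> {A<..<B} \<longrightarrow> w y = c + (\<integral>s. (if s \<le> y then r s else 0) \<partial>lborel)" by auto
      moreover have "\<bar>y - x\<bar> < 1 / Suc n" using y(1,2) e x unfolding abs_less_iff by linarith
      moreover have "y \<in> {A<..<B}" using y(1,2) e by auto
      ultimately show ?thesis by blast
    qed
  qed
  then obtain X where X: "\<And>n. \<bar>X n - x\<bar> < 1 / Suc n" "\<And>n. X n \<in> {A<..<B}"
    "\<And>n. w (X n) = c + (\<integral>s. (if s \<le> X n then r s else 0) \<partial>lborel)" by metis
  have lim: "X \<longlonglongrightarrow> x"
  proof (rule LIM_zero_cancel, rule Lim_null_comparison)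
    show "\<forall>\<^sub>F n in sequentially. norm (X n - x) \<le> 1 / Suc n"
      using X(1) by (intro always_eventually allI) (simp add: less_imp_le)
    show "(\<lambda>n. 1 / real (Suc n)) \<longlonglongrightarrow> 0" using LIMSEQ_inverse_real_of_nat by (simp add: divide_inverse)
  qed
  have "(\<lambda>n. w (X n)) \<longlonglongrightarrow> w x"
    by (rule continuous_on_tendsto_compose[OF w lim])
      (use x AB X(2) in \<open>auto intro!: always_eventually simp: less_imp_le\<close>)
  moreover have "(\<lambda>n. w (X n)) \<longlonglongrightarrow> c + (\<integral>s. (if s \<le> x then r s else 0) \<partial>lborel)"
    unfolding X(3) by (intro tendsto_intros tendsto_primitive r lim)
  ultimately show ?thesis by (rule LIMSEQ_unique)
qed

lemma integral_plane_x_first: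
  fixes F :: "real \<times> real \<Rightarrow> real"
  assumes "integrable lborel F"
  shows "(\<integral>z. F z \<partial>lborel) = (\<integral>y. (\<integral>x. F (x, y) \<partial>lborel) \<partial>lborel)"
    "AE y in lborel. integrable lborel (\<lambda>x. F (x, y))"
    "integrable lborel (\<lambda>y. \<integral>x. F (x, y) \<partial>lborel)"
proof -
  have i: "integrable (lborel \<Otimes>\<^sub>M lborel) (case_prod (\<lambda>x y. F (x, y)))" using assms by (simp add: lborel_prod)
  show "(\<integral>z. F z \<partial>lborel) = (\<integral>y. (\<integral>x. F (x, y) \<partial>lborel) \<partial>lborel)"
    using lborel_pair.integral_snd[OF i] by (simp add: lborel_prod)
  show "AE y in lborel. integrable lborel (\<lambda>x. F (x, y))"
    by (rule lborel_pair.AE_integrable_snd[OF i])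
  show "integrable lborel (\<lambda>y. \<integral>x. F (x, y) \<partial>lborel)"
    by (rule lborel_pair.integrable_snd[OF i])
qed

lemma integral_plane_y_first:
  fixes F :: "real \<times> real \<Rightarrow> real"
  assumes "integrable lborel F"
  shows "(\<integral>z. F z \<partial>lborel) = (\<integral>x. (\<integral>y. F (x, y) \<partial>lborel) \<partial>lborel)"
    "AE x in lborel. integrable lborel (\<lambda>y. F (x, y))"
    "integrable lborel (\<lambda>x. \<integral>y. F (x, y) \<partial>lborel)"
proof -
  have i: "integrable (lborel \<Otimes>\<^sub>M lborel) F" using assms by (simp add: lborel_prod)
  show "(\<integral>z. F z \<partial>lborel) = (\<integral>x. (\<integral>y. F (x, y) \<partial>lborel) \<partial>lborel)"
    using lborel_pair.integral_fst'[OF i] by (simp add: lborel_prod)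
  show "AE x in lborel. integrable lborel (\<lambda>y. F (x, y))"
    by (rule lborel_pair.AE_integrable_fst'[OF i])
  show "integrable lborel (\<lambda>x. \<integral>y. F (x, y) \<partial>lborel)"
    by (rule lborel_pair.integrable_fst'[OF i])
qed

lemma AE_plane_y_first:
  assumes "AE z in lborel. P (z :: real \<times> real)" shows "AE x in lborel. AE y in lborel. P (x, y)"
  using lborel_pair.AE_pair[of P] assms unfolding lborel_prod by blast

lemma AE_plane_x_first:
  assumes "AE z in lborel. P (z :: real \<times> real)" shows "AE y in lborel. AE x in lborel. P (x, y)"
proof -
  have "AE z in lborel \<Otimes>\<^sub>M lborel. P z" unfolding lborel_prod by (rule assms)
  then have "AE z in distr (lborel \<Otimes>\<^sub>M lborel) (lborel \<Otimes>\<^sub>M lborel) (\<lambda>(x, y). (y, x)). P z"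
    by (simp only: lborel_pair.distr_pair_swap[symmetric])
  from AE_distrD[OF measurable_pair_swap' this]
  have "AE z in lborel \<Otimes>\<^sub>M lborel. P (case z of (x, y) \<Rightarrow> (y, x))" .
  from lborel_pair.AE_pair[OF this] show ?thesis by simp
qed

lemma swap_plane:
  fixes F :: "real \<times> real \<Rightarrow> real"
  assumes "F \<in> borel_measurable borel"
  shows "(\<integral>z. F (snd z, fst z) \<partial>lborel) = (\<integral>z. F z \<partial>lborel)"
    "integrable lborel (\<lambda>z. F (snd z, fst z)) \<longleftrightarrow> integrable lborel F"
  using assms lborel_pair.integral_product_swap[of F] lborel_pair.integrable_product_swap_iff[of F]
  by (simp_all add: lborel_prod case_prod_beta' borel_prod)

context plate_width
begin

lemma test_function_dir_derivs:
  assumes "test_function \<Omega> \<phi>" shows "test_function \<Omega> (dir_derivs es \<phi>)"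
proof -
  have s: "smooth (dir_derivs es \<phi>)" using assms by (intro smooth_dir_derivs test_smooth)
  have z: "dir_derivs es \<phi> z = 0" if "z \<in> - closure {z. \<phi> z \<noteq> 0}" for z
    using that
  proof (induction es arbitrary: z)
    case Nil
    then show ?case using closure_subset[of "{z. \<phi> z \<noteq> 0}"] by auto
  next
    case (Cons e es)
    have "((\<lambda>_. 0) has_derivative (\<lambda>_. 0)) (at z)" by simp
    then have "(dir_derivs es \<phi> has_derivative (\<lambda>_. 0)) (at z)"
      by (rule has_derivative_transform_within_open[of _ _ _ _ "- closure {z. \<phi> z \<noteq> 0}"])
        (use Cons in \<open>auto intro: open_Compl\<close>)
    from frechet_derivative_at[OF this, symmetric] show ?case by (simp add: dir_derivs_Cons)
  qed
  then have "{z. dir_derivs es \<phi> z \<noteq> 0} \<subseteq> closure {z. \<phi> z \<noteq> 0}" by blast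
  then have c: "closure {z. dir_derivs es \<phi> z \<noteq> 0} \<subseteq> closure {z. \<phi> z \<noteq> 0}"
    by (rule closure_minimal) simp
  then show ?thesis using assms s unfolding test_function_iff
    by (meson bounded_subset closed_closure compact_eq_bounded_closed order_trans)
qed

text \<open>Testing the definition of \<open>weak_x\<close> with \<open>\<partial>\<^sub>e \<phi>\<close>, which is again a test function.\<close>

lemma weak_deriv_of_weak_x:
  assumes "v \<in> H2_space \<Omega>" "e = (1, 0) \<or> e = (0, 1)"
  shows "is_weak_deriv \<Omega> [e] (weak_x l v) (D [(1, 0), e] v)"
proof -
  have id: "multi_index [(1, 0), e]" "multi_index [(1, 0)]" using assms(2) by (auto simp: multi_index_def)
  show ?thesis unfolding is_weak_deriv_def
  proof (intro conjI allI impI)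
    show "D [(1, 0), e] v \<in> L2" using assms id by (auto intro: weak_deriv_L2)
    fix \<phi> assume t: "test_function \<Omega> \<phi>"
    have 1: "I v (dir_derivs [(1, 0)] (dir_derivs [e] \<phi>)) = - I (weak_x l v) (dir_derivs [e] \<phi>)"
      using weak_deriv_works[OF assms(1) id(2)] test_function_dir_derivs[OF t, of "[e]"]
      unfolding is_weak_deriv_def weak_x_def by auto
    have 2: "I v (dir_derivs [(1, 0), e] \<phi>) = I (D [(1, 0), e] v) \<phi>"
      using weak_deriv_works[OF assms(1) id(1)] t unfolding is_weak_deriv_def by auto
    have "dir_derivs [(1, 0)] (dir_derivs [e] \<phi>) = dir_derivs [(1, 0), e] \<phi>"
      by (simp add: dir_derivs_def)
    then show "I (weak_x l v) (dir_derivs [e] \<phi>) = (- 1) ^ length [e] * I (D [(1, 0), e] v) \<phi>"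
      using 1 2 by simp
  qed
qed

lemma slices_y:
  assumes w: "is_weak_deriv \<Omega> [(0, 1)] p r" and p: "p \<in> L2" and P: "is_rep P p" and R: "is_rep R r"
  shows "\<exists>C. AE x in lborel. AE y in lborel. (x, y) \<in> \<Omega> \<longrightarrow>
     P (x, y) = C x + (\<integral>t. (if t \<le> y then R (x, t) else 0) \<partial>lborel)"
proof -
  have r: "r \<in> L2" using w by (simp add: is_weak_deriv_def)
  have "\<exists>C. AE z in lborel. z \<in> {0<..<pi} \<times> {-l<..<l} \<longrightarrow>
     P z = C (fst z) + (\<integral>t. (if t \<le> snd z then R (fst z, t) else 0) \<partial>lborel)"
  proof (rule weak_derivative_slices)
    show "integrable lborel P" "integrable lborel R" using rep_L2_integrable p r P R by auto
    fix \<alpha> \<beta> assume t: "test_fun_on 0 pi \<alpha>" "test_fun_on (-l) l \<beta>"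
    let ?\<phi> = "\<lambda>z. \<alpha> (fst z) * \<beta> (snd z)"
    have T: "test_function \<Omega> ?\<phi>" unfolding plate_def using t by (rule test_function_prod)
    have s: "smooth \<alpha>" "smooth \<beta>" using t by (auto simp: test_fun_on_def)
    have d: "dir_derivs [(0, 1)] ?\<phi> = (\<lambda>z. \<alpha> (fst z) * deriv \<beta> (snd z))"
      using smooth_prod_deriv[OF s] by (auto simp: dir_derivs_def)
    have sm: "smooth (\<lambda>z. \<alpha> (fst z) * deriv \<beta> (snd z))"
      using smooth_dir_derivs[OF test_smooth[OF T]] d by metis
    have "I p (dir_derivs [(0, 1)] ?\<phi>) = - I r ?\<phi>"
      using w T unfolding is_weak_deriv_def by auto
    then show "(\<integral>z. P z * (\<alpha> (fst z) * deriv \<beta> (snd z)) \<partial>lborel) = - (\<integral>z. R z * (\<alpha> (fst z) * \<beta> (snd z)) \<partial>lborel)"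
      unfolding d I_test_products[OF p P sm] I_test_products[OF r R test_smooth[OF T]] .
  qed (use l_pos in auto)
  then obtain C where "AE z in lborel. z \<in> \<Omega> \<longrightarrow>
     P z = C (fst z) + (\<integral>t. (if t \<le> snd z then R (fst z, t) else 0) \<partial>lborel)" unfolding plate_def by blast
  from AE_plane_y_first[OF this] show ?thesis unfolding fst_conv snd_conv by blast
qed

lemma slices_x:
  assumes w: "is_weak_deriv \<Omega> [(1, 0)] p r" and p: "p \<in> L2" and P: "is_rep P p" and R: "is_rep R r"
  shows "\<exists>C. AE y in lborel. AE x in lborel. (x, y) \<in> \<Omega> \<longrightarrow>
     P (x, y) = C y + (\<integral>s. (if s \<le> x then R (s, y) else 0) \<partial>lborel)"
proof -
  have r: "r \<in> L2" using w by (simp add: is_weak_deriv_def)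
  have Pm: "P \<in> borel_measurable borel" "R \<in> borel_measurable borel" using P R by (auto simp: is_rep_def)
  define P' R' where "P' z = P (snd z, fst z)" and "R' z = R (snd z, fst z)" for z
  have "\<exists>C. AE z in lborel. z \<in> {-l<..<l} \<times> {0<..<pi} \<longrightarrow>
     P' z = C (fst z) + (\<integral>t. (if t \<le> snd z then R' (fst z, t) else 0) \<partial>lborel)"
  proof (rule weak_derivative_slices)
    show "integrable lborel P'" "integrable lborel R'"
      unfolding P'_def R'_def using swap_plane(2) Pm rep_L2_integrable p r P R by auto
    fix \<beta> \<alpha> assume t: "test_fun_on (-l) l \<beta>" "test_fun_on 0 pi \<alpha>"
    let ?\<phi> = "\<lambda>z. \<alpha> (fst z) * \<beta> (snd z)"
    have T: "test_function \<Omega> ?\<phi>" unfolding plate_def using t(2,1) by (rule test_function_prod)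
    have s: "smooth \<alpha>" "smooth \<beta>" using t by (auto simp: test_fun_on_def)
    have d: "dir_derivs [(1, 0)] ?\<phi> = (\<lambda>z. deriv \<alpha> (fst z) * \<beta> (snd z))"
      using smooth_prod_deriv[OF s] by (auto simp: dir_derivs_def)
    have sm: "smooth (\<lambda>z. deriv \<alpha> (fst z) * \<beta> (snd z))"
      using smooth_dir_derivs[OF test_smooth[OF T]] d by metis
    have [measurable]: "\<alpha> \<in> borel_measurable borel" "\<beta> \<in> borel_measurable borel" "deriv \<alpha> \<in> borel_measurable borel"
      using test_fun_measurable t test_fun_deriv by auto
    note [measurable] = Pm
    have "I p (dir_derivs [(1, 0)] ?\<phi>) = - I r ?\<phi>"
      using w T unfolding is_weak_deriv_def by auto
    then have "(\<integral>z. P z * (deriv \<alpha> (fst z) * \<beta> (snd z)) \<partial>lborel) = - (\<integral>z. R z * (\<alpha> (fst z) * \<beta> (snd z)) \<partial>lborel)"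
      unfolding d I_test_products[OF p P sm] I_test_products[OF r R test_smooth[OF T]] .
    moreover have "(\<integral>z. P' z * (\<beta> (fst z) * deriv \<alpha> (snd z)) \<partial>lborel) = (\<integral>z. P z * (deriv \<alpha> (fst z) * \<beta> (snd z)) \<partial>lborel)"
      using swap_plane(1)[of "\<lambda>z. P z * (deriv \<alpha> (fst z) * \<beta> (snd z))"] by (simp add: P'_def mult.commute)
    moreover have "(\<integral>z. R' z * (\<beta> (fst z) * \<alpha> (snd z)) \<partial>lborel) = (\<integral>z. R z * (\<alpha> (fst z) * \<beta> (snd z)) \<partial>lborel)"
      using swap_plane(1)[of "\<lambda>z. R z * (\<alpha> (fst z) * \<beta> (snd z))"] by (simp add: R'_def mult.commute)
    ultimately show "(\<integral>z. P' z * (\<beta> (fst z) * deriv \<alpha> (snd z)) \<partial>lborel) = - (\<integral>z. R' z * (\<beta> (fst z) * \<alpha> (snd z)) \<partial>lborel)"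
      by simp
  qed (use l_pos in auto)
  then obtain C where "AE z in lborel. z \<in> {-l<..<l} \<times> {0<..<pi} \<longrightarrow>
     P' z = C (fst z) + (\<integral>t. (if t \<le> snd z then R' (fst z, t) else 0) \<partial>lborel)" by blast
  from AE_plane_y_first[OF this]
  have "AE y in lborel. AE x in lborel. (x, y) \<in> \<Omega> \<longrightarrow>
     P (x, y) = C y + (\<integral>s. (if s \<le> x then R (s, y) else 0) \<partial>lborel)"
    unfolding fst_conv snd_conv P'_def R'_def plate_def by (simp add: conj_commute)
  then show ?thesis by blast
qed

text \<open>This is where the condition on the short edges enters: the constant of integration on a line is
  the boundary value at \<open>x = 0\<close>, hence zero, and the boundary value at \<open>x = pi\<close> is then the integral of
  the derivative over the whole line.\<close>

lemma slices_boundary: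
  assumes w: "w \<in> V" and W: "is_rep W w" and Q: "is_rep Q (weak_x l w)"
  shows "AE y in lborel. integrable lborel (\<lambda>x. Q (x, y)) \<and> (\<integral>x. Q (x, y) \<partial>lborel) = 0 \<and>
     (AE x in lborel. W (x, y) = (\<integral>s. (if s \<le> x then Q (s, y) else 0) \<partial>lborel))"
proof -
  have wd: "is_weak_deriv \<Omega> [(1, 0)] w (weak_x l w)"
    unfolding weak_x_def using w by (intro weak_deriv_works V_H2) simp_all
  obtain C where C: "AE y in lborel. AE x in lborel. (x, y) \<in> \<Omega> \<longrightarrow>
     W (x, y) = C y + (\<integral>s. (if s \<le> x then Q (s, y) else 0) \<partial>lborel)"
    using slices_x[OF wd V_L2[OF w] W Q] by blast
  obtain w' where w': "continuous_on ({0..pi} \<times> {-l..l}) w'" "AE z in lebesgue_on \<Omega>. w z = w' z"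
      "\<forall>z \<in> {0, pi} \<times> {-l..l}. w' z = 0"
    using w by (auto simp: H2_star_def)
  have W0: "W z = 0" "Q z = 0" if "z \<notin> \<Omega>" for z using W Q that unfolding is_rep_def by blast+
  have Qi: "integrable lborel Q"
    using rep_L2_integrable[OF _ Q] weak_x_L2[OF w] by simp
  define w1 where "w1 z = (if z \<in> \<Omega> then w' z else 0)" for z
  have "AE z in lebesgue_on \<Omega>. w z = W z" using W by (simp add: is_rep_def)
  with w'(2) have "AE z in lebesgue_on \<Omega>. W z = w' z" by eventually_elim simp
  then have "AE z in lebesgue. z \<in> \<Omega> \<longrightarrow> W z = w' z" by (simp add: AE_plate)
  then have "AE z in lborel. z \<in> \<Omega> \<longrightarrow> W z = w' z" by (simp add: AE_completion_iff)
  from AE_plane_x_first[OF this]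
  have eq: "AE y in lborel. AE x in lborel. (x, y) \<in> \<Omega> \<longrightarrow> W (x, y) = w' (x, y)" by simp
  show ?thesis
    using C eq integral_plane_x_first(2)[OF Qi]
  proof eventually_elim
    case (elim y)
    show ?case
    proof (cases "y \<in> {-l<..<l}")
      case False
      then have "Q (x, y) = 0" "W (x, y) = 0" for x by (auto intro!: W0 simp: plate_def)
      then show ?thesis by (simp cong: if_cong)
    next
      case True
      let ?J = "\<lambda>x. \<integral>s. (if s \<le> x then Q (s, y) else 0) \<partial>lborel"
      have ae: "AE x in lborel. x \<in> {0<..<pi} \<longrightarrow> w' (x, y) = C y + ?J x"
        using elim(1,2) by eventually_elim (use True in \<open>auto simp: plate_def\<close>)
      have c: "continuous_on {0..pi} (\<lambda>x. w' (x, y))"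
        using True by (intro continuous_on_compose2[OF w'(1)] continuous_intros) auto
      have b: "w' (x, y) = C y + ?J x" if "x \<in> {0, pi}" for x
        using primitive_at_point[OF elim(3) pi_gt_zero c that ae] .
      have Q0: "Q (x, y) = 0" if "x \<le> 0 \<or> x \<ge> pi" for x using that by (intro W0) (auto simp: plate_def)
      have "?J 0 = 0" using Q0 by (intro integral_eq_zero_AE AE_I2) auto
      then have C0: "C y = 0" using b[of 0] w'(3) True by auto
      have "?J pi = (\<integral>s. Q (s, y) \<partial>lborel)" using Q0 by (intro Bochner_Integration.integral_cong) auto
      then have int0: "(\<integral>s. Q (s, y) \<partial>lborel) = 0" using b[of pi] w'(3) True C0 by auto
      have "AE x in lborel. W (x, y) = ?J x"
        using elim(1)
      proof eventually_elim
        fix x assume h: "(x, y) \<in> \<Omega> \<longrightarrow> W (x, y) = C y + ?J x"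
        consider "(x, y) \<in> \<Omega>" | "x \<le> 0" | "x \<ge> pi" using True by (force simp: plate_def)
        then show "W (x, y) = ?J x"
        proof cases
          case 1 then show ?thesis using h C0 by simp
        next
          case 2
          have "?J x = 0" using Q0 2 by (intro integral_eq_zero_AE AE_I2) auto
          moreover have "W (x, y) = 0" using 2 by (intro W0) (auto simp: plate_def)
          ultimately show ?thesis by simp
        next
          case 3
          have "?J x = (\<integral>s. Q (s, y) \<partial>lborel)" using Q0 3 by (intro Bochner_Integration.integral_cong) auto
          moreover have "W (x, y) = 0" using 3 by (intro W0) (auto simp: plate_def)
          ultimately show ?thesis using int0 by simp
        qed
      qed
      then show ?thesis using elim(3) int0 by simp
    qed
  qed
qed

text \<open>On almost every line in the \<open>x\<close> direction, \<open>v\<^sub>x\<close> is a constant plus the primitive of \<open>v\<^sub>x\<^sub>x\<close>. The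
  constant drops out because \<open>w\<^sub>x\<close> has integral zero on the line, and exchanging the order of
  integration in the rest produces \<open>w\<close>. There is no boundary term on the long edges, as the lines end
  on the short ones.\<close>

lemma integration_by_parts:
  assumes v: "v \<in> V" and w: "w \<in> V"
  shows "bx v w = - I (weak_xx l v) w"
proof -
  have L: "weak_x l v \<in> L2" "weak_x l w \<in> L2" "weak_xx l v \<in> L2" "w \<in> L2"
    using assms by (auto intro: weak_x_L2 weak_xx_L2 V_L2)
  obtain P Q R W where P: "is_rep P (weak_x l v)" and Q: "is_rep Q (weak_x l w)"
    and R: "is_rep R (weak_xx l v)" and W: "is_rep W w"
    using ex_rep L L2_D(1) by metis
  have wd: "is_weak_deriv \<Omega> [(1, 0)] (weak_x l v) (weak_xx l v)"
    unfolding weak_xx_def by (intro weak_deriv_of_weak_x V_H2 v) simp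
  obtain C where C: "AE y in lborel. AE x in lborel. (x, y) \<in> \<Omega> \<longrightarrow>
     P (x, y) = C y + (\<integral>s. (if s \<le> x then R (s, y) else 0) \<partial>lborel)"
    using slices_x[OF wd L(1) P R] by blast
  have PQ: "integrable lborel (\<lambda>z. P z * Q z)" and RW: "integrable lborel (\<lambda>z. R z * W z)"
    using rep_integral(2)[OF rep_mult[OF P Q]] rep_integral(2)[OF rep_mult[OF R W]] L2_mult_integrable L L2_D(1) by auto
  have Q0: "Q z = 0" if "z \<notin> \<Omega>" for z using Q that unfolding is_rep_def by blast
  have Ri: "integrable lborel R" using rep_L2_integrable[OF _ R] L by simp
  have ae: "AE y in lborel. (\<integral>x. P (x, y) * Q (x, y) \<partial>lborel) = - (\<integral>x. R (x, y) * W (x, y) \<partial>lborel)"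
    using C slices_boundary[OF w W Q] integral_plane_x_first(2)[OF Ri] integral_plane_x_first(2)[OF PQ] integral_plane_x_first(2)[OF RW]
  proof eventually_elim
    case (elim y)
    let ?r = "\<lambda>x. R (x, y)" and ?q = "\<lambda>x. Q (x, y)"
    let ?J = "\<lambda>x. \<integral>s. (if s \<le> x then ?r s else 0) \<partial>lborel"
    let ?K = "\<lambda>x. \<integral>s. (if s \<le> x then ?q s else 0) \<partial>lborel"
    have q: "integrable lborel ?q" "(\<integral>x. ?q x \<partial>lborel) = 0" and WK: "AE x in lborel. W (x, y) = ?K x"
      using elim(2) by auto
    have e1: "AE x in lborel. P (x, y) * ?q x - C y * ?q x = ?q x * ?J x"
      using elim(1)
    proof eventually_elim
      case (elim x)
      then show ?case by (cases "(x, y) \<in> \<Omega>") (auto simp: Q0 algebra_simps)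
    qed
    have "(\<integral>x. P (x, y) * ?q x \<partial>lborel) = (\<integral>x. P (x, y) * ?q x - C y * ?q x \<partial>lborel)"
      using elim(4) q by simp
    also have "\<dots> = (\<integral>x. ?q x * ?J x \<partial>lborel)"
    proof (rule integral_cong_AE[OF _ _ e1])
      show "(\<lambda>x. P (x, y) * ?q x - C y * ?q x) \<in> borel_measurable lborel"
        using borel_measurable_integrable[OF elim(4)] borel_measurable_integrable[OF q(1)]
        by (intro borel_measurable_diff borel_measurable_times[OF borel_measurable_const]) auto
      show "(\<lambda>x. ?q x * ?J x) \<in> borel_measurable lborel"
        using borel_measurable_integrable[OF q(1)] borel_measurable_integrable[OF elim(3)] by measurable
    qed
    also have "\<dots> = (\<integral>t. ?r t * (\<integral>x. (if t \<le> x then ?q x else 0) \<partial>lborel) \<partial>lborel)"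
      by (rule integral_primitive_swap[OF q(1) elim(3)])
    also have "\<dots> = (\<integral>t. - (?r t * W (t, y)) \<partial>lborel)"
    proof (rule integral_cong_AE)
      have t: "(\<integral>x. (if t \<le> x then ?q x else 0) \<partial>lborel) = - ?K t" for t
      proof -
        have i: "integrable lborel (\<lambda>x. if t \<le> x then ?q x else 0)" "integrable lborel (\<lambda>x. if x \<le> t then ?q x else 0)"
          using borel_measurable_integrable[OF q(1)]
          by (auto intro!: Bochner_Integration.integrable_bound[OF q(1)])
        have "(\<integral>x. (if t \<le> x then ?q x else 0) + (if x \<le> t then ?q x else 0) \<partial>lborel) = (\<integral>x. ?q x \<partial>lborel)"
        proof (rule integral_cong_AE)
          show "AE x in lborel. (if t \<le> x then ?q x else 0) + (if x \<le> t then ?q x else 0) = ?q x"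
            by (rule AE_mp[OF AE_lborel_singleton[of t]]) (intro AE_I2 impI, auto)
        qed (use i q in auto)
        then show ?thesis using i q(2) by simp
      qed
      show "AE t in lborel. ?r t * (\<integral>x. (if t \<le> x then ?q x else 0) \<partial>lborel) = - (?r t * W (t, y))"
        using WK unfolding t by eventually_elim simp
      show "(\<lambda>t. ?r t * (\<integral>x. (if t \<le> x then ?q x else 0) \<partial>lborel)) \<in> borel_measurable lborel"
        using borel_measurable_integrable[OF q(1)] borel_measurable_integrable[OF elim(3)] by measurable
      show "(\<lambda>t. - (?r t * W (t, y))) \<in> borel_measurable lborel"
        using elim(5) by auto
    qed
    finally show ?case by simp
  qed
  have "bx v w = (\<integral>y. (\<integral>x. P (x, y) * Q (x, y) \<partial>lborel) \<partial>lborel)"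
    using rep_I[OF L(1,2) P Q] integral_plane_x_first(1)[OF PQ] by simp
  also have "\<dots> = (\<integral>y. - (\<integral>x. R (x, y) * W (x, y) \<partial>lborel) \<partial>lborel)"
    using integral_plane_x_first(3)[OF PQ] integral_plane_x_first(3)[OF RW] by (intro integral_cong_AE ae) auto
  also have "\<dots> = - I (weak_xx l v) w"
    using rep_I[OF L(3,4) R W] integral_plane_x_first(1)[OF RW] by simp
  finally show ?thesis .
qed

end

section \<open>Reflection and torsional parts\<close>

definition \<rho> :: "real \<times> real \<Rightarrow> real \<times> real" where "\<rho> z = (fst z, - snd z)"

lemma rho_rho [simp]: "\<rho> (\<rho> z) = z" by (simp add: \<rho>_def)

lemma torsional_rho: "torsional f = (\<lambda>z. (f z - f (\<rho> z)) / 2)"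
  by (auto simp: torsional_def \<rho>_def fun_eq_iff)

lemma bounded_linear_rho: "bounded_linear \<rho>"
  unfolding \<rho>_def by (intro bounded_linear_Pair bounded_linear_fst bounded_linear_minus bounded_linear_snd)

lemma rho_lebesgue: "\<rho> \<in> lebesgue \<rightarrow>\<^sub>M lebesgue" "distr lebesgue lebesgue \<rho> = lebesgue"
proof -
  define c where "c j = fst j - snd j" for j :: "real \<times> real"
  have B: "(Basis :: (real \<times> real) set) = {(1, 0), (0, 1)}" by (auto simp: Basis_prod_def)
  have nz: "c j \<noteq> 0" if "j \<in> Basis" for j using that by (auto simp: B c_def)
  have T: "(\<lambda>x. 0 + (\<Sum>j\<in>Basis. (c j * (x \<bullet> j)) *\<^sub>R j)) = \<rho>"
    by (auto simp: B c_def \<rho>_def fun_eq_iff)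
  have p: "(\<Prod>j\<in>Basis. \<bar>c j\<bar>) = 1" by (simp add: B c_def)
  show "\<rho> \<in> lebesgue \<rightarrow>\<^sub>M lebesgue"
    using lebesgue_affine_measurable[of c 0] nz unfolding T by auto
  have "lebesgue = density (distr lebesgue lebesgue \<rho>) (\<lambda>_. (\<Prod>j\<in>Basis. \<bar>c j\<bar>))"
    using lebesgue_affine_euclidean[of c 0] nz unfolding T by auto
  then show "distr lebesgue lebesgue \<rho> = lebesgue" by (simp add: p density_1)
qed

context plate_width
begin

lemma rho_plate [simp]: "\<rho> z \<in> \<Omega> \<longleftrightarrow> z \<in> \<Omega>"
  by (cases z) (auto simp: \<rho>_def plate_def)

lemma AE_rho:
  assumes "AE z in lebesgue_on \<Omega>. P z" shows "AE z in lebesgue_on \<Omega>. P (\<rho> z)"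
proof -
  have "AE z in distr lebesgue lebesgue \<rho>. z \<in> \<Omega> \<longrightarrow> P z"
    unfolding rho_lebesgue(2) using assms by (simp add: AE_plate)
  from AE_distrD[OF rho_lebesgue(1) this] show ?thesis by (simp add: AE_plate)
qed

lemma rho_on_plate:
  fixes f :: "real \<times> real \<Rightarrow> real"
  assumes f: "f \<in> borel_measurable (lebesgue_on \<Omega>)"
  shows "(\<lambda>z. f (\<rho> z)) \<in> borel_measurable (lebesgue_on \<Omega>)"
    "(\<integral>z. f (\<rho> z) \<partial>lebesgue_on \<Omega>) = (\<integral>z. f z \<partial>lebesgue_on \<Omega>)"
    "integrable (lebesgue_on \<Omega>) f \<Longrightarrow> integrable (lebesgue_on \<Omega>) (\<lambda>z. f (\<rho> z))"
proof -
  let ?f = "\<lambda>z. if z \<in> \<Omega> then f z else 0"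
  have m: "?f \<in> borel_measurable lebesgue"
    using f by (subst borel_measurable_if[OF plate_lebesgue])
  have "(\<lambda>z. ?f (\<rho> z)) \<in> borel_measurable lebesgue"
    using measurable_compose[OF rho_lebesgue(1) m] .
  then have m2: "(\<lambda>z. if z \<in> \<Omega> then f (\<rho> z) else 0) \<in> borel_measurable lebesgue" by simp
  then show "(\<lambda>z. f (\<rho> z)) \<in> borel_measurable (lebesgue_on \<Omega>)"
    using borel_measurable_if[OF plate_lebesgue] by blast
  have r: "(\<integral>z. g z \<partial>lebesgue_on \<Omega>) = (\<integral>z. (if z \<in> \<Omega> then g z else 0) \<partial>lebesgue)"
     "integrable (lebesgue_on \<Omega>) g \<longleftrightarrow> integrable lebesgue (\<lambda>z. if z \<in> \<Omega> then g z else 0)" for g :: "real \<times> real \<Rightarrow> real"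
  proof -
    have "(\<lambda>z. indicator \<Omega> z *\<^sub>R g z) = (\<lambda>z. if z \<in> \<Omega> then g z else 0)" by (auto simp: indicator_def)
    then show "(\<integral>z. g z \<partial>lebesgue_on \<Omega>) = (\<integral>z. (if z \<in> \<Omega> then g z else 0) \<partial>lebesgue)"
     "integrable (lebesgue_on \<Omega>) g \<longleftrightarrow> integrable lebesgue (\<lambda>z. if z \<in> \<Omega> then g z else 0)"
      using plate_lebesgue integral_restrict_space[of \<Omega> lebesgue g] integrable_restrict_space[of \<Omega> lebesgue g] by auto
  qed
  have "(\<integral>z. ?f z \<partial>lebesgue) = (\<integral>z. ?f z \<partial>distr lebesgue lebesgue \<rho>)" by (simp add: rho_lebesgue)
  also have "\<dots> = (\<integral>z. ?f (\<rho> z) \<partial>lebesgue)" by (rule integral_distr[OF rho_lebesgue(1) m])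
  finally show "(\<integral>z. f (\<rho> z) \<partial>lebesgue_on \<Omega>) = (\<integral>z. f z \<partial>lebesgue_on \<Omega>)" by (simp add: r)
  show "integrable (lebesgue_on \<Omega>) (\<lambda>z. f (\<rho> z))" if "integrable (lebesgue_on \<Omega>) f"
  proof -
    have "integrable (distr lebesgue lebesgue \<rho>) ?f" using that by (simp add: rho_lebesgue r)
    from integrable_distr[OF rho_lebesgue(1) this] show ?thesis by (simp add: r)
  qed
qed

lemma L2_rho: "f \<in> L2 \<Longrightarrow> (\<lambda>z. f (\<rho> z)) \<in> L2"
  unfolding L2_space_def using rho_on_plate(1)[of f] rho_on_plate(3)[of "\<lambda>z. (f z)\<^sup>2"] by auto

lemma I_rho:
  assumes "f \<in> L2" "g \<in> L2" shows "I (\<lambda>z. f (\<rho> z)) g = I f (\<lambda>z. g (\<rho> z))"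
proof -
  have "(\<lambda>z. f z * g (\<rho> z)) \<in> borel_measurable (lebesgue_on \<Omega>)"
    using L2_D(1)[OF assms(1)] L2_D(1)[OF L2_rho[OF assms(2)]] by simp
  from rho_on_plate(2)[OF this] show ?thesis by (simp add: L2_inner_def)
qed

lemma test_function_rho:
  assumes "test_function \<Omega> \<phi>" shows "test_function \<Omega> (\<lambda>z. \<phi> (\<rho> z))"
proof -
  let ?K = "closure {z. \<phi> z \<noteq> 0}"
  have K: "compact ?K" "?K \<subseteq> \<Omega>" "smooth \<phi>" using assms by (auto simp: test_function_iff)
  have c: "compact (\<rho> ` ?K)"
    using K(1) linear_continuous_on[OF bounded_linear_rho] by (intro compact_continuous_image)
  have "{z. \<phi> (\<rho> z) \<noteq> 0} \<subseteq> \<rho> ` ?K"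
  proof
    fix z assume "z \<in> {z. \<phi> (\<rho> z) \<noteq> 0}"
    then have "\<rho> z \<in> ?K" using closure_subset[of "{z. \<phi> z \<noteq> 0}"] by auto
    then have "\<rho> (\<rho> z) \<in> \<rho> ` ?K" by (rule imageI)
    then show "z \<in> \<rho> ` ?K" by simp
  qed
  then have s: "closure {z. \<phi> (\<rho> z) \<noteq> 0} \<subseteq> \<rho> ` ?K"
    by (rule closure_minimal) (rule compact_imp_closed[OF c])
  moreover have "\<rho> ` ?K \<subseteq> \<Omega>" using K(2) by auto
  moreover have "compact (closure {z. \<phi> (\<rho> z) \<noteq> 0})"
    using s c by (meson bounded_subset closed_closure compact_eq_bounded_closed)
  ultimately show ?thesis
    unfolding test_function_iff using K(3) smooth_compose_linear[OF bounded_linear_rho] by auto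
qed

text \<open>The sign that the derivative along \<open>es\<close>, a list of coordinate vectors, picks up under the reflection
  \<open>\<rho>\<close>: the factor is 1 for \<open>(1, 0)\<close> and -1 for \<open>(0, 1)\<close>.\<close>

definition reflection_sign :: "(real \<times> real) list \<Rightarrow> real" where
  "reflection_sign es = prod_list (map (\<lambda>e. fst e - snd e) es)"

lemma dir_derivs_rho:
  assumes "smooth \<phi>" "set es \<subseteq> {(1, 0), (0, 1)}"
  shows "dir_derivs es (\<lambda>z. \<phi> (\<rho> z)) z = reflection_sign es * dir_derivs es \<phi> (\<rho> z)"
  using assms(2)
proof (induction es arbitrary: z)
  case (Cons e es)
  have d: "(dir_derivs es \<phi> has_derivative frechet_derivative (dir_derivs es \<phi>) (at (\<rho> z))) (at (\<rho> z))"
    using assms(1) by (intro smooth_has_derivative smooth_dir_derivs)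
  have "((\<lambda>z. reflection_sign es * dir_derivs es \<phi> (\<rho> z)) has_derivative
     (\<lambda>h. reflection_sign es * frechet_derivative (dir_derivs es \<phi>) (at (\<rho> z)) (\<rho> h))) (at z)"
    by (intro has_derivative_mult_right has_derivative_compose[OF bounded_linear_imp_has_derivative[OF bounded_linear_rho] d])
  note fd = frechet_derivative_at[OF this, symmetric]
  have "dir_derivs es (\<lambda>z. \<phi> (\<rho> z)) = (\<lambda>z. reflection_sign es * dir_derivs es \<phi> (\<rho> z))"
    using Cons by auto
  with fd have 1: "dir_derivs (e # es) (\<lambda>z. \<phi> (\<rho> z)) z = reflection_sign es * frechet_derivative (dir_derivs es \<phi>) (at (\<rho> z)) (\<rho> e)"
    by (simp add: dir_derivs_Cons)
  have "\<rho> e = (fst e - snd e) *\<^sub>R e" using Cons.prems by (auto simp: \<rho>_def)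
  then have "frechet_derivative (dir_derivs es \<phi>) (at (\<rho> z)) (\<rho> e) = (fst e - snd e) * frechet_derivative (dir_derivs es \<phi>) (at (\<rho> z)) e"
    using linear_cmul[OF has_derivative_linear[OF d]] by simp
  then show ?case using 1 by (simp add: reflection_sign_def dir_derivs_Cons)
qed (simp add: reflection_sign_def)

lemma reflection_sign_square: "set es \<subseteq> {(1, 0), (0, 1)} \<Longrightarrow> reflection_sign es * reflection_sign es = 1"
  by (induction es) (auto simp: reflection_sign_def)

lemma is_weak_deriv_rho:
  assumes w: "is_weak_deriv \<Omega> es f h" and f: "f \<in> L2" and es: "set es \<subseteq> {(1, 0), (0, 1)}"
  shows "is_weak_deriv \<Omega> es (\<lambda>z. f (\<rho> z)) (\<lambda>z. reflection_sign es * h (\<rho> z))"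
  unfolding is_weak_deriv_def
proof (intro conjI allI impI)
  have h: "h \<in> L2" using w by (simp add: is_weak_deriv_def)
  have h': "(\<lambda>z. h (\<rho> z)) \<in> L2" by (rule L2_rho[OF h])
  show hs: "(\<lambda>z. reflection_sign es * h (\<rho> z)) \<in> L2" using L2_lin[OF h' h', of "reflection_sign es" 0] by simp
  fix \<phi> assume t: "test_function \<Omega> \<phi>"
  have s: "smooth \<phi>" "smooth (\<lambda>z. \<phi> (\<rho> z))" using t test_function_rho test_smooth by auto
  have L: "dir_derivs es \<phi> \<in> L2" "dir_derivs es (\<lambda>z. \<phi> (\<rho> z)) \<in> L2" "(\<lambda>z. \<phi> (\<rho> z)) \<in> L2" "\<phi> \<in> L2"
    using s by (auto intro: L2_smooth smooth_dir_derivs)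
  have "I (\<lambda>z. f (\<rho> z)) (dir_derivs es \<phi>) = I f (\<lambda>z. dir_derivs es \<phi> (\<rho> z))"
    by (rule I_rho[OF f L(1)])
  also have "(\<lambda>z. dir_derivs es \<phi> (\<rho> z)) = (\<lambda>z. reflection_sign es * dir_derivs es (\<lambda>z. \<phi> (\<rho> z)) z)"
    using reflection_sign_square[OF es] by (simp add: dir_derivs_rho[OF s(1) es] mult.assoc[symmetric])
  also have "I f \<dots> = reflection_sign es * I f (dir_derivs es (\<lambda>z. \<phi> (\<rho> z)))"
    using I_lin_left[OF L(2) L(2) f, of "reflection_sign es" 0] by (simp add: I_sym)
  also have "I f (dir_derivs es (\<lambda>z. \<phi> (\<rho> z))) = (- 1) ^ length es * I h (\<lambda>z. \<phi> (\<rho> z))"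
    using w test_function_rho[OF t] by (simp add: is_weak_deriv_def)
  also have "I h (\<lambda>z. \<phi> (\<rho> z)) = I (\<lambda>z. h (\<rho> z)) \<phi>" by (rule I_rho[OF h L(4), symmetric])
  also have "reflection_sign es * ((- 1) ^ length es * I (\<lambda>z. h (\<rho> z)) \<phi>) = (- 1) ^ length es * I (\<lambda>z. reflection_sign es * h (\<rho> z)) \<phi>"
    using I_lin_left[OF h' h' L(4), of "reflection_sign es" 0] by simp
  finally show "I (\<lambda>z. f (\<rho> z)) (dir_derivs es \<phi>) = (- 1) ^ length es * I (\<lambda>z. reflection_sign es * h (\<rho> z)) \<phi>" .
qed

lemma H2_rho: assumes "f \<in> H2_space \<Omega>" shows "(\<lambda>z. f (\<rho> z)) \<in> H2_space \<Omega>"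
  unfolding H2_space_iff
proof (intro conjI allI impI L2_rho H2_space_L2 assms)
  fix es assume "multi_index es"
  then show "\<exists>h. is_weak_deriv \<Omega> es (\<lambda>z. f (\<rho> z)) h"
    using is_weak_deriv_rho[OF weak_deriv_works[OF assms] H2_space_L2[OF assms]] by (auto simp: multi_index_def)
qed

lemma V_rho: assumes "f \<in> V" shows "(\<lambda>z. f (\<rho> z)) \<in> V"
proof -
  obtain W where W: "continuous_on ({0..pi} \<times> {-l..l}) W" "AE z in lebesgue_on \<Omega>. f z = W z"
     "\<forall>z \<in> {0, pi} \<times> {-l..l}. W z = 0" using assms by (auto simp: H2_star_def)
  have "continuous_on ({0..pi} \<times> {-l..l}) (\<lambda>z. W (\<rho> z))"
    by (rule continuous_on_compose2[OF W(1) linear_continuous_on[OF bounded_linear_rho]]) (auto simp: \<rho>_def)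
  moreover have "AE z in lebesgue_on \<Omega>. f (\<rho> z) = W (\<rho> z)" by (rule AE_rho[OF W(2)])
  moreover have "\<forall>z \<in> {0, pi} \<times> {-l..l}. W (\<rho> z) = 0" using W(3) by (auto simp: \<rho>_def)
  ultimately show ?thesis using H2_rho assms by (auto simp: H2_star_def)
qed

lemma torsional_lin: "torsional f = (\<lambda>z. (1/2) * f z + (-1/2) * f (\<rho> z))"
  by (auto simp: torsional_rho fun_eq_iff)

lemma torsional_torsional: "torsional (torsional f) = torsional f"
  by (auto simp: torsional_rho fun_eq_iff field_simps)

lemma L2_torsional: "f \<in> L2 \<Longrightarrow> torsional f \<in> L2"
  unfolding torsional_lin by (intro L2_lin L2_rho)

lemma V_torsional: "f \<in> V \<Longrightarrow> torsional f \<in> V"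
  unfolding torsional_lin by (intro V_lin V_rho)

lemma I_torsional: "f \<in> L2 \<Longrightarrow> g \<in> L2 \<Longrightarrow> I (torsional f) g = I f (torsional g)"
  unfolding torsional_lin using I_lin_left[of f "\<lambda>z. f (\<rho> z)" g "1/2" "-1/2"] I_lin_left[of g "\<lambda>z. g (\<rho> z)" f "1/2" "-1/2"]
  by (simp add: L2_rho I_rho I_sym[of f])

text \<open>Moving the reflection from one factor to the other produces the signs of both derivatives, which
  cancel. Every product in the energy form pairs derivatives of equal sign, so the energy form
  inherits the symmetry, and so does the projection \<open>torsional\<close>.\<close>

lemma I_D_rho:
  assumes "f \<in> H2_space \<Omega>" "g \<in> H2_space \<Omega>" "multi_index es" "multi_index es'" "reflection_sign es = reflection_sign es'"
  shows "I (D es (\<lambda>z. f (\<rho> z))) (D es' g) = I (D es f) (D es' (\<lambda>z. g (\<rho> z)))"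
proof -
  have 1: "I (D ds (\<lambda>z. u (\<rho> z))) k = reflection_sign ds * I (D ds u) (\<lambda>z. k (\<rho> z))"
    if "u \<in> H2_space \<Omega>" "k \<in> L2" "multi_index ds" for u k ds
  proof -
    have L: "(\<lambda>z. D ds u (\<rho> z)) \<in> L2" using that by (intro L2_rho weak_deriv_L2)
    have "I (D ds (\<lambda>z. u (\<rho> z))) k = I (\<lambda>z. reflection_sign ds * D ds u (\<rho> z)) k"
    proof (rule I_cong_AE)
      show "D ds (\<lambda>z. u (\<rho> z)) \<in> L2" using that by (intro weak_deriv_L2 H2_rho)
      show "(\<lambda>z. reflection_sign ds * D ds u (\<rho> z)) \<in> L2" using L2_lin[OF L L, of "reflection_sign ds" 0] by simp
      show "AE z in lebesgue_on \<Omega>. D ds (\<lambda>z. u (\<rho> z)) z = reflection_sign ds * D ds u (\<rho> z)"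
        using that by (intro weak_deriv_eq H2_rho is_weak_deriv_rho weak_deriv_works H2_space_L2) (auto simp: multi_index_def)
    qed (rule that)
    also have "\<dots> = reflection_sign ds * I (\<lambda>z. D ds u (\<rho> z)) k"
      using I_lin_left[OF L L that(2), of "reflection_sign ds" 0] by simp
    finally show ?thesis using that by (simp add: I_rho weak_deriv_L2)
  qed
  have "I (D es (\<lambda>z. f (\<rho> z))) (D es' g) = reflection_sign es * I (D es f) (\<lambda>z. D es' g (\<rho> z))"
    using assms by (intro 1 weak_deriv_L2)
  also have "I (D es f) (\<lambda>z. D es' g (\<rho> z)) = I (\<lambda>z. D es f (\<rho> z)) (D es' g)"
    using assms by (intro I_rho[symmetric] weak_deriv_L2)
  also have "\<dots> = I (D es' g) (\<lambda>z. D es f (\<rho> z))" by (rule I_sym)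
  also have "reflection_sign es * \<dots> = I (D es' (\<lambda>z. g (\<rho> z))) (D es f)"
    using assms by (simp add: 1 weak_deriv_L2)
  finally show ?thesis by (simp add: I_sym)
qed

lemma eV_rho: "f \<in> V \<Longrightarrow> g \<in> V \<Longrightarrow> eV (\<lambda>z. f (\<rho> z)) g = eV f (\<lambda>z. g (\<rho> z))"
  by (simp add: H2_star_inner_eq V_H2 H2_rho weak_xx_def weak_yy_def weak_xy_def I_D_rho reflection_sign_def)

lemma bx_rho: "f \<in> V \<Longrightarrow> g \<in> V \<Longrightarrow> bx (\<lambda>z. f (\<rho> z)) g = bx f (\<lambda>z. g (\<rho> z))"
  by (simp add: V_H2 weak_x_def I_D_rho)

lemma eV_torsional: "f \<in> V \<Longrightarrow> g \<in> V \<Longrightarrow> eV (torsional f) g = eV f (torsional g)"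
  unfolding torsional_lin using V.lin_left[of f "\<lambda>z. f (\<rho> z)" g "1/2" "-1/2"] V.lin_left[of g "\<lambda>z. g (\<rho> z)" f "1/2" "-1/2"]
    V.sym[of f "\<lambda>z. (1/2) * g z + (-1/2) * g (\<rho> z)", OF _ V_lin]
  by (simp add: V_rho eV_rho V.sym[of f] V_lin)

lemma bx_torsional: "f \<in> V \<Longrightarrow> g \<in> V \<Longrightarrow> bx (torsional f) g = bx f (torsional g)"
  unfolding torsional_lin using B.lin_left[of f "\<lambda>z. f (\<rho> z)" g "1/2" "-1/2"] B.lin_left[of g "\<lambda>z. g (\<rho> z)" f "1/2" "-1/2"]
    B.sym[of f "\<lambda>z. (1/2) * g z + (-1/2) * g (\<rho> z)", OF _ V_lin]
  by (simp add: V_rho bx_rho B.sym[of f] V_lin)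

section \<open>The Poincare inequality for torsional functions\<close>

lemma Cauchy_Schwarz_interval:
  fixes s :: "real \<Rightarrow> real"
  assumes s: "integrable lborel s" and s2: "integrable lborel (\<lambda>t. (s t)\<^sup>2)" and z: "\<And>t. t \<notin> {-l<..<l} \<Longrightarrow> s t = 0"
  shows "(\<integral>t. \<bar>s t\<bar> \<partial>lborel)\<^sup>2 \<le> 2 * l * (\<integral>t. (s t)\<^sup>2 \<partial>lborel)"
proof -
  define m where "m = (\<integral>t. \<bar>s t\<bar> \<partial>lborel) / (2 * l)"
  have i: "integrable lborel (\<lambda>t. m\<^sup>2 * indicator {-l<..<l} t)"
    using l_pos by (intro integrable_mult_right integrable_real_indicator) auto
  have "0 \<le> (\<integral>t. (s t)\<^sup>2 - 2 * m * \<bar>s t\<bar> + m\<^sup>2 * indicator {-l<..<l} t \<partial>lborel)"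
  proof (rule Bochner_Integration.integral_nonneg)
    fix t
    have "0 \<le> (\<bar>s t\<bar> - m)\<^sup>2" by simp
    then show "0 \<le> (s t)\<^sup>2 - 2 * m * \<bar>s t\<bar> + m\<^sup>2 * indicator {-l<..<l} t"
      using z[of t] by (cases "t \<in> {-l<..<l}") (auto simp: power2_diff algebra_simps)
  qed
  also have "\<dots> = (\<integral>t. (s t)\<^sup>2 \<partial>lborel) - 2 * m * (\<integral>t. \<bar>s t\<bar> \<partial>lborel) + m\<^sup>2 * (2 * l)"
    using s s2 i l_pos by simp
  also have "\<dots> = (\<integral>t. (s t)\<^sup>2 \<partial>lborel) - (\<integral>t. \<bar>s t\<bar> \<partial>lborel)\<^sup>2 / (2 * l)"
    using l_pos by (simp add: m_def power2_eq_square field_simps)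
  finally show ?thesis using l_pos by (simp add: field_simps)
qed

lemma AE_uminus:
  assumes "AE y in lborel. P (y::real)" shows "AE y in lborel. P (- y)"
proof -
  have "AE y in distr lborel borel uminus. P y" unfolding lborel_distr_uminus by (rule assms)
  from AE_distrD[OF _ this] show ?thesis by simp
qed

text \<open>By oddness, \<open>2 p (x, y) = p (x, y) - p (x, - y)\<close> is the integral of \<open>s\<close> over the segment between
  \<open>- y\<close> and \<open>y\<close>, so \<open>p\<^sup>2\<close> is at most \<open>l / 2\<close> times the integral of \<open>s\<^sup>2\<close> over the vertical line.\<close>

lemma odd_Poincare:
  assumes w: "is_weak_deriv \<Omega> [(0, 1)] p s" and p: "p \<in> L2"
    and odd: "AE z in lebesgue_on \<Omega>. p (\<rho> z) = - p z"
  shows "I p p \<le> l\<^sup>2 * I s s"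
proof -
  have s: "s \<in> L2" using w by (simp add: is_weak_deriv_def)
  obtain P S where P: "is_rep P p" and S: "is_rep S s" using ex_rep p s L2_D(1) by metis
  obtain C where C: "AE x in lborel. AE y in lborel. (x, y) \<in> \<Omega> \<longrightarrow>
     P (x, y) = C x + (\<integral>t. (if t \<le> y then S (x, t) else 0) \<partial>lborel)"
    using slices_y[OF w p P S] by blast
  have P0: "P z = 0" "S z = 0" if "z \<notin> \<Omega>" for z using P S that unfolding is_rep_def by blast+
  have "AE z in lebesgue_on \<Omega>. p z = P z" using P by (simp add: is_rep_def)
  with AE_rho[OF this] odd have "AE z in lebesgue_on \<Omega>. P (\<rho> z) = - P z" by eventually_elim simp
  then have "AE z in lborel. z \<in> \<Omega> \<longrightarrow> P (\<rho> z) = - P z" by (simp add: AE_plate AE_completion_iff)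
  from AE_plane_y_first[OF this] have O: "AE x in lborel. AE y in lborel. (x, y) \<in> \<Omega> \<longrightarrow> P (x, - y) = - P (x, y)"
    by (simp add: \<rho>_def)
  note Pi = rep_L2_integrable[OF p P] and Si = rep_L2_integrable[OF s S]
  have ae: "AE x in lborel. (\<integral>y. (P (x, y))\<^sup>2 \<partial>lborel) \<le> l\<^sup>2 * (\<integral>y. (S (x, y))\<^sup>2 \<partial>lborel)"
    using C O integral_plane_y_first(2)[OF Si(1)] integral_plane_y_first(2)[OF Si(2)] integral_plane_y_first(2)[OF Pi(2)]
  proof eventually_elim
    case (elim x)
    define M where "M = (\<integral>t. \<bar>S (x, t)\<bar> \<partial>lborel)"
    let ?J = "\<lambda>y. \<integral>t. (if t \<le> y then S (x, t) else 0) \<partial>lborel"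
    have M0: "M \<ge> 0" by (simp add: M_def)
    have M: "M\<^sup>2 \<le> 2 * l * (\<integral>t. (S (x, t))\<^sup>2 \<partial>lborel)" unfolding M_def
      by (rule Cauchy_Schwarz_interval[OF elim(3,4)]) (auto intro!: P0 simp: plate_def)
    have J: "\<bar>?J u - ?J v\<bar> \<le> M" for u v
    proof -
      have i: "integrable lborel (\<lambda>t. if t \<le> y then S (x, t) else 0)" for y
        using borel_measurable_integrable[OF elim(3)]
        by (intro Bochner_Integration.integrable_bound[OF elim(3)]) auto
      have "\<bar>?J u - ?J v\<bar> = \<bar>\<integral>t. (if t \<le> u then S (x, t) else 0) - (if t \<le> v then S (x, t) else 0) \<partial>lborel\<bar>"
        using i by simp
      also have "\<dots> \<le> (\<integral>t. \<bar>(if t \<le> u then S (x, t) else 0) - (if t \<le> v then S (x, t) else 0)\<bar> \<partial>lborel)"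
        by (rule integral_abs_bound)
      also have "\<dots> \<le> M" unfolding M_def
        using elim(3) i by (intro integral_mono) auto
      finally show ?thesis .
    qed
    have b: "AE y in lborel. (P (x, y))\<^sup>2 \<le> M\<^sup>2 / 4 * indicator {-l<..<l} y"
      using elim(1,2) AE_uminus[OF elim(1)]
    proof eventually_elim
      fix y assume h: "(x, y) \<in> \<Omega> \<longrightarrow> P (x, y) = C x + ?J y" "(x, y) \<in> \<Omega> \<longrightarrow> P (x, - y) = - P (x, y)"
         "(x, - y) \<in> \<Omega> \<longrightarrow> P (x, - y) = C x + ?J (- y)"
      show "(P (x, y))\<^sup>2 \<le> M\<^sup>2 / 4 * indicator {-l<..<l} y"
      proof (cases "(x, y) \<in> \<Omega>")
        case True
        then have "(x, - y) \<in> \<Omega>" "y \<in> {-l<..<l}" by (auto simp: plate_def)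
        then have "2 * P (x, y) = ?J y - ?J (- y)" using h True by simp
        then have "\<bar>2 * P (x, y)\<bar> \<le> M" using J by simp
        then have "\<bar>2 * P (x, y)\<bar>\<^sup>2 \<le> M\<^sup>2" by (rule power_mono) simp
        then show ?thesis using \<open>y \<in> _\<close> by simp
      qed (simp add: P0)
    qed
    have ii: "integrable lborel (\<lambda>y. M\<^sup>2 / 4 * indicator {-l<..<l} y)"
      using l_pos by (intro integrable_mult_right integrable_real_indicator) auto
    have "(\<integral>y. (P (x, y))\<^sup>2 \<partial>lborel) \<le> (\<integral>y. M\<^sup>2 / 4 * indicator {-l<..<l} y \<partial>lborel)"
      by (rule integral_mono_AE[OF elim(5) ii b])
    also have "\<dots> = l / 2 * M\<^sup>2" using l_pos by simp
    also have "\<dots> \<le> l / 2 * (2 * l * (\<integral>t. (S (x, t))\<^sup>2 \<partial>lborel))"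
      using M l_pos by (intro mult_left_mono) auto
    finally show ?case by (simp add: power2_eq_square algebra_simps)
  qed
  have "I p p = (\<integral>x. (\<integral>y. (P (x, y))\<^sup>2 \<partial>lborel) \<partial>lborel)"
    using rep_I[OF p p P P] integral_plane_y_first(1)[OF Pi(2)] by (simp add: power2_eq_square)
  also have "\<dots> \<le> (\<integral>x. l\<^sup>2 * (\<integral>y. (S (x, y))\<^sup>2 \<partial>lborel) \<partial>lborel)"
    using integral_plane_y_first(3)[OF Pi(2)] integral_plane_y_first(3)[OF Si(2)] ae by (intro integral_mono_AE) auto
  also have "\<dots> = l\<^sup>2 * I s s"
    using rep_I[OF s s S S] integral_plane_y_first(1)[OF Si(2)] by (simp add: power2_eq_square)
  finally show ?thesis .
qed

lemma weak_x_torsional_odd: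
  assumes v: "v \<in> V" and t: "torsional v = v"
  shows "AE z in lebesgue_on \<Omega>. weak_x l v (\<rho> z) = - weak_x l v z"
proof -
  have o: "v (\<rho> z) = - v z" for z
  proof -
    have "(v z - v (\<rho> z)) / 2 = v z" using fun_cong[OF t, of z] by (simp add: torsional_rho)
    then have "v z - v (\<rho> z) = v z * 2" by (simp only: divide_eq_eq_numeral1)
    then show ?thesis by (simp add: algebra_simps)
  qed
  have id: "multi_index [(1, 0)]" by simp
  have H: "v \<in> H2_space \<Omega>" by (rule V_H2[OF v])
  have w: "is_weak_deriv \<Omega> [(1, 0)] v (weak_x l v)" unfolding weak_x_def by (rule weak_deriv_works[OF H id])
  have "is_weak_deriv \<Omega> [(1, 0)] (\<lambda>z. v (\<rho> z)) (\<lambda>z. reflection_sign [(1, 0)] * weak_x l v (\<rho> z))"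
    using w H by (intro is_weak_deriv_rho H2_space_L2) auto
  moreover have "is_weak_deriv \<Omega> [(1, 0)] (\<lambda>z. (-1) * v z + 0 * v z) (\<lambda>z. (-1) * weak_x l v z + 0 * weak_x l v z)"
    using w H by (intro is_weak_deriv_lin H2_space_L2)
  ultimately show ?thesis using weak_deriv_unique by (auto simp: o reflection_sign_def)
qed

end

section \<open>The first eigenvalue\<close>

lemma smooth_sin: "smooth (sin :: real \<Rightarrow> real)"
proof -
  have "Cdiff n (sin :: real \<Rightarrow> real) \<and> Cdiff n (cos :: real \<Rightarrow> real)" for n
  proof (induction n)
    case (Suc n)
    have s: "Cdiff n (\<lambda>z. cos z * e)" for e :: real using Suc by (intro Cdiff_mult Cdiff_const) simp
    have c: "Cdiff n (\<lambda>z. (- 1 * sin z) * e)" for e :: real using Suc by (intro Cdiff_mult Cdiff_const) simp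
    have "Cdiff (Suc n) (sin :: real \<Rightarrow> real)"
      by (rule Cdiff_SucI[where f' = "\<lambda>z e. cos z * e"])
        (use s DERIV_sin in \<open>auto simp: has_field_derivative_def\<close>)
    moreover have "Cdiff (Suc n) (cos :: real \<Rightarrow> real)"
      by (rule Cdiff_SucI[where f' = "\<lambda>z e. (- 1 * sin z) * e"])
        (use c in \<open>auto intro!: has_derivative_eq_rhs[OF DERIV_cos[unfolded has_field_derivative_def]]\<close>)
    ultimately show ?case by (simp only:)
  qed simp
  then show ?thesis by (simp add: smooth_def)
qed

lemma integral_deriv_test_fun:
  assumes "test_fun_on a b g" shows "(\<integral>x. deriv g x \<partial>lborel) = 0"
proof -
  have "deriv g x = (if a \<le> x then deriv g x else 0)" for x
    using test_fun_zero[OF test_fun_deriv[OF assms], of x] by simp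
  then have "(\<integral>x. deriv g x \<partial>lborel) = (\<integral>x. (if a \<le> x then deriv g x else 0) \<partial>lborel)" by presburger
  also have "\<dots> = - g a" by (rule integral_tail_deriv[OF assms])
  finally show ?thesis using test_fun_zero[OF assms, of a] by simp
qed

lemma smooth_slice:
  fixes F :: "real \<times> real \<Rightarrow> real" and p e :: "real \<times> real"
  assumes "smooth F"
  shows "smooth (\<lambda>x. F (x *\<^sub>R e + p))" "deriv (\<lambda>x. F (x *\<^sub>R e + p)) x = frechet_derivative F (at (x *\<^sub>R e + p)) e"
proof -
  have L: "bounded_linear (\<lambda>x. x *\<^sub>R e)" by (rule bounded_linear_scaleR_left)
  show "smooth (\<lambda>x. F (x *\<^sub>R e + p))" by (rule smooth_affine[OF L assms])
  have "((\<lambda>x. x *\<^sub>R e + p) has_derivative (\<lambda>h. h *\<^sub>R e)) (at x)"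
    by (auto intro!: derivative_eq_intros)
  from has_derivative_compose[OF this smooth_has_derivative[OF assms]]
  have "((\<lambda>x. F (x *\<^sub>R e + p)) has_derivative (\<lambda>h. frechet_derivative F (at (x *\<^sub>R e + p)) (h *\<^sub>R e))) (at x)" .
  moreover have "frechet_derivative F (at (x *\<^sub>R e + p)) (h *\<^sub>R e) = frechet_derivative F (at (x *\<^sub>R e + p)) e * h" for h
    using linear_cmul[OF has_derivative_linear[OF smooth_has_derivative[OF assms]]] by simp
  ultimately have "((\<lambda>x. F (x *\<^sub>R e + p)) has_real_derivative frechet_derivative F (at (x *\<^sub>R e + p)) e) (at x)"
    by (simp add: has_field_derivative_def)
  then show "deriv (\<lambda>x. F (x *\<^sub>R e + p)) x = frechet_derivative F (at (x *\<^sub>R e + p)) e"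
    by (rule DERIV_imp_deriv)
qed

context plate_width
begin

lemma test_zero: "test_function \<Omega> F \<Longrightarrow> z \<notin> \<Omega> \<Longrightarrow> F z = 0"
  using closure_subset[of "{z. F z \<noteq> 0}"] by (auto simp: test_function_iff)

lemma integral_partial_test:
  assumes F: "test_function \<Omega> F" and e: "e = (1, 0) \<or> e = (0, 1)"
  shows "(\<integral>z. dir_derivs [e] F z \<partial>lebesgue_on \<Omega>) = 0"
proof -
  let ?G = "dir_derivs [e] F"
  have G: "test_function \<Omega> ?G" by (rule test_function_dir_derivs[OF F])
  have s: "smooth F" "smooth ?G" using F G test_smooth by auto
  have rep: "is_rep ?G ?G"
    unfolding is_rep_def using test_zero[OF G] s(2)
    by (auto intro: borel_measurable_continuous_onI smooth_continuous_on)
  have L: "?G \<in> L2" by (rule L2_smooth[OF s(2)])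
  have int: "integrable lborel ?G" by (rule rep_L2_integrable(1)[OF L rep])
  have "(\<integral>z. ?G z \<partial>lebesgue_on \<Omega>) = (\<integral>z. ?G z \<partial>lborel)"
    by (rule rep_integral(1)[OF rep L2_D(1)[OF L]])
  also have "\<dots> = 0"
    using e
  proof
    assume e: "e = (1, 0)"
    have "(\<integral>x. ?G (x, y) \<partial>lborel) = 0" for y
    proof -
      have "F (x *\<^sub>R e + (0, y)) = 0" if "x \<notin> {0..pi}" for x
        using that e by (intro test_zero[OF F]) (auto simp: plate_def)
      then have "test_fun_on (-1) (pi + 1) (\<lambda>x. F (x *\<^sub>R e + (0, y)))"
        unfolding test_fun_on_def using smooth_slice(1)[OF s(1)] by (intro conjI exI[of _ 0] exI[of _ pi]) auto
      from integral_deriv_test_fun[OF this] show ?thesis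
        unfolding smooth_slice(2)[OF s(1)] by (simp add: e dir_derivs_def)
    qed
    then show ?thesis by (simp add: integral_plane_x_first(1)[OF int])
  next
    assume e: "e = (0, 1)"
    have "(\<integral>y. ?G (x, y) \<partial>lborel) = 0" for x
    proof -
      have "F (y *\<^sub>R e + (x, 0)) = 0" if "y \<notin> {-l..l}" for y
        using that e by (intro test_zero[OF F]) (auto simp: plate_def)
      then have "test_fun_on (-l - 1) (l + 1) (\<lambda>y. F (y *\<^sub>R e + (x, 0)))"
        unfolding test_fun_on_def using smooth_slice(1)[OF s(1)] by (intro conjI exI[of _ "-l"] exI[of _ l]) auto
      from integral_deriv_test_fun[OF this] show ?thesis
        unfolding smooth_slice(2)[OF s(1)] by (simp add: e dir_derivs_def)
    qed
    then show ?thesis by (simp add: integral_plane_y_first(1)[OF int])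
  qed
  finally show ?thesis .
qed

lemma weak_deriv_fst:
  fixes k :: "real \<Rightarrow> real"
  assumes k: "smooth k" and e: "e = (1, 0) \<or> e = (0, 1)"
  shows "is_weak_deriv \<Omega> [e] (\<lambda>z. k (fst z)) (\<lambda>z. fst e * deriv k (fst z))"
  unfolding is_weak_deriv_def
proof (intro conjI allI impI)
  have sk: "smooth (\<lambda>z :: real \<times> real. k (fst z))" "smooth (\<lambda>z :: real \<times> real. fst e * deriv k (fst z))"
    using smooth_compose_linear[OF bounded_linear_fst] k smooth_real_deriv(2)[OF k]
    by (auto intro!: smooth_mult smooth_const)
  then show "(\<lambda>z. fst e * deriv k (fst z)) \<in> L2" by (intro L2_smooth)
  fix \<phi> assume t: "test_function \<Omega> \<phi>"
  have s\<phi>: "smooth \<phi>" using t by (rule test_smooth)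
  let ?F = "\<lambda>z. k (fst z) * \<phi> z"
  have sF: "smooth ?F" by (rule smooth_mult[OF sk(1) s\<phi>])
  have "{z. ?F z \<noteq> 0} \<subseteq> {z. \<phi> z \<noteq> 0}" by auto
  then have sub: "closure {z. ?F z \<noteq> 0} \<subseteq> closure {z. \<phi> z \<noteq> 0}" by (rule closure_mono)
  have F: "test_function \<Omega> ?F"
    using t sF sub unfolding test_function_iff
    by (meson bounded_subset closed_closure compact_eq_bounded_closed order_trans)
  have d: "dir_derivs [e] ?F z = fst e * deriv k (fst z) * \<phi> z + k (fst z) * dir_derivs [e] \<phi> z" for z
  proof -
    have "((\<lambda>z. k (fst z)) has_derivative (\<lambda>h. deriv k (fst z) * fst h)) (at z)"
      by (rule has_derivative_compose[OF bounded_linear_imp_has_derivative[OF bounded_linear_fst]])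
        (use smooth_real_deriv(1)[OF k] in \<open>simp add: has_field_derivative_def\<close>)
    from has_derivative_mult[OF this smooth_has_derivative[OF s\<phi>]]
    have "(?F has_derivative (\<lambda>h. k (fst z) * frechet_derivative \<phi> (at z) h + deriv k (fst z) * fst h * \<phi> z)) (at z)" .
    from frechet_derivative_at[OF this, symmetric] show ?thesis by (simp add: dir_derivs_def)
  qed
  have L: "(\<lambda>z. k (fst z)) \<in> L2" "(\<lambda>z. fst e * deriv k (fst z)) \<in> L2" "\<phi> \<in> L2" "dir_derivs [e] \<phi> \<in> L2"
    using sk s\<phi> smooth_dir_derivs by (auto intro: L2_smooth)
  have "0 = (\<integral>z. dir_derivs [e] ?F z \<partial>lebesgue_on \<Omega>)" by (rule integral_partial_test[OF F e, symmetric])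
  also have "\<dots> = I (\<lambda>z. fst e * deriv k (fst z)) \<phi> + I (\<lambda>z. k (fst z)) (dir_derivs [e] \<phi>)"
    unfolding d L2_inner_def using L2_mult_integrable[OF L(2,3)] L2_mult_integrable[OF L(1,4)]
    by (rule Bochner_Integration.integral_add)
  finally show "I (\<lambda>z. k (fst z)) (dir_derivs [e] \<phi>) = (- 1) ^ length [e] * I (\<lambda>z. fst e * deriv k (fst z)) \<phi>"
    by simp
qed

lemma is_weak_deriv_append:
  assumes "is_weak_deriv \<Omega> es f g" "is_weak_deriv \<Omega> ds g h"
  shows "is_weak_deriv \<Omega> (es @ ds) f h"
  unfolding is_weak_deriv_def
proof (intro conjI allI impI)
  show "h \<in> L2" using assms(2) by (simp add: is_weak_deriv_def)
  fix \<phi> assume t: "test_function \<Omega> \<phi>"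
  have "dir_derivs (es @ ds) \<phi> = dir_derivs es (dir_derivs ds \<phi>)" by (simp add: dir_derivs_def)
  then have "I f (dir_derivs (es @ ds) \<phi>) = (- 1) ^ length es * I g (dir_derivs ds \<phi>)"
    using assms(1) test_function_dir_derivs[OF t] by (simp add: is_weak_deriv_def)
  also have "I g (dir_derivs ds \<phi>) = (- 1) ^ length ds * I h \<phi>"
    using assms(2) t by (simp add: is_weak_deriv_def)
  finally show "I f (dir_derivs (es @ ds) \<phi>) = (- 1) ^ length (es @ ds) * I h \<phi>"
    by (simp add: power_add)
qed

abbreviation "sn \<equiv> \<lambda>z :: real \<times> real. sin (fst z)"

lemma sin_first_second:
  assumes "e = (1, 0) \<or> e = (0, 1)" "d = (1, 0) \<or> d = (0, 1)"
  shows "is_weak_deriv \<Omega> [] sn sn"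
    "is_weak_deriv \<Omega> [e] sn (\<lambda>z. fst e * cos (fst z))"
    "is_weak_deriv \<Omega> [e, d] sn (\<lambda>z. fst e * fst d * - sn z)"
proof -
  have ds: "deriv sin = (cos :: real \<Rightarrow> real)" using DERIV_imp_deriv[OF DERIV_sin] by auto
  have dc: "deriv (\<lambda>x. c * cos x) = (\<lambda>x. c * - sin x)" for c :: real
    using DERIV_imp_deriv[OF DERIV_cmult[OF DERIV_cos]] by auto
  have sc: "smooth (\<lambda>x. c * cos x)" for c :: real
    using smooth_real_deriv(2)[OF smooth_sin] by (intro smooth_mult smooth_const) (simp add: ds)
  show "is_weak_deriv \<Omega> [] sn sn"
    unfolding is_weak_deriv_def using smooth_compose_linear[OF bounded_linear_fst smooth_sin] by (auto intro: L2_smooth)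
  show 1: "is_weak_deriv \<Omega> [e] sn (\<lambda>z. fst e * cos (fst z))"
    using weak_deriv_fst[OF smooth_sin assms(1)] by (simp add: ds)
  have "is_weak_deriv \<Omega> [d] (\<lambda>z. fst e * cos (fst z)) (\<lambda>z. fst d * (fst e * - sn z))"
    using weak_deriv_fst[OF sc assms(2), of "fst e"] by (simp only: dc)
  from is_weak_deriv_append[OF 1 this] show "is_weak_deriv \<Omega> [e, d] sn (\<lambda>z. fst e * fst d * - sn z)"
    by (simp add: mult_ac)
qed

lemma sin_H2: "sn \<in> H2_space \<Omega>"
  unfolding H2_space_iff
proof (intro conjI allI impI)
  show "sn \<in> L2" using smooth_compose_linear[OF bounded_linear_fst smooth_sin] by (rule L2_smooth)
  fix es assume es: "multi_index es"
  consider "es = []" | e where "es = [e]" | e d where "es = [e, d]"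
    using es by (cases es; cases "tl es") (auto simp: multi_index_def)
  then show "\<exists>h. is_weak_deriv \<Omega> es sn h"
  proof cases
    case 1 then show ?thesis using sin_first_second(1) by blast
  next
    case 2 then show ?thesis using sin_first_second(2)[of e] es by (auto simp: multi_index_def)
  next
    case 3 then show ?thesis using sin_first_second(3)[of e d] es by (auto simp: multi_index_def)
  qed
qed

lemma sin_V: "sn \<in> V"
  unfolding H2_star_def using sin_H2
  by (auto intro!: exI[of _ sn] continuous_intros)

lemma eV_sin: "eV sn sn = I sn sn"
proof -
  have L: "sn \<in> L2" by (rule V_L2[OF sin_V])
  have L0: "(\<lambda>_. 0) \<in> L2" by (intro L2_smooth smooth_const)
  have Lm: "(\<lambda>z. - sn z) \<in> L2" using L2_lin[OF L L, of "-1" 0] by simp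
  have xx: "AE z in lebesgue_on \<Omega>. weak_xx l sn z = - sn z"
    using weak_deriv_eq[OF sin_H2 _ sin_first_second(3)[of "(1, 0)" "(1, 0)"]] by (simp add: weak_xx_def)
  have yy: "AE z in lebesgue_on \<Omega>. weak_yy l sn z = 0"
    using weak_deriv_eq[OF sin_H2 _ sin_first_second(3)[of "(0, 1)" "(0, 1)"]] by (simp add: weak_yy_def)
  have xy: "AE z in lebesgue_on \<Omega>. weak_xy l sn z = 0"
    using weak_deriv_eq[OF sin_H2 _ sin_first_second(3)[of "(1, 0)" "(0, 1)"]] by (simp add: weak_xy_def)
  have W: "weak_xx l sn \<in> L2" "weak_xy l sn \<in> L2" "weak_yy l sn \<in> L2"
    using weak_xx_L2 weak_xy_L2 sin_V by (auto simp: weak_yy_def intro: weak_deriv_L2 sin_H2)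
  have z: "I (\<lambda>_. 0) f = 0" for f by (simp add: L2_inner_def)
  have "I (weak_yy l sn) f = 0" "I (weak_xy l sn) f = 0" if "f \<in> L2" for f
    using I_cong_AE[OF W(3) L0 that yy] I_cong_AE[OF W(2) L0 that xy] z by auto
  moreover have "I (weak_xx l sn) (weak_xx l sn) = I (\<lambda>z. - sn z) (weak_xx l sn)" by (rule I_cong_AE[OF W(1) Lm W(1) xx])
  moreover have "I (weak_xx l sn) (\<lambda>z. - sn z) = I (\<lambda>z. - sn z) (\<lambda>z. - sn z)" by (rule I_cong_AE[OF W(1) Lm Lm xx])
  moreover have "I (\<lambda>z. - sn z) (\<lambda>z. - sn z) = I sn sn" by (simp add: L2_inner_def)
  ultimately show ?thesis using W
    by (simp add: H2_star_inner_eq[OF sin_H2 sin_H2] I_sym[of "weak_xx l sn" "weak_yy l sn"] I_sym[of "\<lambda>z. - sn z" "weak_xx l sn"])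
qed

lemma sin_nonzero: "I sn sn > 0"
proof -
  have L: "sn \<in> L2" by (rule V_L2[OF sin_V])
  have "I sn sn \<noteq> 0"
  proof
    assume "I sn sn = 0"
    then have "AE z in lebesgue_on \<Omega>. sn z * sn z = 0"
      unfolding L2_inner_def using L2_mult_integrable[OF L L] by (subst (asm) integral_nonneg_eq_0_iff_AE) auto
    then have "AE z in lebesgue_on \<Omega>. False"
    proof (rule AE_mp, intro AE_I2 impI)
      fix z assume "z \<in> space (lebesgue_on \<Omega>)" "sn z * sn z = 0"
      then show False using sin_gt_zero[of "fst z"] by (auto simp: plate_def)
    qed
    then have "AE z in lebesgue. z \<notin> \<Omega>" by (simp add: AE_plate)
    then have "\<Omega> \<in> null_sets lebesgue" using AE_iff_null_sets[OF plate_lebesgue] by blast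
    then have "emeasure lebesgue \<Omega> = 0" by (rule null_setsD1)
    moreover have "emeasure lborel \<Omega> \<noteq> 0"
    proof -
      have "\<Omega> = box (0, -l) (pi, l)" by (auto simp: plate_def box_prod box_real)
      then show ?thesis using l_pos by (simp add: emeasure_lborel_box_eq Basis_prod_def)
    qed
    ultimately show False using plate_borel by simp
  qed
  then show ?thesis using I_nonneg[of sn] by simp
qed

abbreviation "\<Lambda> \<equiv> lambda1 l"

lemma lambda1_le:
  assumes v: "v \<in> V" shows "\<Lambda> * I v v \<le> eV v v"
proof (cases "I v v = 0")
  case True
  then show ?thesis using V.nonneg[OF v] by simp
next
  case False
  then have p: "I v v > 0" using I_nonneg[of v] by simp
  have n: "(H2_star_norm l v)\<^sup>2 = eV v v" "(L2_norm \<Omega> v)\<^sup>2 = I v v" if "v \<in> V" for v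
    using V.nonneg[OF that] I_nonneg[of v] by (simp_all add: H2_star_norm_def L2_norm_def)
  have "\<Lambda> \<le> eV v v / I v v"
    unfolding lambda1_def
  proof (rule cInf_lower)
    show "eV v v / I v v \<in> {(H2_star_norm l v)\<^sup>2 / (L2_norm \<Omega> v)\<^sup>2 |v. v \<in> V \<and> L2_norm \<Omega> v \<noteq> 0}"
      using v n[OF v] False by (auto intro!: exI[of _ v])
    show "bdd_below {(H2_star_norm l v)\<^sup>2 / (L2_norm \<Omega> v)\<^sup>2 |v. v \<in> V \<and> L2_norm \<Omega> v \<noteq> 0}"
      by (auto intro!: bdd_belowI[of _ 0])
  qed
  then show ?thesis using p by (simp add: field_simps)
qed

text \<open>The function \<open>sin x\<close> has the Rayleigh quotient 1.\<close>

lemma lambda1_le_1: "\<Lambda> \<le> 1"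
  using lambda1_le[OF sin_V] sin_nonzero by (simp add: eV_sin)

lemma weak_xx_bound: "v \<in> V \<Longrightarrow> I (weak_xx l v) (weak_xx l v) \<le> 25/24 * eV v v"
  using H2_star_inner_lower[OF V_H2, of v] I_nonneg[of "weak_xy l v"] by simp

text \<open>Integrate by parts with \<open>w = v\<close> and apply the Cauchy-Schwarz inequality.\<close>

lemma bx_interpolation:
  assumes v: "v \<in> V" shows "(bx v v)\<^sup>2 \<le> I v v * I (weak_xx l v) (weak_xx l v)"
proof -
  have "\<bar>bx v v\<bar> \<le> L2.N (weak_xx l v) * L2.N v"
    using L2.Cauchy_Schwarz[OF weak_xx_L2[OF v] V_L2[OF v]] by (simp add: integration_by_parts[OF v v])
  then have "\<bar>bx v v\<bar>\<^sup>2 \<le> (L2.N (weak_xx l v) * L2.N v)\<^sup>2" by (rule power_mono) simp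
  then show ?thesis using weak_xx_L2[OF v] V_L2[OF v]
    by (simp add: power_mult_distrib L2.N_square mult.commute)
qed

text \<open>The form \<open>eV v v - P * bx v v\<close> is coercive on torsional functions for \<open>P < \<Lambda>\<close>. For general \<open>v\<close> one
  would decompose \<open>v\<close> spectrally in \<open>x\<close>. For odd \<open>v\<close> the term with \<open>v\<^sub>x\<^sub>y\<close> in the energy,
  together with the Poincare inequality in \<open>y\<close>, leaves enough room: if \<open>X = bx v v\<close> exceeded
  \<open>eV v v / \<Lambda>\<close>, then both factors in \<open>X\<^sup>2 \<le> I v v * I v\<^sub>x\<^sub>x v\<^sub>x\<^sub>x\<close> would be smaller than \<open>X\<close>; here \<open>\<Lambda> \<le> 1\<close>
  is used.\<close>

lemma torsional_coercivity:
  assumes v: "v \<in> V" and t: "torsional v = v" and \<Lambda>: "0 < \<Lambda>" and l: "l < pi"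
  shows "\<Lambda> * bx v v \<le> eV v v"
proof (rule ccontr)
  define X E where "X = bx v v" and "E = eV v v"
  assume "\<not> ?thesis"
  then have n: "E < \<Lambda> * X" by (simp add: X_def E_def)
  have E0: "0 \<le> E" unfolding E_def by (rule V.nonneg[OF v])
  have X0: "0 < X" using n E0 \<Lambda> zero_less_mult_pos[of \<Lambda> X] by linarith
  have wd: "is_weak_deriv \<Omega> [(0, 1)] (weak_x l v) (weak_xy l v)"
    unfolding weak_xy_def by (intro weak_deriv_of_weak_x V_H2 v) simp
  have P: "X \<le> l\<^sup>2 * I (weak_xy l v) (weak_xy l v)"
    unfolding X_def by (rule odd_Poincare[OF wd weak_x_L2[OF v] weak_x_torsional_odd[OF v t]])
  \<comment> \<open>The crude bound \<open>l < 4\<close> suffices: it turns \<open>8 / 5\<close> times the norm of \<open>v\<^sub>x\<^sub>y\<close> into \<open>X / 10\<close>.\<close>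
  have "l\<^sup>2 \<le> 4\<^sup>2" using l l_pos pi_less_4 by (intro power_mono) auto
  then have "l\<^sup>2 \<le> 16" by simp
  then have "l\<^sup>2 * I (weak_xy l v) (weak_xy l v) \<le> 16 * I (weak_xy l v) (weak_xy l v)"
    by (intro mult_right_mono I_nonneg)
  then have "X \<le> 16 * I (weak_xy l v) (weak_xy l v)" using P by simp
  then have xx: "24/25 * I (weak_xx l v) (weak_xx l v) \<le> E - 1/10 * X"
    using H2_star_inner_lower[OF V_H2[OF v]] unfolding E_def by linarith
  have EX: "E < X" using n lambda1_le_1 X0 mult_right_mono[of \<Lambda> 1 X] by linarith
  have "I v v \<le> E / \<Lambda>" using lambda1_le[OF v] \<Lambda> by (simp add: field_simps E_def)
  also have "\<dots> < X" using n \<Lambda> by (simp add: field_simps)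
  finally have IX: "I v v < X" .
  have "X\<^sup>2 \<le> I v v * I (weak_xx l v) (weak_xx l v)" unfolding X_def by (rule bx_interpolation[OF v])
  also have "\<dots> \<le> X * I (weak_xx l v) (weak_xx l v)" using IX by (intro mult_right_mono I_nonneg) simp
  finally have "X * X \<le> X * I (weak_xx l v) (weak_xx l v)" by (simp add: power2_eq_square)
  then have "X \<le> I (weak_xx l v) (weak_xx l v)" using X0 by simp
  then show False using xx EX X0 by linarith
qed

end

section \<open>An energy identity for kernels\<close>

text \<open>The chain rule along a line parallel to the diagonal; one partial derivative has to be continuous,
  the other one only has to exist at the point.\<close>

lemma has_derivative_diagonal:
  fixes \<Phi> :: "real \<Rightarrow> real \<Rightarrow> real"
  assumes x: "t + \<alpha> \<in> {c<..<d}" and y: "t + \<beta> \<in> {c<..<d}"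
    and fx: "((\<lambda>s. \<Phi> s (t + \<beta>)) has_real_derivative A) (at (t + \<alpha>))"
    and fy: "\<And>s r. s \<in> {c<..<d} \<Longrightarrow> r \<in> {c<..<d} \<Longrightarrow> ((\<lambda>r. \<Phi> s r) has_real_derivative Q s r) (at r)"
    and Q: "continuous_on ({c<..<d} \<times> {c<..<d}) (\<lambda>p. Q (fst p) (snd p))"
  shows "((\<lambda>t. \<Phi> (t + \<alpha>) (t + \<beta>)) has_real_derivative A + Q (t + \<alpha>) (t + \<beta>)) (at t)"
proof -
  let ?S = "{c<..<d}"
  have "((\<lambda>(s, r). \<Phi> s r) has_derivative
      (\<lambda>(tx, ty). A * tx + blinfun_apply (blinfun_mult_right (Q (t + \<alpha>) (t + \<beta>))) ty)) (at (t + \<alpha>, t + \<beta>) within ?S \<times> ?S)"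
  proof (rule has_derivative_partialsI)
    show "((\<lambda>s. \<Phi> s (t + \<beta>)) has_derivative (\<lambda>tx. A * tx)) (at (t + \<alpha>) within ?S)"
      using fx by (auto simp: has_field_derivative_def intro: has_derivative_at_withinI)
    show "((\<lambda>r. \<Phi> s r) has_derivative blinfun_apply (blinfun_mult_right (Q s r))) (at r within ?S)"
      if "s \<in> ?S" "r \<in> ?S" for s r
      using fy[OF that] by (auto simp: has_field_derivative_def intro: has_derivative_at_withinI)
    have "continuous (at (t + \<alpha>, t + \<beta>) within ?S \<times> ?S) (\<lambda>p. Q (fst p) (snd p))"
      using Q x y by (simp add: continuous_on_eq_continuous_within)
    then have "continuous (at (t + \<alpha>, t + \<beta>) within ?S \<times> ?S) (\<lambda>p. blinfun_mult_right (Q (fst p) (snd p)))"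
      by (rule bounded_linear.continuous[OF bounded_linear_blinfun_mult_right])
    then show "continuous (at (t + \<alpha>, t + \<beta>) within ?S \<times> ?S) (\<lambda>(s, r). blinfun_mult_right (Q s r))"
      by (simp add: case_prod_beta')
  qed (use y in auto)
  then have 1: "((\<lambda>(s, r). \<Phi> s r) has_derivative (\<lambda>(tx, ty). A * tx + Q (t + \<alpha>) (t + \<beta>) * ty)) (at (t + \<alpha>, t + \<beta>))"
    using x y by (subst (asm) at_within_open) (auto intro: open_Times)
  have 2: "((\<lambda>t. (t + \<alpha>, t + \<beta>)) has_derivative (\<lambda>h. (h, h))) (at t)"
    by (auto intro!: derivative_eq_intros)
  have "((\<lambda>t. \<Phi> (t + \<alpha>) (t + \<beta>)) has_derivative (\<lambda>h. A * h + Q (t + \<alpha>) (t + \<beta>) * h)) (at t)"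
    using has_derivative_compose[OF 2 1] by simp
  moreover have "(\<lambda>h. A * h + Q (t + \<alpha>) (t + \<beta>) * h) = (*) (A + Q (t + \<alpha>) (t + \<beta>))"
    by (auto simp: algebra_simps)
  ultimately show ?thesis by (simp only: has_field_derivative_def)
qed

text \<open>The double primitive of a kernel \<open>k\<close>, whose symmetry is the exchange of the order of integration.\<close>

lemma symmetric_primitive:
  fixes k :: "real \<Rightarrow> real \<Rightarrow> real"
  assumes k: "continuous_on ({c..d} \<times> {c..d}) (\<lambda>p. k (fst p) (snd p))"
    and sym: "\<And>s r. s \<in> {c..d} \<Longrightarrow> r \<in> {c..d} \<Longrightarrow> k s r = k r s"
  obtains \<Psi> J where
    "\<And>s r. s \<in> {c<..<d} \<Longrightarrow> r \<in> {c<..<d} \<Longrightarrow> ((\<lambda>s. \<Psi> s r) has_real_derivative J s r) (at s)"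
    "\<And>s r. s \<in> {c<..<d} \<Longrightarrow> r \<in> {c<..<d} \<Longrightarrow> ((\<lambda>r. J s r) has_real_derivative k s r) (at r)"
    "\<And>s r. s \<in> {c<..<d} \<Longrightarrow> r \<in> {c<..<d} \<Longrightarrow> \<Psi> s r = (\<Psi> r s :: real)"
    "continuous_on ({c<..<d} \<times> {c<..<d}) (\<lambda>p. J (fst p) (snd p) :: real)"
proof
  define J where "J s r = integral {c..r} (k s)" for s r
  define \<Psi> where "\<Psi> s r = integral {c..s} (\<lambda>\<sigma>. J \<sigma> r)" for s r
  let ?S = "{c<..<d}"
  have k2: "continuous_on {c..d} (k s)" if "s \<in> {c..d}" for s
  proof -
    have "continuous_on {c..d} (\<lambda>r. (s, r))" by (intro continuous_intros)
    from continuous_on_compose2[OF k this] have "Pair s ` {c..d} \<subseteq> {c..d} \<times> {c..d} \<Longrightarrow> continuous_on {c..d} (k s)"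
      by simp
    moreover have "Pair s ` {c..d} \<subseteq> {c..d} \<times> {c..d}" using that by auto
    ultimately show ?thesis by blast
  qed
  have J1: "continuous_on {c..d} (\<lambda>s. J s r)" if "r \<in> {c..d}" for r
  proof -
    have "continuous_on ({c..d} \<times> cbox c r) (\<lambda>(s, t). k s t)"
      using that by (intro continuous_on_subset[OF k[unfolded case_prod_beta'[symmetric]]]) (auto simp: case_prod_beta' k)
    from integral_continuous_on_param[OF this] show ?thesis by (simp add: J_def)
  qed
  have at: "at x within {c..d} = at x" if "x \<in> ?S" for x
    using that by (intro at_within_interior) auto
  show "((\<lambda>s. \<Psi> s r) has_real_derivative J s r) (at s)" if "s \<in> ?S" "r \<in> ?S" for s r
    using integral_has_real_derivative[OF J1, of r s] that at[OF that(1)] by (simp add: \<Psi>_def)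
  show Jr: "((\<lambda>r. J s r) has_real_derivative k s r) (at r)" if "s \<in> ?S" "r \<in> ?S" for s r
    using integral_has_real_derivative[OF k2, of s r] that at[OF that(2)] by (simp add: J_def)
  show "\<Psi> s r = \<Psi> r s" if "s \<in> ?S" "r \<in> ?S" for s r
  proof -
    have "continuous_on (cbox (c, c) (s, r)) (\<lambda>(x, y). k x y)"
      using that by (auto simp: case_prod_beta' cbox_Pair_eq intro!: continuous_on_subset[OF k])
    from integral_swap_continuous[OF this]
    have "\<Psi> s r = integral {c..r} (\<lambda>y. integral {c..s} (\<lambda>x. k x y))" by (simp add: \<Psi>_def J_def)
    also have "\<dots> = \<Psi> r s"
      unfolding \<Psi>_def J_def using that sym by (intro integral_cong) auto
    finally show ?thesis .
  qed
  show "continuous_on (?S \<times> ?S) (\<lambda>p. J (fst p) (snd p))"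
    unfolding continuous_on_def
  proof
    fix p :: "real \<times> real" assume p: "p \<in> ?S \<times> ?S"
    let ?F = "at p within ?S \<times> ?S"
    obtain M where M: "\<And>q. q \<in> {c..d} \<times> {c..d} \<Longrightarrow> \<bar>k (fst q) (snd q)\<bar> \<le> M"
    proof -
      have "compact ((\<lambda>p. k (fst p) (snd p)) ` ({c..d} \<times> {c..d}))"
        by (intro compact_continuous_image k compact_Times) auto
      then obtain M where M: "\<forall>x\<in>(\<lambda>p. k (fst p) (snd p)) ` ({c..d} \<times> {c..d}). norm x \<le> M"
        using compact_imp_bounded bounded_iff by metis
      show ?thesis by (rule that[of M]) (use M in force)
    qed
    have f: "(fst \<longlongrightarrow> fst p) ?F" "(snd \<longlongrightarrow> snd p) ?F" by (auto intro!: tendsto_intros)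
    have "continuous (at (fst p) within {c..d}) (\<lambda>s. J s (snd p))"
      using J1[of "snd p"] p by (auto simp: continuous_on_eq_continuous_within)
    then have "((\<lambda>q. J (fst q) (snd p)) \<longlongrightarrow> J (fst p) (snd p)) ?F"
      by (rule continuous_within_tendsto_compose) (use f in \<open>auto simp: eventually_at_filter intro!: always_eventually\<close>)
    moreover have "((\<lambda>q. J (fst q) (snd q) - J (fst q) (snd p)) \<longlongrightarrow> 0) ?F"
    proof (rule Lim_null_comparison)
      have "\<bar>J s u - J s v\<bar> \<le> M * \<bar>u - v\<bar>" if s: "s \<in> ?S" and "u \<in> ?S" "v \<in> ?S" for s u v
      proof -
        have "norm (J s u - J s v) \<le> M * norm (u - v)"
        proof (rule differentiable_bound[of ?S])
          show "((\<lambda>r. J s r) has_derivative (\<lambda>h. k s r * h)) (at r within ?S)" if "r \<in> ?S" for r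
            using Jr[OF s that] by (auto simp: has_field_derivative_def intro: has_derivative_at_withinI)
          show "onorm (\<lambda>h. k s r * h) \<le> M" if "r \<in> ?S" for r
            using M[of "(s, r)"] s that by (intro onorm_bound) (auto simp: abs_mult intro!: mult_right_mono intro: order_trans[OF abs_ge_zero])
        qed (use that in auto)
        then show ?thesis by simp
      qed
      then show "\<forall>\<^sub>F q in ?F. norm (J (fst q) (snd q) - J (fst q) (snd p)) \<le> M * \<bar>snd q - snd p\<bar>"
        using p by (auto simp: eventually_at_filter intro!: always_eventually)
      have "((\<lambda>q. M * \<bar>snd q - snd p\<bar>) \<longlongrightarrow> M * \<bar>snd p - snd p\<bar>) ?F" by (intro tendsto_intros f)
      then show "((\<lambda>q. M * \<bar>snd q - snd p\<bar>) \<longlongrightarrow> 0) ?F" by simp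
    qed
    ultimately have "((\<lambda>q. J (fst q) (snd p) + (J (fst q) (snd q) - J (fst q) (snd p))) \<longlongrightarrow> J (fst p) (snd p) + 0) ?F"
      by (rule tendsto_add)
    then show "((\<lambda>p. J (fst p) (snd p)) \<longlongrightarrow> J (fst p) (snd p)) ?F" by simp
  qed
qed

lemma MVT_real:
  fixes f :: "real \<Rightarrow> real"
  assumes "u < v" "\<And>x. x \<in> {u..v} \<Longrightarrow> (f has_real_derivative f' x) (at x)"
  shows "\<exists>x\<in>{u<..<v}. f v - f u = (v - u) * f' x"
  using MVT2[OF assms(1), of f f'] assms(2) by auto

text \<open>The energy identity for weak solutions, reduced to kernels in two time variables: for a solution of
  \<open>u\<^sub>t\<^sub>t + A u = f\<close> one takes \<open>kH = (u s, u r)\<close>, \<open>k = \<langle>A u s, u r\<rangle>\<close>, \<open>m = (u\<^sub>t s, u r)\<close>, \<open>n = (u\<^sub>t s, u\<^sub>t r)\<close>,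
  \<open>F = (f s, u r)\<close> and \<open>Fd = (f s, u\<^sub>t r)\<close>. The velocity may not be used as a test function, as it need
  not have finite energy. Nor is \<open>n\<close> or \<open>k\<close> differentiable by itself; but the second difference \<open>G h t\<close> of
  the function \<open>\<Phi>\<close> with mixed derivative \<open>n + k\<close> over the square of side \<open>h\<close> at \<open>(t, t)\<close> is differentiable
  in \<open>t\<close>, and in its derivative the symmetric kernel \<open>k\<close> cancels, so that only a second difference of
  \<open>F\<close> remains. The mean value theorem, applied once in each variable, expresses both quantities
  through \<open>n + k\<close> and \<open>Fd\<close> at points near \<open>(t, t)\<close>, uniformly enough to let \<open>h\<close> tend to zero.\<close>

lemma energy_identity:
  fixes kH k m n F Fd :: "real \<Rightarrow> real \<Rightarrow> real"
  assumes t: "t \<in> {c<..<d}"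
    and kH: "\<And>s r. s \<in> {c..d} \<Longrightarrow> r \<in> {c..d} \<Longrightarrow> ((\<lambda>s. kH s r) has_real_derivative m s r) (at s)"
    and kH_sym: "\<And>s r. kH s r = kH r s" and k_sym: "\<And>s r. s \<in> {c..d} \<Longrightarrow> r \<in> {c..d} \<Longrightarrow> k s r = k r s"
    and m1: "\<And>s r. s \<in> {c..d} \<Longrightarrow> r \<in> {c..d} \<Longrightarrow> ((\<lambda>s. m s r) has_real_derivative F s r - k s r) (at s)"
    and m2: "\<And>s r. s \<in> {c..d} \<Longrightarrow> r \<in> {c..d} \<Longrightarrow> ((\<lambda>r. m s r) has_real_derivative n s r) (at r)"
    and F2: "\<And>s r. s \<in> {c..d} \<Longrightarrow> r \<in> {c..d} \<Longrightarrow> ((\<lambda>r. F s r) has_real_derivative Fd s r) (at r)"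
    and cont: "continuous_on ({c..d} \<times> {c..d}) (\<lambda>p. k (fst p) (snd p))"
      "continuous_on ({c..d} \<times> {c..d}) (\<lambda>p. m (fst p) (snd p))"
      "continuous_on ({c..d} \<times> {c..d}) (\<lambda>p. n (fst p) (snd p))"
      "continuous_on ({c..d} \<times> {c..d}) (\<lambda>p. Fd (fst p) (snd p))"
  shows "((\<lambda>t. n t t + k t t) has_real_derivative 2 * Fd t t) (at t)"
proof -
  let ?S = "{c<..<d}"
  obtain \<Psi> J where \<Psi>: "\<And>s r. s \<in> ?S \<Longrightarrow> r \<in> ?S \<Longrightarrow> ((\<lambda>s. \<Psi> s r) has_real_derivative J s r) (at s)"
    and J: "\<And>s r. s \<in> ?S \<Longrightarrow> r \<in> ?S \<Longrightarrow> ((\<lambda>r. J s r) has_real_derivative k s r) (at r)"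
    and \<Psi>_sym: "\<And>s r. s \<in> ?S \<Longrightarrow> r \<in> ?S \<Longrightarrow> \<Psi> s r = \<Psi> r s"
    and J_cont: "continuous_on (?S \<times> ?S) (\<lambda>p. J (fst p) (snd p))"
    using symmetric_primitive[OF cont(1) k_sym] by blast
  define \<Phi> where "\<Phi> s r = kH s r + \<Psi> s r" for s r
  define \<mu> where "\<mu> s r = m s r + J s r" for s r
  define q where "q s r = n s r + k s r" for s r
  have \<Phi>1: "((\<lambda>s. \<Phi> s r) has_real_derivative \<mu> s r) (at s)" if "s \<in> ?S" "r \<in> ?S" for s r
    unfolding \<Phi>_def \<mu>_def using that by (intro DERIV_add kH \<Psi>) auto
  have \<Phi>2: "((\<lambda>r. \<Phi> s r) has_real_derivative \<mu> r s) (at r)" if "s \<in> ?S" "r \<in> ?S" for s r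
  proof (rule has_field_derivative_transform_within_open[OF \<Phi>1[OF that(2,1)], of ?S])
    show "\<Phi> x s = \<Phi> s x" if "x \<in> ?S" for x using that \<open>s \<in> ?S\<close> kH_sym \<Psi>_sym by (simp add: \<Phi>_def)
  qed (use that in auto)
  have \<mu>2: "((\<lambda>r. \<mu> s r) has_real_derivative q s r) (at r)" if "s \<in> ?S" "r \<in> ?S" for s r
    unfolding \<mu>_def q_def using that by (intro DERIV_add m2 J) auto
  have \<mu>_cont: "continuous_on (?S \<times> ?S) (\<lambda>p. \<mu> (snd p) (fst p))"
  proof -
    have "continuous_on (?S \<times> ?S) (\<lambda>p. \<mu> (fst p) (snd p))"
      unfolding \<mu>_def by (intro continuous_on_add J_cont continuous_on_subset[OF cont(2)]) auto
    then have "continuous_on (?S \<times> ?S) (\<lambda>p. \<mu> (fst (snd p, fst p)) (snd (snd p, fst p)))"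
      by (rule continuous_on_compose2[where f = "\<lambda>p. (snd p, fst p)"]) (auto intro!: continuous_intros)
    then show ?thesis by simp
  qed
  define G where "G h t = \<Phi> (t + h) (t + h) - \<Phi> (t + h) (t + 0) - \<Phi> (t + 0) (t + h) + \<Phi> (t + 0) (t + 0)" for h t
  have G_value: "\<exists>s\<in>{t<..<t + h}. \<exists>r\<in>{t<..<t + h}. G h t = h * (h * q s r)"
    if h: "h > 0" "c < t" "t + h < d" for h t
  proof -
    have "\<exists>s\<in>{t<..<t + h}. (\<Phi> (t + h) (t + h) - \<Phi> (t + h) t) - (\<Phi> t (t + h) - \<Phi> t t)
       = (t + h - t) * (\<mu> s (t + h) - \<mu> s t)"
      using h by (intro MVT_real DERIV_diff \<Phi>1) auto
    then obtain s where s: "s \<in> {t<..<t + h}" "G h t = h * (\<mu> s (t + h) - \<mu> s t)"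
      by (auto simp: G_def)
    have "\<exists>r\<in>{t<..<t + h}. \<mu> s (t + h) - \<mu> s t = (t + h - t) * q s r"
      using h s(1) by (intro MVT_real \<mu>2) auto
    then show ?thesis using s by auto
  qed
  have G_deriv: "(G h has_real_derivative 2 * (\<mu> (t + h) (t + h) - \<mu> (t + h) t - \<mu> t (t + h) + \<mu> t t)) (at t)"
    if h: "h > 0" "c < t" "t + h < d" for h t
  proof -
    have d: "((\<lambda>t. \<Phi> (t + \<alpha>) (t + \<beta>)) has_real_derivative \<mu> (t + \<alpha>) (t + \<beta>) + \<mu> (t + \<beta>) (t + \<alpha>)) (at t)"
      if "\<alpha> \<in> {0, h}" "\<beta> \<in> {0, h}" for \<alpha> \<beta>
      using h that by (intro has_derivative_diagonal[OF _ _ \<Phi>1 \<Phi>2 \<mu>_cont]) auto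
    have "(G h has_real_derivative (\<mu> (t + h) (t + h) + \<mu> (t + h) (t + h)) - (\<mu> (t + h) (t + 0) + \<mu> (t + 0) (t + h))
       - (\<mu> (t + 0) (t + h) + \<mu> (t + h) (t + 0)) + (\<mu> (t + 0) (t + 0) + \<mu> (t + 0) (t + 0))) (at t)"
      unfolding G_def by (intro DERIV_add DERIV_diff d) auto
    then show ?thesis by (simp add: algebra_simps)
  qed
  have \<mu>_value: "\<exists>\<sigma>\<in>{t<..<t + h}. \<exists>\<rho>\<in>{t<..<t + h}.
      \<mu> (t + h) (t + h) - \<mu> (t + h) t - \<mu> t (t + h) + \<mu> t t = h * (h * Fd \<sigma> \<rho>)"
    if h: "h > 0" "c < t" "t + h < d" for h t
  proof -
    \<comment> \<open>The terms with \<open>J\<close> are arranged such that the symmetric kernel \<open>k\<close> cancels in the derivative.\<close>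
    define g where "g \<sigma> = (m \<sigma> (t + h) - m \<sigma> t) + (J (t + h) \<sigma> - J t \<sigma>)" for \<sigma>
    have g: "(g has_real_derivative F \<sigma> (t + h) - F \<sigma> t) (at \<sigma>)" if "\<sigma> \<in> {t..t + h}" for \<sigma>
    proof -
      have "(g has_real_derivative ((F \<sigma> (t + h) - k \<sigma> (t + h)) - (F \<sigma> t - k \<sigma> t)) + (k (t + h) \<sigma> - k t \<sigma>)) (at \<sigma>)"
        unfolding g_def using h that by (intro DERIV_add DERIV_diff m1 J) auto
      moreover have "k (t + h) \<sigma> = k \<sigma> (t + h)" "k t \<sigma> = k \<sigma> t" using h that by (auto intro: k_sym)
      ultimately show ?thesis by simp
    qed
    have "\<exists>\<sigma>\<in>{t<..<t + h}. g (t + h) - g t = (t + h - t) * (F \<sigma> (t + h) - F \<sigma> t)"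
      using h g by (intro MVT_real) auto
    then obtain \<sigma> where \<sigma>: "\<sigma> \<in> {t<..<t + h}" "g (t + h) - g t = h * (F \<sigma> (t + h) - F \<sigma> t)" by auto
    have "\<exists>\<rho>\<in>{t<..<t + h}. F \<sigma> (t + h) - F \<sigma> t = (t + h - t) * Fd \<sigma> \<rho>"
      using h \<sigma>(1) by (intro MVT_real F2) auto
    then obtain \<rho> where \<rho>: "\<rho> \<in> {t<..<t + h}" "F \<sigma> (t + h) - F \<sigma> t = h * Fd \<sigma> \<rho>" by auto
    have "g (t + h) - g t = \<mu> (t + h) (t + h) - \<mu> (t + h) t - \<mu> t (t + h) + \<mu> t t"
      by (simp add: g_def \<mu>_def)
    then have "\<mu> (t + h) (t + h) - \<mu> (t + h) t - \<mu> t (t + h) + \<mu> t t = h * (h * Fd \<sigma> \<rho>)"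
      using \<sigma>(2) unfolding \<rho>(2) by simp
    then show ?thesis using \<sigma>(1) \<rho>(1) by blast
  qed
  have near: "\<exists>s1 r1 s2 r2 \<sigma> \<rho>. s1 \<in> {t1<..<t1 + h} \<and> r1 \<in> {t1<..<t1 + h} \<and> s2 \<in> {t2<..<t2 + h} \<and> r2 \<in> {t2<..<t2 + h} \<and>
      \<sigma> \<in> {t1<..<t2 + h} \<and> \<rho> \<in> {t1<..<t2 + h} \<and> q s2 r2 - q s1 r1 = (t2 - t1) * (2 * Fd \<sigma> \<rho>)"
    if h: "h > 0" and t12: "c < t1" "t1 < t2" "t2 + h < d" for h t1 t2
  proof -
    have "\<exists>\<tau>\<in>{t1<..<t2}. G h t2 - G h t1 = (t2 - t1) * (2 * (\<mu> (\<tau> + h) (\<tau> + h) - \<mu> (\<tau> + h) \<tau> - \<mu> \<tau> (\<tau> + h) + \<mu> \<tau> \<tau>))"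
      using h t12 by (intro MVT_real G_deriv) auto
    then obtain \<tau> where \<tau>: "\<tau> \<in> {t1<..<t2}"
      "G h t2 - G h t1 = (t2 - t1) * (2 * (\<mu> (\<tau> + h) (\<tau> + h) - \<mu> (\<tau> + h) \<tau> - \<mu> \<tau> (\<tau> + h) + \<mu> \<tau> \<tau>))" by blast
    obtain \<sigma> \<rho> where \<sigma>: "\<sigma> \<in> {\<tau><..<\<tau> + h}" "\<rho> \<in> {\<tau><..<\<tau> + h}"
      "\<mu> (\<tau> + h) (\<tau> + h) - \<mu> (\<tau> + h) \<tau> - \<mu> \<tau> (\<tau> + h) + \<mu> \<tau> \<tau> = h * (h * Fd \<sigma> \<rho>)"
      using \<mu>_value[of h \<tau>] h t12 \<tau>(1) by auto
    obtain s1 r1 where 1: "s1 \<in> {t1<..<t1 + h}" "r1 \<in> {t1<..<t1 + h}" "G h t1 = h * (h * q s1 r1)"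
      using G_value[of h t1] h t12 by auto
    obtain s2 r2 where 2: "s2 \<in> {t2<..<t2 + h}" "r2 \<in> {t2<..<t2 + h}" "G h t2 = h * (h * q s2 r2)"
      using G_value[of h t2] h t12 by auto
    have "h * (h * (q s2 r2 - q s1 r1)) = h * (h * ((t2 - t1) * (2 * Fd \<sigma> \<rho>)))"
      using \<tau>(2) unfolding \<sigma>(3) 1(3) 2(3) by (simp add: algebra_simps)
    then have "q s2 r2 - q s1 r1 = (t2 - t1) * (2 * Fd \<sigma> \<rho>)" using h by simp
    moreover have "\<sigma> \<in> {t1<..<t2 + h}" "\<rho> \<in> {t1<..<t2 + h}" using \<sigma> \<tau>(1) by auto
    ultimately show ?thesis using 1 2 by blast
  qed
  have q_cont: "continuous_on (?S \<times> ?S) (\<lambda>p. q (fst p) (snd p))"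
    unfolding q_def by (intro continuous_on_add continuous_on_subset[OF cont(1)] continuous_on_subset[OF cont(3)]) auto
  have q_lim: "(\<lambda>i. q (X i) (Y i)) \<longlonglongrightarrow> q x x"
    if "X \<longlonglongrightarrow> x" "Y \<longlonglongrightarrow> x" "\<And>i. X i \<in> ?S" "\<And>i. Y i \<in> ?S" "x \<in> ?S" for X Y x
    using continuous_on_tendsto_compose[OF q_cont, of "\<lambda>i. (X i, Y i)" "(x, x)"] that
    by (auto intro!: tendsto_Pair)
  have estimate: "\<bar>q t2 t2 - q t1 t1 - (t2 - t1) * (2 * Fd t t)\<bar> \<le> e * (t2 - t1)"
    if t12: "t - D < t1" "t1 < t2" "t2 < t + D" "c < t - D" "t + D < d" 
      and D: "\<And>\<sigma> \<rho>. \<bar>\<sigma> - t\<bar> < D \<Longrightarrow> \<bar>\<rho> - t\<bar> < D \<Longrightarrow> \<bar>2 * Fd \<sigma> \<rho> - 2 * Fd t t\<bar> \<le> e" for t1 t2 D e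
  proof -
    define h where "h i = (t + D - t2) / real (Suc (Suc i))" for i
    have h: "h i > 0" "t2 + h i < t + D" for i
    proof -
      show "h i > 0" using t12 by (simp add: h_def)
      have "h i \<le> (t + D - t2) / 2" unfolding h_def using t12 by (intro divide_left_mono) auto
      then show "t2 + h i < t + D" using t12 by (simp add: field_simps)
    qed
    have h0: "h \<longlonglongrightarrow> 0" unfolding h_def by real_asymp
    have "\<exists>s1 r1 s2 r2 \<sigma> \<rho>. s1 \<in> {t1<..<t1 + h i} \<and> r1 \<in> {t1<..<t1 + h i} \<and> s2 \<in> {t2<..<t2 + h i} \<and> r2 \<in> {t2<..<t2 + h i} \<and>
      \<sigma> \<in> {t1<..<t2 + h i} \<and> \<rho> \<in> {t1<..<t2 + h i} \<and> q s2 r2 - q s1 r1 = (t2 - t1) * (2 * Fd \<sigma> \<rho>)" for i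
      using h[of i] t12 by (intro near) auto
    then obtain s1 r1 s2 r2 \<sigma> \<rho> where *: "\<And>i. s1 i \<in> {t1<..<t1 + h i}" "\<And>i. r1 i \<in> {t1<..<t1 + h i}"
       "\<And>i. s2 i \<in> {t2<..<t2 + h i}" "\<And>i. r2 i \<in> {t2<..<t2 + h i}"
       "\<And>i. \<sigma> i \<in> {t1<..<t2 + h i}" "\<And>i. \<rho> i \<in> {t1<..<t2 + h i}"
       "\<And>i. q (s2 i) (r2 i) - q (s1 i) (r1 i) = (t2 - t1) * (2 * Fd (\<sigma> i) (\<rho> i))"
      by metis
    have lim: "X \<longlonglongrightarrow> x" if "\<And>i. X i \<in> {x<..<x + h i}" for X x
    proof (rule tendsto_sandwich[of "\<lambda>_. x" _ _ "\<lambda>i. x + h i"])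
      show "(\<lambda>i. x + h i) \<longlonglongrightarrow> x" using tendsto_add[OF tendsto_const h0, of x] by simp
    qed (use that in \<open>auto intro!: always_eventually simp: less_imp_le\<close>)
    have "\<bar>(q (s2 i) (r2 i) - q (s1 i) (r1 i)) - (t2 - t1) * (2 * Fd t t)\<bar> \<le> e * (t2 - t1)" for i
    proof -
      have "\<bar>2 * Fd (\<sigma> i) (\<rho> i) - 2 * Fd t t\<bar> \<le> e"
        using *(5,6)[of i] h[of i] t12 by (intro D) (auto simp: abs_less_iff)
      then have "(t2 - t1) * \<bar>2 * Fd (\<sigma> i) (\<rho> i) - 2 * Fd t t\<bar> \<le> (t2 - t1) * e"
        using t12 by (intro mult_left_mono) auto
      moreover have "\<bar>(t2 - t1) * (2 * Fd (\<sigma> i) (\<rho> i)) - (t2 - t1) * (2 * Fd t t)\<bar> = (t2 - t1) * \<bar>2 * Fd (\<sigma> i) (\<rho> i) - 2 * Fd t t\<bar>"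
        using t12 unfolding right_diff_distrib[symmetric, of "t2 - t1"] abs_mult by simp
      ultimately show ?thesis unfolding *(7) by (simp add: mult.commute)
    qed
    moreover have "(\<lambda>i. \<bar>(q (s2 i) (r2 i) - q (s1 i) (r1 i)) - (t2 - t1) * (2 * Fd t t)\<bar>)
       \<longlonglongrightarrow> \<bar>(q t2 t2 - q t1 t1) - (t2 - t1) * (2 * Fd t t)\<bar>"
    proof (intro tendsto_intros q_lim lim)
      show "s2 i \<in> ?S" "r2 i \<in> ?S" "s1 i \<in> ?S" "r1 i \<in> ?S" for i
        using *(1-4)[of i] h[of i] t12 by auto
    qed (use * t12 in auto)
    ultimately show ?thesis by (intro LIMSEQ_le_const2) auto
  qed
  have "((\<lambda>t. q t t) has_derivative (\<lambda>x. (2 * Fd t t) * x)) (at t)"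
    unfolding has_derivative_at_alt
  proof (intro conjI allI impI)
    show "bounded_linear ((*) (2 * Fd t t))" by (rule bounded_linear_mult_right)
    fix e :: real assume e: "e > 0"
    have "isCont (\<lambda>p. 2 * Fd (fst p) (snd p)) (t, t)"
    proof -
      have "continuous_on (?S \<times> ?S) (\<lambda>p. 2 * Fd (fst p) (snd p))"
        by (intro continuous_intros continuous_on_subset[OF cont(4)]) auto
      then show ?thesis using t by (subst (asm) continuous_on_eq_continuous_at) (auto intro: open_Times)
    qed
    then obtain D0 where D0: "D0 > 0" "\<And>p. dist p (t, t) < D0 \<Longrightarrow> dist (2 * Fd (fst p) (snd p)) (2 * Fd t t) < e"
      using e unfolding continuous_at_eps_delta by fastforce
    define D where "D = min (D0 / 2) (min ((t - c) / 2) ((d - t) / 2))"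
    have D: "D > 0" "D \<le> D0 / 2" "D \<le> (t - c) / 2" "D \<le> (d - t) / 2"
    proof -
      have "0 < D0 / 2" "0 < (t - c) / 2" "0 < (d - t) / 2" using D0(1) t by auto
      then show "D > 0" "D \<le> D0 / 2" "D \<le> (t - c) / 2" "D \<le> (d - t) / 2" unfolding D_def by linarith+
    qed
    have D_c: "c < t - D" "t + D < d" using D t by (auto simp: field_simps)
    have D1: "\<bar>2 * Fd \<sigma> \<rho> - 2 * Fd t t\<bar> \<le> e" if "\<bar>\<sigma> - t\<bar> < D" "\<bar>\<rho> - t\<bar> < D" for \<sigma> \<rho>
    proof -
      have "dist (\<sigma>, \<rho>) (t, t) \<le> \<bar>\<sigma> - t\<bar> + \<bar>\<rho> - t\<bar>"
        using sqrt_sum_squares_le_sum_abs[of "\<sigma> - t" "\<rho> - t"] by (simp add: dist_Pair_Pair dist_real_def)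
      then have "dist (\<sigma>, \<rho>) (t, t) < D0" using that D by linarith
      from D0(2)[OF this] show ?thesis by (simp add: dist_real_def)
    qed
    show "\<exists>D>0. \<forall>y. norm (y - t) < D \<longrightarrow> norm (q y y - q t t - (2 * Fd t t) * (y - t)) \<le> e * norm (y - t)"
    proof (intro exI[of _ D] conjI allI impI D(1))
      fix y assume y: "norm (y - t) < D"
      show "norm (q y y - q t t - (2 * Fd t t) * (y - t)) \<le> e * norm (y - t)"
      proof (cases y t rule: linorder_cases)
        case less
        have "\<bar>q t t - q y y - (t - y) * (2 * Fd t t)\<bar> \<le> e * (t - y)"
          using y less D(1) D_c by (intro estimate[of D] D1) auto
        then show ?thesis using less by (simp add: algebra_simps abs_if split: if_splits)
      next
        case greater
        have "\<bar>q y y - q t t - (y - t) * (2 * Fd t t)\<bar> \<le> e * (y - t)"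
          using y greater D(1) D_c by (intro estimate[of D] D1) auto
        then show ?thesis using greater by (simp add: algebra_simps)
      qed simp
    qed
  qed
  then show ?thesis by (simp add: has_field_derivative_def q_def)
qed

section \<open>Curves in the energy spaces\<close>

context plate_width
begin

lemma L2_norm_square: "(L2_norm \<Omega> f)\<^sup>2 = I f f"
  by (simp add: L2_norm_def I_nonneg)

lemma V_norm_square: "f \<in> V \<Longrightarrow> (H2_star_norm l f)\<^sup>2 = eV f f"
  using V.N_square by (simp add: V_N)

lemma L2_norm_le_V:
  assumes \<Lambda>: "0 < \<Lambda>" and f: "f \<in> V" shows "L2_norm \<Omega> f \<le> sqrt (1 / \<Lambda>) * H2_star_norm l f"
proof -
  have "I f f \<le> 1 / \<Lambda> * eV f f" using lambda1_le[OF f] \<Lambda> by (simp add: field_simps)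
  then show ?thesis unfolding L2_norm_def H2_star_norm_def real_sqrt_mult[symmetric] by (rule real_sqrt_le_mono)
qed

lemma C0_curve_bound:
  assumes u: "C0_curve X N u" and Y: "\<And>t. t \<ge> 0 \<Longrightarrow> v t \<in> Y"
    and bound: "\<And>s t. s \<ge> 0 \<Longrightarrow> t \<ge> 0 \<Longrightarrow> M (\<lambda>z. v s z - v t z) \<le> K * N (\<lambda>z. u s z - u t z)"
    and M: "\<And>s t. s \<ge> 0 \<Longrightarrow> t \<ge> 0 \<Longrightarrow> 0 \<le> M (\<lambda>z. v s z - v t z)"
  shows "C0_curve Y M v"
  unfolding C0_curve_def
proof (intro allI impI conjI Y)
  fix t :: real assume t: "t \<ge> 0"
  have ev: "\<forall>\<^sub>F s in at t within {0..}. s \<ge> 0" by (auto simp: eventually_at_filter intro!: always_eventually)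
  have "((\<lambda>s. K * N (\<lambda>z. u s z - u t z)) \<longlongrightarrow> K * 0) (at t within {0..})"
    using u t by (intro tendsto_intros) (auto simp: C0_curve_def)
  then have "((\<lambda>s. K * N (\<lambda>z. u s z - u t z)) \<longlongrightarrow> 0) (at t within {0..})" by simp
  then show "((\<lambda>s. M (\<lambda>z. v s z - v t z)) \<longlongrightarrow> 0) (at t within {0..})"
    by (rule Lim_null_comparison[rotated], intro eventually_mono[OF ev]) (use bound M t in auto)
qed

lemma C0_curve_V_L2:
  assumes \<Lambda>: "0 < \<Lambda>" and u: "C0_curve V (H2_star_norm l) u"
  shows "C0_curve L2 (L2_norm \<Omega>) u"
proof (rule C0_curve_bound[OF u, where K = "sqrt (1 / \<Lambda>)"])
  have V: "u t \<in> V" if "t \<ge> 0" for t using u that by (auto simp: C0_curve_def)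
  show "u t \<in> L2" if "t \<ge> 0" for t using V[OF that] by (rule V_L2)
  show "L2_norm \<Omega> (\<lambda>z. u s z - u t z) \<le> sqrt (1 / \<Lambda>) * H2_star_norm l (\<lambda>z. u s z - u t z)"
    if "s \<ge> 0" "t \<ge> 0" for s t
    using V that by (intro L2_norm_le_V \<Lambda> V.diff)
qed (simp add: L2_norm_def I_nonneg)

lemma C0_curve_weak_xx:
  assumes u: "C0_curve V (H2_star_norm l) u"
  shows "C0_curve L2 (L2_norm \<Omega>) (\<lambda>t. weak_xx l (u t))"
proof (rule C0_curve_bound[OF u, where K = "sqrt (25 / 24)"])
  have V: "u t \<in> V" if "t \<ge> 0" for t using u that by (auto simp: C0_curve_def)
  show "weak_xx l (u t) \<in> L2" if "t \<ge> 0" for t using V[OF that] by (rule weak_xx_L2)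
  fix s t :: real assume st: "s \<ge> 0" "t \<ge> 0"
  let ?d = "\<lambda>z. u s z - u t z" and ?D = "\<lambda>z. weak_xx l (u s) z - weak_xx l (u t) z"
  have d: "?d \<in> V" using V st by (intro V.diff)
  have L: "weak_xx l ?d \<in> L2" "?D \<in> L2" using V st d by (auto intro: weak_xx_L2 L2.diff)
  have wd: "is_weak_deriv \<Omega> [(1, 0), (1, 0)] (u r) (weak_xx l (u r))" if "r \<ge> 0" for r
    unfolding weak_xx_def using V[OF that] by (intro weak_deriv_works V_H2) simp_all
  have "is_weak_deriv \<Omega> [(1, 0), (1, 0)] (\<lambda>z. 1 * u s z + (-1) * u t z) (\<lambda>z. 1 * weak_xx l (u s) z + (-1) * weak_xx l (u t) z)"
    using V st by (intro is_weak_deriv_lin wd V_L2)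
  then have "is_weak_deriv \<Omega> [(1, 0), (1, 0)] ?d ?D" by simp
  then have ae: "AE z in lebesgue_on \<Omega>. weak_xx l ?d z = ?D z"
    unfolding weak_xx_def using weak_deriv_eq[OF V_H2[OF d]] by simp
  have "I ?D ?D = I (weak_xx l ?d) (weak_xx l ?d)"
    using I_cong_AE[OF L L(1) ae] I_cong_AE[OF L L(2) ae] by (simp add: I_sym)
  also have "\<dots> \<le> 25 / 24 * eV ?d ?d" by (rule weak_xx_bound[OF d])
  finally show "L2_norm \<Omega> ?D \<le> sqrt (25 / 24) * H2_star_norm l ?d"
    unfolding L2_norm_def H2_star_norm_def real_sqrt_mult[symmetric] by (rule real_sqrt_le_mono)
qed (simp add: L2_norm_def I_nonneg)

lemma continuous_on_I:
  "C0_curve L2 (L2_norm \<Omega>) v \<Longrightarrow> C0_curve L2 (L2_norm \<Omega>) w \<Longrightarrow>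
    continuous_on ({0..} \<times> {0..}) (\<lambda>p. I (v (fst p)) (w (snd p)))"
  using L2.continuous_on_B by (simp add: L2_N)

lemma continuous_bx:
  assumes \<Lambda>: "0 < \<Lambda>" and u: "C0_curve V (H2_star_norm l) u"
  shows "continuous_on {0..} (\<lambda>t. bx (u t) (u t))"
proof -
  have "continuous_on {0..} (\<lambda>t. I (weak_xx l (u (fst (t, t)))) (u (snd (t, t))))"
    by (rule continuous_on_compose2[OF continuous_on_I[OF C0_curve_weak_xx[OF u] C0_curve_V_L2[OF \<Lambda> u]], of _ "\<lambda>t. (t, t)"])
       (auto intro!: continuous_intros)
  then have "continuous_on {0..} (\<lambda>t. - I (weak_xx l (u t)) (u t))" by (intro continuous_intros) simp
  then show ?thesis
    by (rule continuous_on_eq) (use u in \<open>auto simp: C0_curve_def integration_by_parts\<close>)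
qed

end

section \<open>Energy identities for the linear plate equation\<close>

text \<open>The solution and its torsional part satisfy the same linear equation once the factor
  \<open>S * bx u u - P\<close> in front of \<open>u\<^sub>x\<^sub>x\<close> is regarded as a given coefficient \<open>\<alpha>\<close>, with the forcing \<open>g\<close> and
  zero, respectively.\<close>

locale plate_evolution = plate_width +
  fixes \<delta> :: real and \<alpha> :: "real \<Rightarrow> real" and w wt \<gamma> :: "real \<Rightarrow> real \<times> real \<Rightarrow> real"
  assumes \<Lambda>_pos: "0 < \<Lambda>"
    and w: "C0_curve V (H2_star_norm l) w"
    and wt: "C0_curve L2 (L2_norm \<Omega>) wt"
    and w_wt: "has_time_deriv (L2_norm \<Omega>) w wt"
    and \<gamma>: "C0_curve L2 (L2_norm \<Omega>) \<gamma>"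
    and \<alpha>: "continuous_on {0..} \<alpha>"
    and evolution: "\<And>t v. t > 0 \<Longrightarrow> v \<in> V \<Longrightarrow> ((\<lambda>s. I (wt s) v) has_real_derivative
        I (\<gamma> t) v - \<delta> * I (wt t) v - eV (w t) v - \<alpha> t * bx (w t) v) (at t)"
begin

abbreviation "xx t \<equiv> weak_xx l (w t)"

lemma wV: "t \<ge> 0 \<Longrightarrow> w t \<in> V" and wL2: "t \<ge> 0 \<Longrightarrow> w t \<in> L2" and wtL2: "t \<ge> 0 \<Longrightarrow> wt t \<in> L2"
  and \<gamma>L2: "t \<ge> 0 \<Longrightarrow> \<gamma> t \<in> L2" and xxL2: "t \<ge> 0 \<Longrightarrow> xx t \<in> L2"
  using w wt \<gamma> by (auto simp: C0_curve_def intro: V_L2 weak_xx_L2)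

lemma w_C0: "C0_curve L2 (L2_norm \<Omega>) w" by (rule C0_curve_V_L2[OF \<Lambda>_pos w])

lemma xx_C0: "C0_curve L2 (L2_norm \<Omega>) xx" by (rule C0_curve_weak_xx[OF w])

lemma deriv_I_w: "t > 0 \<Longrightarrow> f \<in> L2 \<Longrightarrow> ((\<lambda>r. I f (w r)) has_real_derivative I f (wt t)) (at t)"
  using L2.has_derivative_B[of w wt f t] wL2 wtL2 w_wt by (simp add: L2_N I_sym[of f])

lemma continuous_square:
  fixes f :: "real \<times> real \<Rightarrow> real"
  assumes "continuous_on ({0..} \<times> {0..}) f" "0 < c"
  shows "continuous_on ({c..d} \<times> {c..d}) f" "continuous_on ({c<..<d} \<times> {c<..<d}) f"
proof -
  have "{c..d} \<subseteq> {0..}" "{c<..<d} \<subseteq> {0..}" using assms(2) by auto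
  then have "{c..d} \<times> {c..d} \<subseteq> {0..} \<times> {0..}" "{c<..<d} \<times> {c<..<d} \<subseteq> {0..} \<times> {0..}" by blast+
  then show "continuous_on ({c..d} \<times> {c..d}) f" "continuous_on ({c<..<d} \<times> {c<..<d}) f"
    using continuous_on_subset[OF assms(1)] by blast+
qed

text \<open>By \<open>integration_by_parts\<close>, the term with \<open>\<alpha>\<close> is the \<open>L\<^sup>2\<close> product with \<open>\<alpha> w\<^sub>x\<^sub>x\<close>, so it may be treated
  as a part of the right hand side \<open>F\<close>; as such it can be paired with the velocity.\<close>

lemma deriv_energy:
  assumes t: "t > 0"
  shows "((\<lambda>t. I (wt t) (wt t) + eV (w t) (w t)) has_real_derivative
     2 * (I (\<gamma> t) (wt t) - \<delta> * I (wt t) (wt t) + \<alpha> t * I (xx t) (wt t))) (at t)"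
proof (rule energy_identity[where c = "t / 2" and d = "t + 1" and kH = "\<lambda>s r. I (w s) (w r)"
      and k = "\<lambda>s r. eV (w s) (w r)" and n = "\<lambda>s r. I (wt s) (wt r)" and m = "\<lambda>s r. I (wt s) (w r)"
      and F = "\<lambda>s r. I (\<gamma> s) (w r) - \<delta> * I (wt s) (w r) + \<alpha> s * I (xx s) (w r)"
      and Fd = "\<lambda>s r. I (\<gamma> s) (wt r) - \<delta> * I (wt s) (wt r) + \<alpha> s * I (xx s) (wt r)"])
  have c: "0 < t / 2" using t by simp
  have pos: "s > 0" if "s \<in> {t / 2..t + 1}" for s using that t by simp
  show "t \<in> {t / 2<..<t + 1}" using t by simp
  fix s r assume sr: "s \<in> {t / 2..t + 1}" "r \<in> {t / 2..t + 1}"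
  have p: "s > 0" "r > 0" using sr pos by blast+
  show "((\<lambda>s. I (w s) (w r)) has_real_derivative I (wt s) (w r)) (at s)"
    using deriv_I_w[OF p(1) wL2, of r] p by (simp add: I_sym)
  show "eV (w s) (w r) = eV (w r) (w s)" using p by (intro V.sym wV) auto
  show "((\<lambda>s. I (wt s) (w r)) has_real_derivative I (\<gamma> s) (w r) - \<delta> * I (wt s) (w r) + \<alpha> s * I (xx s) (w r) - eV (w s) (w r)) (at s)"
    using evolution[OF p(1) wV, of r] p by (simp add: integration_by_parts wV algebra_simps)
  show "((\<lambda>r. I (wt s) (w r)) has_real_derivative I (wt s) (wt r)) (at r)"
    using p by (intro deriv_I_w wtL2) auto
  show "((\<lambda>r. I (\<gamma> s) (w r) - \<delta> * I (wt s) (w r) + \<alpha> s * I (xx s) (w r)) has_real_derivative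
      I (\<gamma> s) (wt r) - \<delta> * I (wt s) (wt r) + \<alpha> s * I (xx s) (wt r)) (at r)"
    using p by (intro DERIV_add DERIV_diff DERIV_cmult deriv_I_w wtL2 \<gamma>L2 xxL2) auto
next
  have c: "0 < t / 2" using t by simp
  have "continuous_on ({0..} \<times> {0..}) (\<lambda>p. eV (w (fst p)) (w (snd p)))"
    using V.continuous_on_B[of w w] w by (simp add: V_N)
  then show "continuous_on ({t / 2..t + 1} \<times> {t / 2..t + 1}) (\<lambda>p. eV (w (fst p)) (w (snd p)))"
    by (rule continuous_square(1)[OF _ c])
  show "continuous_on ({t / 2..t + 1} \<times> {t / 2..t + 1}) (\<lambda>p. I (wt (fst p)) (w (snd p)))"
    "continuous_on ({t / 2..t + 1} \<times> {t / 2..t + 1}) (\<lambda>p. I (wt (fst p)) (wt (snd p)))"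
    using continuous_on_I wt w_C0 by (auto intro!: continuous_square(1)[OF _ c])
  have "continuous_on ({0..} \<times> {0..}) (\<lambda>p :: real \<times> real. \<alpha> (fst p))"
    by (rule continuous_on_compose2[OF \<alpha>]) (auto intro!: continuous_intros)
  then have "continuous_on ({0..} \<times> {0..}) (\<lambda>p. I (\<gamma> (fst p)) (wt (snd p)) - \<delta> * I (wt (fst p)) (wt (snd p)) + \<alpha> (fst p) * I (xx (fst p)) (wt (snd p)))"
    by (intro continuous_on_add continuous_on_diff continuous_on_mult continuous_on_const continuous_on_I \<gamma> wt xx_C0)
  then show "continuous_on ({t / 2..t + 1} \<times> {t / 2..t + 1}) (\<lambda>p. I (\<gamma> (fst p)) (wt (snd p)) - \<delta> * I (wt (fst p)) (wt (snd p)) + \<alpha> (fst p) * I (xx (fst p)) (wt (snd p)))"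
    by (rule continuous_square(1)[OF _ c])
qed (rule I_sym)

lemma deriv_cross:
  assumes t: "t > 0"
  shows "((\<lambda>t. I (wt t) (w t)) has_real_derivative
     I (\<gamma> t) (w t) - \<delta> * I (wt t) (w t) - eV (w t) (w t) - \<alpha> t * bx (w t) (w t) + I (wt t) (wt t)) (at t)"
proof -
  have c: "0 < t / 2" using t by simp
  have "((\<lambda>t. I (wt (t + 0)) (w (t + 0))) has_real_derivative
     (I (\<gamma> t) (w t) - \<delta> * I (wt t) (w t) - eV (w t) (w t) - \<alpha> t * bx (w t) (w t)) + I (wt (t + 0)) (wt (t + 0))) (at t)"
  proof (rule has_derivative_diagonal[where c = "t / 2" and d = "t + 1"
       and \<alpha> = 0 and \<beta> = 0 and \<Phi> = "\<lambda>s r. I (wt s) (w r)" and Q = "\<lambda>s r. I (wt s) (wt r)"])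
    show "((\<lambda>s. I (wt s) (w (t + 0))) has_real_derivative
      I (\<gamma> t) (w t) - \<delta> * I (wt t) (w t) - eV (w t) (w t) - \<alpha> t * bx (w t) (w t)) (at (t + 0))"
      using evolution[OF t wV, of t] t by simp
    show "((\<lambda>r. I (wt s) (w r)) has_real_derivative I (wt s) (wt r)) (at r)"
      if "s \<in> {t / 2<..<t + 1}" "r \<in> {t / 2<..<t + 1}" for s r
    proof -
      have "s > t / 2" "r > t / 2" using that by simp_all
      then have "s > 0" "r > 0" using t by linarith+
      then show ?thesis by (intro deriv_I_w wtL2) auto
    qed
    show "continuous_on ({t / 2<..<t + 1} \<times> {t / 2<..<t + 1}) (\<lambda>p. I (wt (fst p)) (wt (snd p)))"
      by (intro continuous_square(2)[OF _ c] continuous_on_I wt)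
  qed (use t in auto)
  then show ?thesis by simp
qed

lemma deriv_L2:
  assumes t: "t > 0" shows "((\<lambda>t. I (w t) (w t)) has_real_derivative 2 * I (wt t) (w t)) (at t)"
proof -
  have c: "0 < t / 2" using t by simp
  have "((\<lambda>t. I (w (t + 0)) (w (t + 0))) has_real_derivative I (wt t) (w t) + I (w (t + 0)) (wt (t + 0))) (at t)"
  proof (rule has_derivative_diagonal[where c = "t / 2" and d = "t + 1"
       and \<alpha> = 0 and \<beta> = 0 and \<Phi> = "\<lambda>s r. I (w s) (w r)" and Q = "\<lambda>s r. I (w s) (wt r)"])
    show "((\<lambda>s. I (w s) (w (t + 0))) has_real_derivative I (wt t) (w t)) (at (t + 0))"
      using deriv_I_w[OF t wL2, of t] t by (simp add: I_sym)
    show "((\<lambda>r. I (w s) (w r)) has_real_derivative I (w s) (wt r)) (at r)"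
      if "s \<in> {t / 2<..<t + 1}" "r \<in> {t / 2<..<t + 1}" for s r
    proof -
      have "s > t / 2" "r > t / 2" using that by simp_all
      then have "s > 0" "r > 0" using t by linarith+
      then show ?thesis by (intro deriv_I_w wL2) auto
    qed
    show "continuous_on ({t / 2<..<t + 1} \<times> {t / 2<..<t + 1}) (\<lambda>p. I (w (fst p)) (wt (snd p)))"
      by (intro continuous_square(2)[OF _ c] continuous_on_I wt w_C0)
  qed (use t in auto)
  then show ?thesis by (simp add: I_sym[of "w t" "wt t"])
qed

lemma deriv_bx:
  assumes t: "t > 0" shows "((\<lambda>t. bx (w t) (w t)) has_real_derivative - 2 * I (xx t) (wt t)) (at t)"
proof -
  have c: "0 < t / 2" using t by simp
  have pos: "s > 0" if "s \<in> {t / 2<..<t + 1}" for s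
  proof -
    have "s > t / 2" using that by simp
    then show ?thesis using t by linarith
  qed
  have d: "((\<lambda>r. bx (w s) (w r)) has_real_derivative - I (xx s) (wt r)) (at r)" if p: "s > 0" "r > 0" for s r
  proof (rule has_field_derivative_transform_within_open[where S = "{0<..}"])
    show "((\<lambda>r. - I (xx s) (w r)) has_real_derivative - I (xx s) (wt r)) (at r)"
      using p by (intro DERIV_minus deriv_I_w xxL2) auto
    show "- I (xx s) (w x) = bx (w s) (w x)" if "x \<in> {0<..}" for x
      using p that by (simp add: integration_by_parts wV)
  qed (use p in auto)
  have "((\<lambda>t. bx (w (t + 0)) (w (t + 0))) has_real_derivative - I (xx t) (wt t) + - I (xx (t + 0)) (wt (t + 0))) (at t)"
  proof (rule has_derivative_diagonal[where c = "t / 2" and d = "t + 1"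
       and \<alpha> = 0 and \<beta> = 0 and \<Phi> = "\<lambda>s r. bx (w s) (w r)" and Q = "\<lambda>s r. - I (xx s) (wt r)"])
    show "((\<lambda>s. bx (w s) (w (t + 0))) has_real_derivative - I (xx t) (wt t)) (at (t + 0))"
      using d[OF t t] by (simp add: I_sym)
    show "((\<lambda>r. bx (w s) (w r)) has_real_derivative - I (xx s) (wt r)) (at r)"
      if "s \<in> {t / 2<..<t + 1}" "r \<in> {t / 2<..<t + 1}" for s r
      using that pos by (intro d)
    show "continuous_on ({t / 2<..<t + 1} \<times> {t / 2<..<t + 1}) (\<lambda>p. - I (xx (fst p)) (wt (snd p)))"
      by (intro continuous_square(2)[OF _ c] continuous_on_I wt xx_C0 continuous_on_minus)
  qed (use t in auto)
  then show ?thesis by simp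
qed

lemma CS_L2: "f \<in> L2 \<Longrightarrow> g \<in> L2 \<Longrightarrow> \<bar>I f g\<bar> \<le> L2_norm \<Omega> f * L2_norm \<Omega> g"
  using L2.Cauchy_Schwarz by (simp add: L2_N)

end

section \<open>Absorbing set and decay\<close>

lemma exponential_bound:
  fixes \<Phi> :: "real \<Rightarrow> real"
  assumes d: "\<And>t. t \<ge> T \<Longrightarrow> (\<Phi> has_real_derivative \<Phi>' t) (at t)"
    and le: "\<And>t. t \<ge> T \<Longrightarrow> \<Phi>' t \<le> - k * (\<Phi> t - M)" and t: "t \<ge> T"
  shows "\<Phi> t - M \<le> (\<Phi> T - M) * exp (- k * (t - T))"
proof -
  let ?g = "\<lambda>t. (\<Phi> t - M) * exp (k * t)"
  have "?g t \<le> ?g T"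
  proof (rule DERIV_nonpos_imp_nonincreasing[OF t])
    fix s assume s: "T \<le> s" "s \<le> t"
    have "(?g has_real_derivative (\<Phi>' s + k * (\<Phi> s - M)) * exp (k * s)) (at s)"
      using d[OF s(1)] by (auto intro!: derivative_eq_intros simp: algebra_simps)
    moreover have "(\<Phi>' s + k * (\<Phi> s - M)) * exp (k * s) \<le> 0"
      using le[OF s(1)] by (intro mult_nonpos_nonneg) auto
    ultimately show "\<exists>y. (?g has_real_derivative y) (at s) \<and> y \<le> 0" by blast
  qed
  then have "?g t * exp (- k * t) \<le> ?g T * exp (- k * t)" by (intro mult_right_mono) auto
  moreover have "?g t * exp (- k * t) = \<Phi> t - M" by (simp add: mult.assoc exp_minus)
  moreover have "exp (k * T) * exp (- k * t) = exp (- k * (t - T))"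
    by (simp add: mult_exp_exp algebra_simps)
  then have "?g T * exp (- k * t) = (\<Phi> T - M) * exp (- k * (t - T))" by (simp only: mult.assoc)
  ultimately show ?thesis by (simp only:)
qed

lemma exp_decay_tendsto: "k > 0 \<Longrightarrow> ((\<lambda>t. C * exp (- k * (t - T))) \<longlongrightarrow> (0::real)) at_top"
  by real_asymp

lemma young: "\<epsilon> > 0 \<Longrightarrow> (x::real) * y \<le> \<epsilon> * x\<^sup>2 / 2 + y\<^sup>2 / (2 * \<epsilon>)"
proof -
  assume e: "\<epsilon> > 0"
  have "0 \<le> (\<epsilon> * x - y)\<^sup>2" by simp
  then have "2 * \<epsilon> * (x * y) \<le> \<epsilon>\<^sup>2 * x\<^sup>2 + y\<^sup>2" by (simp add: power2_eq_square algebra_simps)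
  then show ?thesis using e by (simp add: field_simps power2_eq_square)
qed

text \<open>The level at which dissipation and supply balance in \<open>energy_dissipation_inequality\<close>: the first
  factor bounds the supply, and \<open>L / (L + 2)\<close> is the rate of dissipation.\<close>

definition absorbing_level :: "real \<Rightarrow> real \<Rightarrow> real \<Rightarrow> real \<Rightarrow> real" where
  "absorbing_level G S P L = (G\<^sup>2 / 2 + G\<^sup>2 / L + P\<^sup>2 / (2 * S)) * (L + 2) / L"

text \<open>A bound for the square of the coefficient \<open>S * q - P\<close> when \<open>q = bx u u\<close> belongs to a state whose
  Lyapunov function is at most \<open>absorbing_level G S P L + 1\<close>.\<close>

definition stretch_bound :: "real \<Rightarrow> real \<Rightarrow> real \<Rightarrow> real \<Rightarrow> real" where
  "stretch_bound G S P L = 2 * S\<^sup>2 * (8 / S * (absorbing_level G S P L + 1 + P\<^sup>2 / (2 * S))) + 2 * P\<^sup>2"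

text \<open>The variables are the values at one instant of \<open>x = \<parallel>u\<^sub>t\<parallel>\<^sup>2\<close>, \<open>E = eV u u\<close>, \<open>q = \<parallel>u\<^sub>x\<parallel>\<^sup>2\<close>, \<open>y = (u\<^sub>t, u)\<close>,
  \<open>h = \<parallel>u\<parallel>\<^sup>2\<close>, \<open>p1 = (g, u\<^sub>t)\<close> and \<open>p2 = (g, u)\<close>; the left hand side is the time derivative of \<open>\<Phi>\<close>.
  For large damping the solution relaxes at a rate of order \<open>1 / \<delta>\<close>. This is why the multiplier \<open>u\<close>
  gets the weight \<open>1 / \<delta>\<close>: both the rate and the supply are then of order \<open>1 / \<delta>\<close>, and the resulting
  bound does not depend on \<open>\<delta>\<close>. The quartic term of the energy absorbs the compression \<open>P\<close>.\<close>

lemma energy_dissipation_inequality: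
  fixes x E q y h p1 p2 G S P L \<delta> :: real
  assumes S: "S > 0" and P: "P \<ge> 0" and L: "L > 0" and \<delta>: "\<delta> \<ge> 2"
    and x: "x \<ge> 0" and q: "q \<ge> 0" and h: "h \<ge> 0" "L * h \<le> E"
    and y: "\<bar>y\<bar> \<le> sqrt x * sqrt h" and p1: "\<bar>p1\<bar> \<le> G * sqrt x" and p2: "\<bar>p2\<bar> \<le> G * sqrt h"
  defines "\<Phi> \<equiv> (x + E) / 2 + S / 4 * q\<^sup>2 - P / 2 * q + (y + \<delta> / 2 * h) / \<delta>"
  shows "p1 - \<delta> * x + (p2 - E - (S * q - P) * q + x) / \<delta>
      \<le> - (L / (L + 2) / \<delta>) * (\<Phi> - absorbing_level G S P L)"
    and "q\<^sup>2 \<le> 8 / S * (\<Phi> + P\<^sup>2 / (2 * S))"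
proof -
  have E: "E \<ge> 0" using h L by (meson mult_nonneg_nonneg order_trans less_imp_le)
  define C where "C = G\<^sup>2 / 2 + G\<^sup>2 / L + P\<^sup>2 / (2 * S)"
  define c where "c = L / (L + 2)"
  have c: "0 < c" "c \<le> 1" "c * (1 / 2 + 1 / L) = 1 / 2"
  proof -
    have "1 / 2 + 1 / L = (L + 2) / (2 * L)" using L by (simp add: field_simps)
    then show "c * (1 / 2 + 1 / L) = 1 / 2" using L by (simp add: c_def)
  qed (use L in \<open>simp_all add: c_def\<close>)
  have hE: "h \<le> E / L" using h L by (simp add: field_simps)
  have y': "\<bar>y\<bar> \<le> x / 2 + h / 2"
    using y young[of 1 "sqrt x" "sqrt h"] x h by simp
  have y\<delta>: "\<bar>y / \<delta>\<bar> \<le> x / 4 + h / 4"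
  proof -
    have "\<bar>y / \<delta>\<bar> = \<bar>y\<bar> / \<delta>" using \<delta> by simp
    also have "\<dots> \<le> \<bar>y\<bar> / 2" using \<delta> by (intro divide_left_mono) auto
    finally show ?thesis using y' by simp
  qed
  have \<Phi>: "\<Phi> = (x + E) / 2 + S / 4 * q\<^sup>2 - P / 2 * q + y / \<delta> + h / 2"
    using \<delta> by (simp add: \<Phi>_def field_simps)
  have upper: "\<Phi> \<le> x + (1 / 2 + 1 / L) * E + S / 4 * q\<^sup>2"
  proof -
    have "\<Phi> \<le> 3 / 4 * x + E / 2 + S / 4 * q\<^sup>2 + 3 / 4 * h"
    proof -
      have "0 \<le> P / 2 * q" using P q by simp
      moreover have "y / \<delta> \<le> x / 4 + h / 4" using y\<delta> by (rule abs_le_D1)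
      moreover have "(x + E) / 2 + r - u + v + h / 2 \<le> 3 / 4 * x + E / 2 + r + 3 / 4 * h"
        if "0 \<le> u" "v \<le> x / 4 + h / 4" for r u v using that by (simp add: field_simps)
      ultimately show ?thesis unfolding \<Phi> by blast
    qed
    also have "\<dots> \<le> x + (1 / 2 + 1 / L) * E + S / 4 * q\<^sup>2"
      using hE x h by (simp add: algebra_simps)
    finally show ?thesis .
  qed
  have Pq: "P * q \<le> S / 2 * q\<^sup>2 + P\<^sup>2 / (2 * S)"
    using young[OF S, of q P] by (simp add: mult.commute)
  have p1': "p1 \<le> \<delta> / 2 * x + G\<^sup>2 / (2 * \<delta>)"
    using p1 young[of \<delta> "sqrt x" G] \<delta> x by (simp add: abs_le_iff mult.commute)
  have p2': "p2 \<le> E / 4 + G\<^sup>2 / L"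
  proof -
    have "p2 \<le> G * sqrt h" using p2 by simp
    also have "\<dots> \<le> (L / 2) * h / 2 + G\<^sup>2 / (2 * (L / 2))"
      using young[of "L / 2" "sqrt h" G] L h by (simp add: mult.commute)
    also have "\<dots> \<le> E / 4 + G\<^sup>2 / L" using h by (simp add: field_simps)
    finally show ?thesis .
  qed
  have "c * \<Phi> \<le> c * (x + (1 / 2 + 1 / L) * E + S / 4 * q\<^sup>2)" using upper c by (intro mult_left_mono) auto
  also have "\<dots> = c * x + (c * (1 / 2 + 1 / L)) * E + c * (S / 4 * q\<^sup>2)" by (simp add: algebra_simps)
  also have "\<dots> \<le> x + E / 2 + S / 4 * q\<^sup>2"
  proof -
    have "c * x \<le> 1 * x" "c * (S / 4 * q\<^sup>2) \<le> 1 * (S / 4 * q\<^sup>2)"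
      using mult_right_mono[OF c(2) x] mult_right_mono[OF c(2), of "S / 4 * q\<^sup>2"] S by simp_all
    then show ?thesis unfolding c(3) by simp
  qed
  finally have c\<Phi>: "c * \<Phi> \<le> x + E / 2 + S / 4 * q\<^sup>2" .
  have \<delta>2: "\<delta>\<^sup>2 \<ge> 4" using power_mono[of 2 \<delta> 2] \<delta> by simp
  have "\<delta> * (p1 - \<delta> * x + (p2 - E - (S * q - P) * q + x) / \<delta>) = \<delta> * p1 - \<delta>\<^sup>2 * x + p2 - E - S * q\<^sup>2 + P * q + x"
    using \<delta> by (simp add: field_simps power2_eq_square)
  also have "\<dots> \<le> (\<delta>\<^sup>2 / 2 * x + G\<^sup>2 / 2) - \<delta>\<^sup>2 * x + (E / 4 + G\<^sup>2 / L) - E - S * q\<^sup>2 + (S / 2 * q\<^sup>2 + P\<^sup>2 / (2 * S)) + x"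
  proof -
    have "\<delta> * p1 \<le> \<delta> * (\<delta> / 2 * x + G\<^sup>2 / (2 * \<delta>))" using p1' \<delta> by (intro mult_left_mono) auto
    also have "\<dots> = \<delta>\<^sup>2 / 2 * x + G\<^sup>2 / 2" using \<delta> by (simp add: field_simps power2_eq_square)
    finally show ?thesis using p2' Pq by linarith
  qed
  also have "\<dots> = C - (\<delta>\<^sup>2 / 2 * x - x) - 3 / 4 * E - S / 2 * q\<^sup>2" by (simp add: C_def algebra_simps)
  also have "\<dots> \<le> C - x - E / 2 - S / 4 * q\<^sup>2"
  proof -
    \<comment> \<open>This is where \<open>\<delta> \<ge> 2\<close> is used: damping beats the kinetic term of the multiplier \<open>u\<close>.\<close>
    have "2 * x \<le> \<delta>\<^sup>2 / 2 * x" using \<delta>2 x by (intro mult_right_mono) auto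
    moreover have "0 \<le> S * q\<^sup>2" using S by simp
    ultimately show ?thesis using E by linarith
  qed
  also have "\<dots> \<le> C - c * \<Phi>" using c\<Phi> by simp
  also have "\<dots> = \<delta> * (- (c / \<delta>) * (\<Phi> - C / c))" using c \<delta> by (simp add: field_simps)
  finally have "p1 - \<delta> * x + (p2 - E - (S * q - P) * q + x) / \<delta> \<le> - (c / \<delta>) * (\<Phi> - C / c)"
    using \<delta> by (simp only: mult_le_cancel_left_pos)
  moreover have "C / c = absorbing_level G S P L" by (simp add: C_def c_def absorbing_level_def)
  ultimately show "p1 - \<delta> * x + (p2 - E - (S * q - P) * q + x) / \<delta>
      \<le> - (L / (L + 2) / \<delta>) * (\<Phi> - absorbing_level G S P L)"
    by (simp add: c_def)
  have "P / 2 * q \<le> S / 8 * q\<^sup>2 + P\<^sup>2 / (2 * S)"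
    using young[of "S / 2" q P] S by (simp add: field_simps)
  moreover have "\<Phi> \<ge> S / 4 * q\<^sup>2 - P / 2 * q"
  proof -
    have "- (y / \<delta>) \<le> x / 4 + h / 4" using y\<delta> by (rule abs_le_D2)
    moreover have "r - v \<le> (x + E) / 2 + r - v + u + h / 2" if "- u \<le> x / 4 + h / 4" for u v r
      using that x E h(1) by (simp add: field_simps)
    ultimately show ?thesis unfolding \<Phi> by blast
  qed
  ultimately have "S / 8 * q\<^sup>2 \<le> \<Phi> + P\<^sup>2 / (2 * S)" by linarith
  then show "q\<^sup>2 \<le> 8 / S * (\<Phi> + P\<^sup>2 / (2 * S))" using S by (simp add: field_simps)
qed

text \<open>The variables are the values at one instant of \<open>x = \<parallel>w\<^sub>t\<parallel>\<^sup>2\<close>, \<open>E = eV w w\<close>, \<open>b = \<parallel>w\<^sub>x\<parallel>\<^sup>2\<close>, \<open>y = (w\<^sub>t, w)\<close>,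
  \<open>h = \<parallel>w\<parallel>\<^sup>2\<close> and \<open>z = (w\<^sub>x\<^sub>x, w\<^sub>t)\<close> for the torsional part \<open>w\<close>, and \<open>a\<close> is the coefficient \<open>\<alpha>\<close>. Through
  the multiplier \<open>w\<^sub>t\<close>, the coefficient feeds at most \<open>A * E / \<delta>\<close> into the energy, and its time
  derivative never appears. The multiplier \<open>w\<close> with the weight \<open>\<delta> / 4\<close> removes \<open>\<delta> / 4 * (1 - P / L) * E\<close>,
  which is twice as much under the assumption on \<open>\<delta>\<close>.\<close>

lemma torsional_dissipation_inequality:
  fixes x E b y h z a A P L \<delta> :: real
  assumes P: "P \<ge> 0" "P < L" and \<delta>: "\<delta> > 0" "8 * A \<le> \<delta>\<^sup>2 * (1 - P / L)"
    and x: "x \<ge> 0" and b: "b \<ge> 0" "L * b \<le> E" and h: "h \<ge> 0" "L * h \<le> E"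
    and y: "\<bar>y\<bar> \<le> sqrt x * sqrt h" and z: "\<bar>z\<bar> \<le> sqrt (2 * E) * sqrt x"
    and a: "- P \<le> a" "a\<^sup>2 \<le> A"
  defines "\<Phi> \<equiv> (x + E) / 2 + \<delta> / 4 * (y + \<delta> / 2 * h)"
  shows "- \<delta> * x + a * z + \<delta> / 4 * (- E - a * b + x) \<le> - (\<delta> / 8 * (1 - P / L) / (1 + \<delta>\<^sup>2 / L)) * \<Phi>"
    and "x + E \<le> 4 * \<Phi>"
proof -
  have L: "L > 0" using P by simp
  have E: "E \<ge> 0" using b L by (meson mult_nonneg_nonneg order_trans less_imp_le)
  have hE: "h \<le> E / L" using h L by (simp add: field_simps)
  have y': "\<delta> / 4 * \<bar>y\<bar> \<le> x / 4 + \<delta>\<^sup>2 / 16 * h"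
  proof -
    have "\<delta> / 4 * \<bar>y\<bar> \<le> \<delta> / 4 * (sqrt x * sqrt h)" using y \<delta> by (intro mult_left_mono) auto
    also have "sqrt x * sqrt h \<le> (2 / \<delta>) * x / 2 + h / (2 * (2 / \<delta>))"
      using young[of "2 / \<delta>" "sqrt x" "sqrt h"] x h \<delta> by simp
    finally have "\<delta> / 4 * \<bar>y\<bar> \<le> \<delta> / 4 * ((2 / \<delta>) * x / 2 + h / (2 * (2 / \<delta>)))" using \<delta> by simp
    also have "\<dots> = x / 4 + \<delta>\<^sup>2 / 16 * h" using \<delta> by (simp add: field_simps power2_eq_square)
    finally show ?thesis .
  qed
  have y2: "- (\<delta> / 4 * \<bar>y\<bar>) \<le> \<delta> / 4 * y" "\<delta> / 4 * y \<le> \<delta> / 4 * \<bar>y\<bar>"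
    using \<delta> by (auto simp: abs_if)
  have \<Phi>: "\<Phi> = (x + E) / 2 + \<delta> / 4 * y + \<delta>\<^sup>2 / 8 * h"
    by (simp add: \<Phi>_def algebra_simps power2_eq_square)
  have \<delta>h: "0 \<le> \<delta>\<^sup>2 * h" using h by simp
  show "x + E \<le> 4 * \<Phi>" unfolding \<Phi> using y' y2 \<delta>h E by (simp add: field_simps)
  have upper: "\<Phi> \<le> (1 + \<delta>\<^sup>2 / L) * (x + E)"
  proof -
    have "\<Phi> \<le> x + E + \<delta>\<^sup>2 * h" unfolding \<Phi> using y' y2 \<delta>h E x by (simp add: field_simps)
    also have "\<delta>\<^sup>2 * h \<le> \<delta>\<^sup>2 * (E / L)" using hE by (intro mult_left_mono) auto
    also have "x + E + \<delta>\<^sup>2 * (E / L) \<le> x + E + \<delta>\<^sup>2 * (E / L) + x * (\<delta>\<^sup>2 / L)" using x L by simp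
    also have "\<dots> = (1 + \<delta>\<^sup>2 / L) * (x + E)" by (simp add: algebra_simps add_divide_distrib)
    finally show ?thesis by simp
  qed
  have az: "a * z \<le> \<delta> / 2 * x + A * E / \<delta>"
  proof -
    have "a * z \<le> sqrt x * (\<bar>a\<bar> * sqrt (2 * E))"
    proof -
      have "a * z \<le> \<bar>a\<bar> * \<bar>z\<bar>" by (simp add: abs_mult[symmetric])
      also have "\<dots> \<le> \<bar>a\<bar> * (sqrt (2 * E) * sqrt x)" using z by (intro mult_left_mono) auto
      finally show ?thesis by (simp add: mult_ac)
    qed
    also have "\<dots> \<le> \<delta> * x / 2 + (\<bar>a\<bar> * sqrt (2 * E))\<^sup>2 / (2 * \<delta>)"
      using young[OF \<delta>(1), of "sqrt x" "\<bar>a\<bar> * sqrt (2 * E)"] x by simp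
    also have "(\<bar>a\<bar> * sqrt (2 * E))\<^sup>2 = 2 * (a\<^sup>2 * E)" using E by (simp add: power_mult_distrib)
    also have "\<dots> \<le> 2 * (A * E)" using a(2) E by (intro mult_left_mono mult_right_mono) auto
    finally show ?thesis using \<delta> by (simp add: field_simps)
  qed
  have ab: "- (a * b) \<le> P / L * E"
  proof -
    have "- (a * b) \<le> P * b" using mult_right_mono[OF a(1) b(1)] by simp
    also have "\<dots> \<le> P * (E / L)" using b L P by (intro mult_left_mono) (auto simp: field_simps)
    finally show ?thesis by simp
  qed
  define \<theta> where "\<theta> = 1 - P / L"
  have \<theta>: "0 < \<theta>" "\<theta> \<le> 1" using P L by (simp_all add: \<theta>_def field_simps)
  have "A * E / \<delta> \<le> \<delta> / 8 * \<theta> * E"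
  proof -
    have "8 * A * E \<le> \<delta>\<^sup>2 * \<theta> * E" using \<delta>(2) E unfolding \<theta>_def by (intro mult_right_mono)
    then show ?thesis using \<delta> by (simp add: field_simps power2_eq_square)
  qed
  moreover have "\<delta> / 4 * (- E - a * b + x) \<le> \<delta> / 4 * (- \<theta> * E + x)"
    using ab \<delta> by (intro mult_left_mono) (auto simp: \<theta>_def algebra_simps)
  ultimately have "- \<delta> * x + a * z + \<delta> / 4 * (- E - a * b + x)
      \<le> - \<delta> * x + (\<delta> / 2 * x + \<delta> / 8 * \<theta> * E) + \<delta> / 4 * (- \<theta> * E + x)"
    using az by linarith
  also have "\<dots> = - (\<delta> / 4 * x) - \<delta> / 8 * \<theta> * E"
    by (simp add: algebra_simps diff_divide_distrib)
  also have "\<dots> \<le> - (\<delta> / 8 * \<theta>) * (x + E)"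
  proof -
    have "\<delta> / 8 * \<theta> * x \<le> \<delta> / 8 * 1 * x" using \<theta> \<delta> x by (intro mult_right_mono mult_left_mono) auto
    also have "\<dots> \<le> \<delta> / 4 * x" using \<delta> x by simp
    finally show ?thesis by (simp add: algebra_simps)
  qed
  also have "\<dots> \<le> - (\<delta> / 8 * \<theta> / (1 + \<delta>\<^sup>2 / L)) * \<Phi>"
  proof -
    have p: "1 + \<delta>\<^sup>2 / L > 0" using L by (simp add: add_pos_nonneg)
    then have "\<Phi> / (1 + \<delta>\<^sup>2 / L) \<le> x + E" using upper by (simp add: pos_divide_le_eq mult.commute)
    then have "\<delta> / 8 * \<theta> * (\<Phi> / (1 + \<delta>\<^sup>2 / L)) \<le> \<delta> / 8 * \<theta> * (x + E)" using \<theta> \<delta> by (intro mult_left_mono) auto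
    then show ?thesis by simp
  qed
  finally show "- \<delta> * x + a * z + \<delta> / 4 * (- E - a * b + x) \<le> - (\<delta> / 8 * (1 - P / L) / (1 + \<delta>\<^sup>2 / L)) * \<Phi>"
    by (simp add: \<theta>_def)
qed

context plate_evolution
begin

lemma basic_bounds:
  assumes t: "t \<ge> 0"
  shows "0 \<le> I (wt t) (wt t)" "0 \<le> bx (w t) (w t)" "0 \<le> I (w t) (w t)" "\<Lambda> * I (w t) (w t) \<le> eV (w t) (w t)"
    "\<bar>I (wt t) (w t)\<bar> \<le> sqrt (I (wt t) (wt t)) * sqrt (I (w t) (w t))"
    "\<bar>I (xx t) (wt t)\<bar> \<le> sqrt (2 * eV (w t) (w t)) * sqrt (I (wt t) (wt t))"
proof -
  show "\<Lambda> * I (w t) (w t) \<le> eV (w t) (w t)" by (rule lambda1_le[OF wV[OF t]])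
  show "\<bar>I (wt t) (w t)\<bar> \<le> sqrt (I (wt t) (wt t)) * sqrt (I (w t) (w t))"
    using CS_L2[OF wtL2[OF t] wL2[OF t]] by (simp add: L2_norm_def)
  have "I (xx t) (xx t) \<le> 2 * eV (w t) (w t)"
    using weak_xx_bound[OF wV[OF t]] V.nonneg[OF wV[OF t]] by simp
  then have "L2_norm \<Omega> (xx t) \<le> sqrt (2 * eV (w t) (w t))" unfolding L2_norm_def by (rule real_sqrt_le_mono)
  then have "L2_norm \<Omega> (xx t) * L2_norm \<Omega> (wt t) \<le> sqrt (2 * eV (w t) (w t)) * L2_norm \<Omega> (wt t)"
    by (intro mult_right_mono) (simp_all add: L2_norm_def I_nonneg)
  with CS_L2[OF xxL2[OF t] wtL2[OF t]]
  show "\<bar>I (xx t) (wt t)\<bar> \<le> sqrt (2 * eV (w t) (w t)) * sqrt (I (wt t) (wt t))"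
    by (simp add: L2_norm_def)
qed (auto intro: I_nonneg)

text \<open>The bound involves neither \<open>\<delta>\<close> nor the plate, except through the first eigenvalue, so that the
  threshold for \<open>\<delta>\<close> may be chosen in terms of it.\<close>

lemma eventually_stretch_bounded:
  assumes S: "S > 0" and P: "P \<ge> 0" and \<delta>: "\<delta> \<ge> 2"
    and nonlinear: "\<And>t. t \<ge> 0 \<Longrightarrow> \<alpha> t = S * bx (w t) (w t) - P"
    and G: "\<forall>\<^sub>F t in at_top. L2_norm \<Omega> (\<gamma> t) \<le> G"
  shows "\<forall>\<^sub>F t in at_top. (\<alpha> t)\<^sup>2 \<le> stretch_bound G S P \<Lambda>"
proof -
  from G obtain T0 where T0: "\<And>t. t \<ge> T0 \<Longrightarrow> L2_norm \<Omega> (\<gamma> t) \<le> G" by (auto simp: eventually_at_top_linorder)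
  define T where "T = max T0 1"
  define k where "k = \<Lambda> / (\<Lambda> + 2) / \<delta>"
  define M where "M = absorbing_level G S P \<Lambda>"
  have k: "k > 0" using \<Lambda>_pos \<delta> by (simp add: k_def)
  let ?x = "\<lambda>t. I (wt t) (wt t)" and ?E = "\<lambda>t. eV (w t) (w t)" and ?q = "\<lambda>t. bx (w t) (w t)"
  let ?y = "\<lambda>t. I (wt t) (w t)" and ?h = "\<lambda>t. I (w t) (w t)"
  let ?p1 = "\<lambda>t. I (\<gamma> t) (wt t)" and ?p2 = "\<lambda>t. I (\<gamma> t) (w t)"
  define \<Phi> where "\<Phi> t = (?x t + ?E t) / 2 + S / 4 * (?q t)\<^sup>2 - P / 2 * ?q t + (?y t + \<delta> / 2 * ?h t) / \<delta>" for t
  let ?\<Phi>' = "\<lambda>t. ?p1 t - \<delta> * ?x t + (?p2 t - ?E t - (S * ?q t - P) * ?q t + ?x t) / \<delta>"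
  have deriv: "(\<Phi> has_real_derivative ?\<Phi>' t) (at t)" if t: "t \<ge> T" for t
  proof -
    have t0: "t > 0" "t \<ge> 0" using t by (auto simp: T_def)
    note d = DERIV_add[OF DERIV_diff[OF DERIV_add[OF DERIV_cdivide[OF deriv_energy[OF t0(1)], of 2]
        DERIV_cmult[OF DERIV_power[OF deriv_bx[OF t0(1)], of 2], of "S / 4"]]
        DERIV_cmult[OF deriv_bx[OF t0(1)], of "P / 2"]]
        DERIV_cdivide[OF DERIV_add[OF deriv_cross[OF t0(1)] DERIV_cmult[OF deriv_L2[OF t0(1)], of "\<delta> / 2"]], of \<delta>]]
    show ?thesis unfolding \<Phi>_def
      by (rule DERIV_cong[OF d]) (use \<delta> in \<open>simp add: nonlinear[OF t0(2)] field_simps power2_eq_square\<close>)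
  qed
  have ineq: "?\<Phi>' t \<le> - k * (\<Phi> t - M)" "(?q t)\<^sup>2 \<le> 8 / S * (\<Phi> t + P\<^sup>2 / (2 * S))" if t: "t \<ge> T" for t
  proof -
    have t0: "t \<ge> 0" using t by (auto simp: T_def)
    have \<gamma>G: "L2_norm \<Omega> (\<gamma> t) \<le> G" using t by (intro T0) (simp add: T_def)
    have g: "\<bar>I (\<gamma> t) f\<bar> \<le> G * sqrt (I f f)" if "f \<in> L2" for f
    proof -
      have "\<bar>I (\<gamma> t) f\<bar> \<le> L2_norm \<Omega> (\<gamma> t) * sqrt (I f f)"
        using CS_L2[OF \<gamma>L2[OF t0] that] by (simp add: L2_norm_def)
      also have "\<dots> \<le> G * sqrt (I f f)" using \<gamma>G by (intro mult_right_mono) (simp_all add: I_nonneg)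
      finally show ?thesis .
    qed
    note ineqs = energy_dissipation_inequality[OF S P \<Lambda>_pos \<delta> basic_bounds(1-5)[OF t0] g[OF wtL2[OF t0]] g[OF wL2[OF t0]]]
    show "?\<Phi>' t \<le> - k * (\<Phi> t - M)" using ineqs(1) unfolding \<Phi>_def k_def M_def .
    show "(?q t)\<^sup>2 \<le> 8 / S * (\<Phi> t + P\<^sup>2 / (2 * S))" using ineqs(2) unfolding \<Phi>_def .
  qed
  have bound: "\<Phi> t - M \<le> (\<Phi> T - M) * exp (- k * (t - T))" if "t \<ge> T" for t
    by (rule exponential_bound[OF deriv ineq(1) that])
  have "\<forall>\<^sub>F t in at_top. (\<Phi> T - M) * exp (- k * (t - T)) < 1"
    using exp_decay_tendsto[OF k] by (rule order_tendstoD) simp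
  then show ?thesis
    using eventually_ge_at_top[of T]
  proof eventually_elim
    case (elim t)
    have "\<Phi> t \<le> M + 1" using bound[OF elim(2)] elim(1) by simp
    have "(?q t)\<^sup>2 \<le> 8 / S * (\<Phi> t + P\<^sup>2 / (2 * S))" by (rule ineq(2)[OF elim(2)])
    also have "\<dots> \<le> 8 / S * (M + 1 + P\<^sup>2 / (2 * S))" using \<open>\<Phi> t \<le> M + 1\<close> S by (intro mult_left_mono) auto
    finally have q: "(?q t)\<^sup>2 \<le> 8 / S * (M + 1 + P\<^sup>2 / (2 * S))" .
    have "(\<alpha> t)\<^sup>2 = (S * ?q t - P)\<^sup>2" using elim(2) by (simp add: nonlinear T_def)
    also have "\<dots> \<le> 2 * (S * ?q t)\<^sup>2 + 2 * P\<^sup>2"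
      using zero_le_power2[of "S * ?q t + P"] by (simp add: power2_eq_square algebra_simps)
    also have "\<dots> = 2 * S\<^sup>2 * (?q t)\<^sup>2 + 2 * P\<^sup>2" by (simp add: power_mult_distrib)
    also have "\<dots> \<le> stretch_bound G S P \<Lambda>"
      unfolding stretch_bound_def M_def[symmetric] using q by (intro add_right_mono mult_left_mono) auto
    finally show ?case .
  qed
qed

text \<open>The Lyapunov function \<open>\<Phi>\<close> decays at the rate \<open>2 * \<eta>\<close> from some time on; half of the rate is spent on
  the factor \<open>exp (\<eta> * t)\<close>.\<close>

lemma torsional_decay:
  assumes P: "P \<ge> 0" "P < \<Lambda>" and l: "l < pi" and \<delta>: "\<delta> > 0" "8 * A \<le> \<delta>\<^sup>2 * (1 - P / \<Lambda>)"
    and \<gamma>0: "\<And>t. \<gamma> t = (\<lambda>_. 0)" and odd: "\<And>t. t \<ge> 0 \<Longrightarrow> torsional (w t) = w t"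
    and \<alpha>_lower: "\<And>t. t \<ge> 0 \<Longrightarrow> - P \<le> \<alpha> t" and \<alpha>_upper: "\<forall>\<^sub>F t in at_top. (\<alpha> t)\<^sup>2 \<le> A"
    and \<eta>: "\<eta> = \<delta> / 16 * (1 - P / \<Lambda>) / (1 + \<delta>\<^sup>2 / \<Lambda>)"
  shows "((\<lambda>t. exp (\<eta> * t) * (I (wt t) (wt t) + eV (w t) (w t))) \<longlongrightarrow> 0) at_top"
proof -
  from \<alpha>_upper obtain T0 where T0: "\<And>t. t \<ge> T0 \<Longrightarrow> (\<alpha> t)\<^sup>2 \<le> A" by (auto simp: eventually_at_top_linorder)
  define T where "T = max T0 1"
  have p: "0 < 1 + \<delta>\<^sup>2 / \<Lambda>" using \<Lambda>_pos by (simp add: add_pos_nonneg)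
  have "0 < 1 - P / \<Lambda>" using P \<Lambda>_pos by simp
  then have \<eta>_pos: "\<eta> > 0" unfolding \<eta> using \<delta> p by (intro divide_pos_pos mult_pos_pos) auto
  let ?x = "\<lambda>t. I (wt t) (wt t)" and ?E = "\<lambda>t. eV (w t) (w t)" and ?b = "\<lambda>t. bx (w t) (w t)"
  let ?y = "\<lambda>t. I (wt t) (w t)" and ?h = "\<lambda>t. I (w t) (w t)" and ?z = "\<lambda>t. I (xx t) (wt t)"
  define \<Phi> where "\<Phi> t = (?x t + ?E t) / 2 + \<delta> / 4 * (?y t + \<delta> / 2 * ?h t)" for t
  let ?\<Phi>' = "\<lambda>t. - \<delta> * ?x t + \<alpha> t * ?z t + \<delta> / 4 * (- ?E t - \<alpha> t * ?b t + ?x t)"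
  have \<gamma>I: "I (\<gamma> t) f = 0" for t f by (simp add: \<gamma>0 L2_inner_def)
  have deriv: "(\<Phi> has_real_derivative ?\<Phi>' t) (at t)" if t: "t \<ge> T" for t
  proof -
    have t0: "t > 0" using t by (auto simp: T_def)
    note d = DERIV_add[OF DERIV_cdivide[OF deriv_energy[OF t0], of 2]
        DERIV_cmult[OF DERIV_add[OF deriv_cross[OF t0] DERIV_cmult[OF deriv_L2[OF t0], of "\<delta> / 2"]], of "\<delta> / 4"]]
    show ?thesis unfolding \<Phi>_def by (rule DERIV_cong[OF d]) (simp add: \<gamma>I field_simps)
  qed
  have ineq: "?\<Phi>' t \<le> - (2 * \<eta>) * (\<Phi> t - 0)" "?x t + ?E t \<le> 4 * \<Phi> t" if t: "t \<ge> T" for t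
  proof -
    have t0: "t \<ge> 0" using t by (auto simp: T_def)
    have A: "(\<alpha> t)\<^sup>2 \<le> A" using t by (intro T0) (simp add: T_def)
    have b: "\<Lambda> * ?b t \<le> ?E t" by (rule torsional_coercivity[OF wV[OF t0] odd[OF t0] \<Lambda>_pos l])
    note ineqs = torsional_dissipation_inequality[OF P \<delta> basic_bounds(1,2)[OF t0] b basic_bounds(3-6)[OF t0] \<alpha>_lower[OF t0] A]
    have e: "2 * \<eta> = \<delta> / 8 * (1 - P / \<Lambda>) / (1 + \<delta>\<^sup>2 / \<Lambda>)"
    proof -
      have "2 * (a / 16 * b / c) = a / 8 * b / c" for a b c :: real by simp
      then show ?thesis unfolding \<eta> .
    qed
    show "?\<Phi>' t \<le> - (2 * \<eta>) * (\<Phi> t - 0)" using ineqs(1) unfolding \<Phi>_def e by simp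
    show "?x t + ?E t \<le> 4 * \<Phi> t" using ineqs(2) unfolding \<Phi>_def .
  qed
  have bound: "\<Phi> t \<le> \<Phi> T * exp (- (2 * \<eta>) * (t - T))" if "t \<ge> T" for t
    using exponential_bound[OF deriv ineq(1) that] by simp
  show ?thesis
  proof (rule Lim_null_comparison)
    show "((\<lambda>t. (4 * \<Phi> T * exp (\<eta> * T)) * exp (- \<eta> * (t - T))) \<longlongrightarrow> 0) at_top"
      by (rule exp_decay_tendsto[OF \<eta>_pos])
    show "\<forall>\<^sub>F t in at_top. norm (exp (\<eta> * t) * (?x t + ?E t)) \<le> (4 * \<Phi> T * exp (\<eta> * T)) * exp (- \<eta> * (t - T))"
      using eventually_ge_at_top[of T]
    proof eventually_elim
      case (elim t)
      have t0: "t \<ge> 0" using elim by (auto simp: T_def)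
      have nn: "0 \<le> ?x t + ?E t" using I_nonneg V.nonneg[OF wV[OF t0]] by (intro add_nonneg_nonneg)
      have "exp (\<eta> * t) * (?x t + ?E t) \<le> exp (\<eta> * t) * (4 * (\<Phi> T * exp (- (2 * \<eta>) * (t - T))))"
        using ineq(2)[OF elim] bound[OF elim] by (intro mult_left_mono) auto
      also have "\<dots> = (4 * \<Phi> T) * (exp (\<eta> * t) * exp (- (2 * \<eta>) * (t - T)))" by simp
      also have "exp (\<eta> * t) * exp (- (2 * \<eta>) * (t - T)) = exp (\<eta> * T) * exp (- \<eta> * (t - T))"
        by (simp add: mult_exp_exp algebra_simps)
      finally show ?case using nn by (simp add: mult.assoc)
    qed
  qed
qed

end

section \<open>Weak solutions\<close>

context plate_width
begin

text \<open>The supremum \<open>dual_norm\<close> is meaningful only for bounded functionals. On elements of norm zero a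
  bounded functional vanishes, and all others can be normalized.\<close>

lemma dual_bound:
  assumes \<psi>: "\<psi> \<in> H2_star_dual l" and v: "v \<in> V"
  shows "\<bar>\<psi> v\<bar> \<le> dual_norm l \<psi> * H2_star_norm l v"
proof -
  let ?N = "H2_star_norm l"
  from \<psi> obtain C where lin: "\<And>v w a b. v \<in> V \<Longrightarrow> w \<in> V \<Longrightarrow> \<psi> (\<lambda>z. a * v z + b * w z) = a * \<psi> v + b * \<psi> w"
    and C: "\<And>v. v \<in> V \<Longrightarrow> \<bar>\<psi> v\<bar> \<le> C * ?N v" unfolding H2_star_dual_def by blast
  have N: "0 \<le> ?N v" using V.N_nonneg[OF v] by (simp add: V_N)
  show ?thesis
  proof (cases "?N v = 0")
    case True
    then show ?thesis using C[OF v] by simp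
  next
    case False
    then have p: "?N v > 0" using N by simp
    \<comment> \<open>Written as a linear combination, to which the closure of \<open>V\<close> and the linearity apply.\<close>
    let ?v = "\<lambda>z. inverse (?N v) * v z + 0 * v z"
    have V: "?v \<in> V" by (rule V_lin[OF v v])
    have "eV ?v ?v = inverse (?N v) * eV ?v v" using V.lin_left[OF v v V, of "inverse (?N v)" 0] V.sym[OF v V] by simp
    also have "eV ?v v = inverse (?N v) * eV v v" using V.lin_left[OF v v v, of "inverse (?N v)" 0] by simp
    also have "inverse (?N v) * (inverse (?N v) * eV v v) = 1"
      using p unfolding V_norm_square[OF v, symmetric] by (simp add: power2_eq_square mult.assoc[symmetric])
    finally have 1: "?N ?v = 1" by (simp add: H2_star_norm_def)
    have "\<bar>\<psi> ?v\<bar> \<le> dual_norm l \<psi>"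
      unfolding dual_norm_def
    proof (rule cSUP_upper)
      show "?v \<in> {v \<in> V. ?N v \<le> 1}" using V 1 by simp
      show "bdd_above ((\<lambda>v. \<bar>\<psi> v\<bar>) ` {v \<in> V. ?N v \<le> 1})"
      proof (rule bdd_aboveI2)
        fix v assume v: "v \<in> {v \<in> V. ?N v \<le> 1}"
        have "\<bar>\<psi> v\<bar> \<le> C * ?N v" using v C by simp
        also have "\<dots> \<le> \<bar>C\<bar> * ?N v" using v V.N_nonneg[of v] by (intro mult_right_mono) (auto simp: V_N)
        also have "\<dots> \<le> \<bar>C\<bar> * 1" using v by (intro mult_left_mono) auto
        finally show "\<bar>\<psi> v\<bar> \<le> \<bar>C\<bar> * 1" .
      qed
    qed
    also have "\<psi> ?v = inverse (?N v) * \<psi> v" using lin[OF v v, of "inverse (?N v)" 0] by simp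
    finally show ?thesis using p by (simp add: abs_mult field_simps)
  qed
qed

text \<open>Differentiability in the dual norm yields differentiability after pairing with a fixed \<open>v\<close>, since the
  difference quotients belong to the dual: \<open>L\<^sup>2\<close> functions do because the first eigenvalue is
  positive.\<close>

lemma weak_solution_derivative:
  assumes \<Lambda>: "0 < \<Lambda>" and sol: "weak_solution l \<delta> S P g u ut" and t: "t > 0" and v: "v \<in> V"
  shows "((\<lambda>s. I (ut s) v) has_real_derivative
     I (g t) v - \<delta> * I (ut t) v - eV (u t) v - (S * bx (u t) (u t) - P) * bx (u t) v) (at t)"
proof -
  obtain utt where d: "has_time_deriv (dual_norm l) (\<lambda>t. I (ut t)) utt"
    and c: "C0_curve (H2_star_dual l) (dual_norm l) utt"
    and eq: "\<forall>t\<ge>0. \<forall>v \<in> V. utt t v + \<delta> * I (ut t) v + eV (u t) v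
           + (S * (L2_norm \<Omega> (weak_x l (u t)))\<^sup>2 - P) * bx (u t) v = I (g t) v"
    and ut: "C0_curve L2 (L2_norm \<Omega>) ut"
    using sol unfolding weak_solution_def by blast
  have utL2: "ut s \<in> L2" if "s \<ge> 0" for s using ut that by (auto simp: C0_curve_def)
  let ?\<chi> = "\<lambda>s v. (I (ut s) v - I (ut t) v) / (s - t) - utt t v"
  have "utt t \<in> H2_star_dual l" using c t by (auto simp: C0_curve_def)
  then obtain C where lin: "\<And>v w a b. v \<in> V \<Longrightarrow> w \<in> V \<Longrightarrow> utt t (\<lambda>z. a * v z + b * w z) = a * utt t v + b * utt t w"
    and C: "\<And>v. v \<in> V \<Longrightarrow> \<bar>utt t v\<bar> \<le> C * H2_star_norm l v" unfolding H2_star_dual_def by blast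
  have dual: "?\<chi> s \<in> H2_star_dual l" if s: "s \<ge> 0" for s
    unfolding H2_star_dual_def
  proof (intro CollectI conjI ballI allI)
    fix v w a b assume vw: "v \<in> V" "w \<in> V"
    have I: "I (ut r) (\<lambda>z. a * v z + b * w z) = a * I (ut r) v + b * I (ut r) w" if "r \<ge> 0" for r
      using I_lin_left[OF V_L2[OF vw(1)] V_L2[OF vw(2)] utL2[OF that], of a b] by (simp add: I_sym[of "ut r"])
    have "((a * x + b * y) - (a * x' + b * y')) / h - (a * p + b * q) = a * ((x - x') / h - p) + b * ((y - y') / h - q)"
      for x y x' y' h p q :: real by (simp add: diff_divide_distrib add_divide_distrib algebra_simps)
    then show "?\<chi> s (\<lambda>z. a * v z + b * w z) = a * ?\<chi> s v + b * ?\<chi> s w"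
      using s t by (simp only: I lin[OF vw] less_imp_le)
  next
    let ?D = "\<lambda>z. ut s z - ut t z"
    have D: "?D \<in> L2" using utL2[OF s] utL2[of t] t by (intro L2.diff) auto
    show "\<exists>C. \<forall>v\<in>V. \<bar>?\<chi> s v\<bar> \<le> C * H2_star_norm l v"
    proof (intro exI ballI)
      fix v assume v: "v \<in> V"
      have "\<bar>I ?D v\<bar> \<le> L2_norm \<Omega> ?D * L2_norm \<Omega> v" using L2.Cauchy_Schwarz[OF D V_L2[OF v]] by (simp add: L2_N)
      also have "\<dots> \<le> L2_norm \<Omega> ?D * (sqrt (1 / \<Lambda>) * H2_star_norm l v)"
        using L2_norm_le_V[OF \<Lambda> v] by (intro mult_left_mono) (simp_all add: L2_norm_def I_nonneg)
      finally have "\<bar>I (ut s) v - I (ut t) v\<bar> \<le> L2_norm \<Omega> ?D * (sqrt (1 / \<Lambda>) * H2_star_norm l v)"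
        using L2.diff_left[OF utL2[OF s] utL2 V_L2[OF v], of t] t by simp
      then have "\<bar>I (ut s) v - I (ut t) v\<bar> / \<bar>s - t\<bar> \<le> L2_norm \<Omega> ?D * (sqrt (1 / \<Lambda>) * H2_star_norm l v) / \<bar>s - t\<bar>"
        by (intro divide_right_mono) auto
      moreover have "\<bar>?\<chi> s v\<bar> \<le> \<bar>I (ut s) v - I (ut t) v\<bar> / \<bar>s - t\<bar> + \<bar>utt t v\<bar>"
        by (metis abs_divide abs_triangle_ineq4)
      ultimately show "\<bar>?\<chi> s v\<bar> \<le> (L2_norm \<Omega> ?D * sqrt (1 / \<Lambda>) / \<bar>s - t\<bar> + C) * H2_star_norm l v"
        using C[OF v] by (simp add: algebra_simps)
    qed
  qed
  have at: "at t within {0..} = at t"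
    using t by (intro at_within_interior) (auto simp: interior_Ici)
  have "((\<lambda>s. dual_norm l (?\<chi> s)) \<longlongrightarrow> 0) (at t)"
    using d t at by (auto simp: has_time_deriv_def dest!: spec[of _ t])
  then have "((\<lambda>s. dual_norm l (?\<chi> s) * H2_star_norm l v) \<longlongrightarrow> 0 * H2_star_norm l v) (at t)" by (intro tendsto_intros)
  then have "((\<lambda>s. dual_norm l (?\<chi> s) * H2_star_norm l v) \<longlongrightarrow> 0) (at t)" by simp
  moreover have "\<forall>\<^sub>F s in at t. s \<ge> 0"
    using t by (intro eventually_at_topological[THEN iffD2] exI[of _ "{0<..}"]) auto
  then have "\<forall>\<^sub>F s in at t. norm (?\<chi> s v) \<le> dual_norm l (?\<chi> s) * H2_star_norm l v"
    by eventually_elim (use dual_bound[OF dual v] in simp)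
  ultimately have "((\<lambda>s. ?\<chi> s v) \<longlongrightarrow> 0) (at t)"
    by (rule Lim_null_comparison[rotated])
  then have "((\<lambda>s. I (ut s) v) has_real_derivative utt t v) (at t)"
    by (simp add: has_field_derivative_iff LIM_zero_iff)
  moreover have "utt t v = I (g t) v - \<delta> * I (ut t) v - eV (u t) v - (S * bx (u t) (u t) - P) * bx (u t) v"
    using eq[rule_format, of t v] t v by (simp add: L2_norm_square)
  ultimately show ?thesis by simp
qed

lemma torsional_diff: "torsional (\<lambda>z. f z - g z) = (\<lambda>z. torsional f z - torsional g z)"
  by (auto simp: torsional_rho fun_eq_iff field_simps)

lemma L2_norm_torsional: 
  assumes f: "f \<in> L2" shows "L2_norm \<Omega> (torsional f) \<le> L2_norm \<Omega> f"
proof -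
  have T: "torsional f \<in> L2" by (rule L2_torsional[OF f])
  have "(L2.N (torsional f))\<^sup>2 = I f (torsional f)"
    using I_torsional[OF f T] by (simp add: L2.N_square[OF T] torsional_torsional)
  also have "\<dots> \<le> L2.N f * L2.N (torsional f)" using L2.Cauchy_Schwarz[OF f T] by simp
  finally have "L2.N (torsional f) \<le> L2.N f"
    using L2.N_nonneg[OF T] L2.N_nonneg[OF f] by (cases "L2.N (torsional f) = 0") (auto simp: power2_eq_square)
  then show ?thesis by (simp add: L2_N)
qed

lemma V_norm_torsional: 
  assumes f: "f \<in> V" shows "H2_star_norm l (torsional f) \<le> H2_star_norm l f"
proof -
  have T: "torsional f \<in> V" by (rule V_torsional[OF f])
  have "(V.N (torsional f))\<^sup>2 = eV f (torsional f)"
    using eV_torsional[OF f T] by (simp add: V.N_square[OF T] torsional_torsional)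
  also have "\<dots> \<le> V.N f * V.N (torsional f)" using V.Cauchy_Schwarz[OF f T] by simp
  finally have "V.N (torsional f) \<le> V.N f"
    using V.N_nonneg[OF T] V.N_nonneg[OF f] by (cases "V.N (torsional f) = 0") (auto simp: power2_eq_square)
  then show ?thesis by (simp add: V_N)
qed

text \<open>The projection \<open>torsional\<close> is symmetric for all forms involved. Testing the equation with
  \<open>torsional v\<close> therefore gives the equation of the torsional part, with the coefficient \<open>\<alpha>\<close> of the full
  solution and, as \<open>g\<close> is even, without forcing.\<close>

lemma weak_solution_torsional_decay:
  assumes sol: "weak_solution l \<delta> S P g u ut"
    and g: "C0_curve L2 (L2_norm \<Omega>) g" and even: "\<And>t. t \<ge> 0 \<Longrightarrow> even_in_y l (g t)"
    and G: "\<forall>\<^sub>F t in at_top. L2_norm \<Omega> (g t) \<le> G"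
    and S: "0 < S" and P: "0 \<le> P" "P < \<Lambda>" and l: "l < pi"
    and \<delta>: "2 \<le> \<delta>" "8 * stretch_bound G S P \<Lambda> \<le> \<delta>\<^sup>2 * (1 - P / \<Lambda>)"
    and \<eta>: "\<eta> = \<delta> / 16 * (1 - P / \<Lambda>) / (1 + \<delta>\<^sup>2 / \<Lambda>)"
  shows "((\<lambda>t. exp (\<eta> * t) * ((L2_norm \<Omega> (torsional (ut t)))\<^sup>2 + (H2_star_norm l (torsional (u t)))\<^sup>2)) \<longlongrightarrow> 0) at_top"
proof -
  have \<Lambda>: "0 < \<Lambda>" using P by simp
  have u: "C0_curve V (H2_star_norm l) u" and ut: "C0_curve L2 (L2_norm \<Omega>) ut"
    and u_ut: "has_time_deriv (L2_norm \<Omega>) u ut"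
    using sol unfolding weak_solution_def by auto
  have uV: "u t \<in> V" and utL2: "ut t \<in> L2" and gL2: "g t \<in> L2" if "t \<ge> 0" for t
    using u ut g that by (auto simp: C0_curve_def)
  define \<alpha> where "\<alpha> t = S * bx (u t) (u t) - P" for t
  have \<alpha>_cont: "continuous_on {0..} \<alpha>"
    unfolding \<alpha>_def by (intro continuous_intros continuous_bx \<Lambda> u)
  interpret full: plate_evolution l \<delta> \<alpha> u ut g
    using weak_solution_derivative[OF \<Lambda> sol]
    by unfold_locales (use \<Lambda> u ut u_ut g \<alpha>_cont in \<open>simp_all add: \<alpha>_def\<close>)
  let ?w = "\<lambda>t. torsional (u t)" and ?wt = "\<lambda>t. torsional (ut t)"
  have w: "C0_curve V (H2_star_norm l) ?w"
  proof (rule C0_curve_bound[OF u, where K = 1])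
    show "H2_star_norm l (\<lambda>z. ?w s z - ?w t z) \<le> 1 * H2_star_norm l (\<lambda>z. u s z - u t z)" if "s \<ge> 0" "t \<ge> 0" for s t
      using V_norm_torsional[OF V.diff[OF uV[OF that(1)] uV[OF that(2)]]] by (simp add: torsional_diff)
    show "0 \<le> H2_star_norm l (\<lambda>z. ?w s z - ?w t z)" if "s \<ge> 0" "t \<ge> 0" for s t
      using V.N_nonneg[OF V.diff[OF V_torsional[OF uV[OF that(1)]] V_torsional[OF uV[OF that(2)]]]] by (simp add: V_N)
  qed (intro V_torsional uV)
  have wt: "C0_curve L2 (L2_norm \<Omega>) ?wt"
  proof (rule C0_curve_bound[OF ut, where K = 1])
    show "L2_norm \<Omega> (\<lambda>z. ?wt s z - ?wt t z) \<le> 1 * L2_norm \<Omega> (\<lambda>z. ut s z - ut t z)" if "s \<ge> 0" "t \<ge> 0" for s t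
      using L2_norm_torsional[OF L2.diff[OF utL2[OF that(1)] utL2[OF that(2)]]] by (simp add: torsional_diff)
  qed (auto intro: L2_torsional utL2 simp: L2_norm_def I_nonneg)
  have w_wt: "has_time_deriv (L2_norm \<Omega>) ?w ?wt"
    unfolding has_time_deriv_def
  proof (intro allI impI)
    fix t :: real assume t: "t \<ge> 0"
    let ?q = "\<lambda>s z. (u s z - u t z) / (s - t) - ut t z"
    have ev: "\<forall>\<^sub>F s in at t within {0..}. s \<ge> 0" by (auto simp: eventually_at_filter intro!: always_eventually)
    have T: "(\<lambda>z. (?w s z - ?w t z) / (s - t) - ?wt t z) = torsional (?q s)" for s
    proof -
      have "((p - p') / 2 - (q - q') / 2) / c - (r - r') / 2 = ((p - q) / c - r - ((p' - q') / c - r')) / 2"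
        for p p' q q' r r' c :: real by (simp add: diff_divide_distrib)
      then show ?thesis by (simp only: torsional_rho)
    qed
    have q: "?q s \<in> L2" if "s \<ge> 0" for s
      using L2.diff[OF L2_lin[OF V_L2[OF uV[OF that]] V_L2[OF uV[OF t]], of "inverse (s - t)" "- inverse (s - t)"] utL2[OF t]]
      by (simp add: divide_inverse algebra_simps)
    show "((\<lambda>s. L2_norm \<Omega> (\<lambda>z. (?w s z - ?w t z) / (s - t) - ?wt t z)) \<longlongrightarrow> 0) (at t within {0..})"
      unfolding T
    proof (rule Lim_null_comparison)
      show "((\<lambda>s. L2_norm \<Omega> (?q s)) \<longlongrightarrow> 0) (at t within {0..})" using u_ut t by (auto simp: has_time_deriv_def)
      show "\<forall>\<^sub>F s in at t within {0..}. norm (L2_norm \<Omega> (torsional (?q s))) \<le> L2_norm \<Omega> (?q s)"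
        using ev
      proof eventually_elim
        case (elim s)
        have "0 \<le> L2_norm \<Omega> (torsional (?q s))" by (simp add: L2_norm_def I_nonneg)
        then show ?case using L2_norm_torsional[OF q[OF elim]] by simp
      qed
    qed
  qed
  have zero: "(\<lambda>_. 0) \<in> L2" by (intro L2_smooth smooth_const)
  have g0: "I (g t) (torsional v) = 0" if t: "t \<ge> 0" and v: "v \<in> L2" for t v
  proof -
    have "AE z in lebesgue_on \<Omega>. torsional (g t) z = 0"
      using even[OF t] unfolding even_in_y_def by (rule eventually_mono) (auto simp: torsional_def)
    then have "I (torsional (g t)) v = I (\<lambda>_. 0) v" by (intro I_cong_AE L2_torsional gL2 t zero v)
    then show ?thesis using I_torsional[OF gL2[OF t] v] by (simp add: L2_inner_def)
  qed
  interpret tors: plate_evolution l \<delta> \<alpha> ?w ?wt "\<lambda>_ _. 0"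
  proof unfold_locales
    show "C0_curve L2 (L2_norm \<Omega>) (\<lambda>_ _. 0)"
      using zero by (simp add: C0_curve_def L2_norm_def L2_inner_def)
    fix t :: real and v assume t: "t > 0" and v: "v \<in> V"
    have t0: "t \<ge> 0" using t by simp
    have 1: "((\<lambda>s. I (ut s) (torsional v)) has_real_derivative
       I (g t) (torsional v) - \<delta> * I (ut t) (torsional v) - eV (u t) (torsional v) - \<alpha> t * bx (u t) (torsional v)) (at t)"
      using full.evolution[OF t V_torsional[OF v]] .
    have "((\<lambda>s. I (?wt s) v) has_real_derivative
       I (g t) (torsional v) - \<delta> * I (ut t) (torsional v) - eV (u t) (torsional v) - \<alpha> t * bx (u t) (torsional v)) (at t)"
      by (rule has_field_derivative_transform_within_open[OF 1, of "{0<..}"])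
        (use t v in \<open>auto simp: I_torsional utL2 V_L2\<close>)
    then show "((\<lambda>s. I (?wt s) v) has_real_derivative
       I (\<lambda>_. 0) v - \<delta> * I (?wt t) v - eV (?w t) v - \<alpha> t * bx (?w t) v) (at t)"
      using g0[OF t0 V_L2[OF v]] uV[OF t0] utL2[OF t0] v
      by (simp add: I_torsional eV_torsional bx_torsional V_L2 L2_inner_def[of _ "\<lambda>_. 0"])
  qed (use \<Lambda> w wt w_wt \<alpha>_cont in auto)
  have upper: "\<forall>\<^sub>F t in at_top. (\<alpha> t)\<^sup>2 \<le> stretch_bound G S P \<Lambda>"
    by (rule full.eventually_stretch_bounded[OF S P(1) \<delta>(1) _ G]) (simp add: \<alpha>_def)
  have "((\<lambda>t. exp (\<eta> * t) * (I (?wt t) (?wt t) + eV (?w t) (?w t))) \<longlongrightarrow> 0) at_top"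
  proof (rule tors.torsional_decay[OF P l _ \<delta>(2) refl torsional_torsional _ upper \<eta>])
    show "- P \<le> \<alpha> t" for t using S I_nonneg by (simp add: \<alpha>_def)
  qed (use \<delta> in auto)
  then show ?thesis
  proof (rule Lim_transform_eventually)
    show "\<forall>\<^sub>F t in at_top. exp (\<eta> * t) * (I (?wt t) (?wt t) + eV (?w t) (?w t))
      = exp (\<eta> * t) * ((L2_norm \<Omega> (?wt t))\<^sup>2 + (H2_star_norm l (?w t))\<^sup>2)"
      using eventually_ge_at_top[of 0]
      by eventually_elim (simp add: L2_norm_square V_norm_square V_torsional uV)
  qed
qed

end

text \<open>The forcing is eventually bounded by \<open>G + 1\<close> when its limit superior is \<open>G\<close>. The absolute value
  matters only for parameters that are excluded in the theorem; it keeps the threshold positive.\<close>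

definition damping_threshold :: "real \<Rightarrow> real \<Rightarrow> real \<Rightarrow> real \<Rightarrow> real" where
  "damping_threshold G S P L = 2 + \<bar>8 * stretch_bound (G + 1) S P L / (1 - P / L)\<bar>"

theorem theorem11:
  "\<exists>\<delta>0 :: real \<Rightarrow> real \<Rightarrow> real \<Rightarrow> real \<Rightarrow> real.
     (\<forall>G S P \<Lambda>. 0 < \<delta>0 G S P \<Lambda>) \<and>
     (\<forall>(l :: real) (S :: real) (P :: real) (g :: real \<Rightarrow> real \<times> real \<Rightarrow> real) (g_inf :: real) (\<delta> :: real).
        0 < l \<and> l < pi \<and> 0 < S \<and> 0 \<le> P \<and> P < lambda1 l \<and>
        C0_curve (L2_space (plate l)) (L2_norm (plate l)) g \<and>
        Limsup at_top (\<lambda>t. ereal (L2_norm (plate l) (g t))) = ereal g_inf \<and>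
        (\<forall>t\<ge>0. even_in_y l (g t)) \<and>
        \<delta>0 g_inf S P (lambda1 l) < \<delta> \<longrightarrow>
        (\<exists>\<eta>>0. \<forall>u ut. weak_solution l \<delta> S P g u ut \<longrightarrow>
           ((\<lambda>t. exp (\<eta> * t) *
                 ((L2_norm (plate l) (torsional (ut t)))\<^sup>2 +
                  (H2_star_norm l (torsional (u t)))\<^sup>2)) \<longlongrightarrow> 0) at_top))"
proof (intro exI[of _ damping_threshold] conjI allI impI)
  show "0 < damping_threshold G S P \<Lambda>" for G S P \<Lambda>
    by (simp add: damping_threshold_def add_pos_nonneg)
  fix l S P g_inf \<delta> :: real and g :: "real \<Rightarrow> real \<times> real \<Rightarrow> real"
  assume *: "0 < l \<and> l < pi \<and> 0 < S \<and> 0 \<le> P \<and> P < lambda1 l \<and>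
        C0_curve (L2_space (plate l)) (L2_norm (plate l)) g \<and>
        Limsup at_top (\<lambda>t. ereal (L2_norm (plate l) (g t))) = ereal g_inf \<and>
        (\<forall>t\<ge>0. even_in_y l (g t)) \<and>
        damping_threshold g_inf S P (lambda1 l) < \<delta>"
  interpret plate_width l by unfold_locales (use * in simp)
  let ?B = "stretch_bound (g_inf + 1) S P \<Lambda>"
  define \<eta> where "\<eta> = \<delta> / 16 * (1 - P / \<Lambda>) / (1 + \<delta>\<^sup>2 / \<Lambda>)"
  have \<Lambda>: "0 < \<Lambda>" and \<theta>: "0 < 1 - P / \<Lambda>" using * by auto
  have \<delta>: "2 \<le> \<delta>" "8 * ?B / (1 - P / \<Lambda>) \<le> \<delta>"
  proof -
    have "2 + \<bar>8 * ?B / (1 - P / \<Lambda>)\<bar> < \<delta>" using * unfolding damping_threshold_def by blast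
    then show "2 \<le> \<delta>" "8 * ?B / (1 - P / \<Lambda>) \<le> \<delta>" by linarith+
  qed
  have "8 * ?B \<le> \<delta> * (1 - P / \<Lambda>)" using \<delta>(2) \<theta> by (simp only: pos_divide_le_eq)
  also have "\<dots> \<le> \<delta>\<^sup>2 * (1 - P / \<Lambda>)"
    using \<delta>(1) \<theta> by (intro mult_right_mono) (auto simp: power2_eq_square)
  finally have \<delta>2: "8 * ?B \<le> \<delta>\<^sup>2 * (1 - P / \<Lambda>)" .
  have "\<forall>\<^sub>F t in at_top. ereal (L2_norm \<Omega> (g t)) < ereal (g_inf + 1)"
    by (rule Limsup_lessD) (use * in simp)
  then have G: "\<forall>\<^sub>F t in at_top. L2_norm \<Omega> (g t) \<le> g_inf + 1" by eventually_elim simp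
  have "0 < 1 + \<delta>\<^sup>2 / \<Lambda>" using \<Lambda> by (simp add: add_pos_nonneg)
  then have "0 < \<eta>" unfolding \<eta>_def using \<delta>(1) \<theta> by (intro divide_pos_pos mult_pos_pos) auto
  then show "\<exists>\<eta>>0. \<forall>u ut. weak_solution l \<delta> S P g u ut \<longrightarrow>
           ((\<lambda>t. exp (\<eta> * t) *
                 ((L2_norm (plate l) (torsional (ut t)))\<^sup>2 +
                  (H2_star_norm l (torsional (u t)))\<^sup>2)) \<longlongrightarrow> 0) at_top"
    using weak_solution_torsional_decay[OF _ _ _ G _ _ _ _ \<delta>(1) \<delta>2 \<eta>_def] * by blast
qed

end
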